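(* Let $d,n\ge1$ be integers and let $A$ be a linear operator with constant coefficients from $(H^{t/2}(\mathbb{R}^d))^n$ to $(H^{-t/2}(\mathbb{R}^d))^n$ whose symbol matrix $M(\xi)\in\mathbb{C}^{n\times n}$ satisfies: (i) $M$ is continuous; (ii) $M$ is almost everywhere invertible on $\mathbb{R}^d$ in the sense of Riemann measure, i.e. for every compact set $K\subset\mathbb{R}^d$ the subset of $K$ where $M(\xi)$ is not invertible has vanishing Riemann measure; (iii) for all $i\in\{1,\dots,d\}$, $M(\xi_1,\dots,-\xi_i,\dots,\xi_d)=M(\xi_1,\dots,\xi_i,\dots,\xi_d)$. Then the equation $A\mathbf u=\mathbf v$ can be solved numerically with a wavelet packet method: for every $\varepsilon>0$ one can find, by means of the preconditioned Richardson wavelet algorithm (described in the context) used with Shannon wavelet packets, a function $\mathbf u_\varepsilon$ such that $$\|\mathbf v-A\mathbf u_\varepsilon\|<\varepsilon .$$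
   Context: $H^s(\mathbb{R}^d)$ is the Sobolev space of distributions $f$ with $(1+|\xi|^2)^{s/2}\widehat f\in L^2$. The right-hand side is $\mathbf v\in(H^{-t/2}(\mathbb{R}^d))^n$, and $\|\cdot\|$ is the norm of $(H^{-t/2}(\mathbb{R}^d))^n$. Symbol: $\widehat{A\mathbf u}(\xi)=M(\xi)\widehat{\mathbf u}(\xi)$. Functions are real-valued, so the symbol entries satisfy $m_{ij}(-\xi)=\overline{m_{ij}(\xi)}$, and $A$ is assumed continuous. Shannon wavelet packets: the Shannon wavelet $\psi$ has $\widehat\psi(\xi)=e^{-i\xi/2}\chi_{[-2\pi,-\pi]\cup[\pi,2\pi]}(\xi)$. The perfect low-pass and high-pass filters are the $2\pi$-periodic functions given on $[-\pi/2,3\pi/2]$ by $m=\chi_{[-\pi/2,\pi/2]}$ and $n(\xi)=-e^{-i\xi}\chi_{[\pi/2,3\pi/2]}(\xi)$. From $\psi$ one forms $\psi_{(10)},\psi_{(11)}$ with $\widehat{\psi_{(10)}}(2\xi)=m(\xi)\widehat\psi(\xi)$ and $\widehat{\psi_{(11)}}(2\xi)=n(\xi)\widehat\psi(\xi)$. This operation, which halves the Fourier support relative to that of the wavelet, may be iterated arbitrarily often. Tensor products of dilates and translates of such packets give decompositions $\mathbf v=\sum_{\mathbf j\in J}\mathbf v_{\mathbf j}$ ($J$ a countable set of levels) in which the Fourier transforms of the $\mathbf v_{\mathbf j}$ are supported on the pieces of a partition of the frequency domain. $P_{\mathbf j}$ is the projector $\mathbf v\mapsto\mathbf v_{\mathbf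 j}$. Algorithm: for each $\mathbf j\in J$ choose a constant matrix $M_{\omega_{\mathbf j}}\in\mathbb{R}^{n\times n}$ approximating $M(\xi)$ on the Fourier support of $\mathbf v_{\mathbf j}$, put $M_\omega^\dagger=\sum_{\mathbf j\in J}M_{\omega_{\mathbf j}}^\dagger P_{\mathbf j}$ ($^\dagger$ on matrices being the pseudo-inverse; it is applied to the wavelet packet coefficients), and iterate $$\mathbf u_0=0,\quad\mathbf v_0=\mathbf v,\quad\mathbf u_{p+1}=\mathbf u_p+M_\omega^\dagger\mathbf v_p,\quad\mathbf v_{p+1}=\mathbf v_p-A(\mathbf u_{p+1}-\mathbf u_p).$$ *)

theory Defs
  imports "HOL-Analysis.Analysis"
begin

section \<open>Tempered distributions\<close>

definition partial_deriv :: "'d::finite \<Rightarrow> (real^'d \<Rightarrow> complex) \<Rightarrow> real^'d \<Rightarrow> complex" where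
  "partial_deriv i f x = vector_derivative (\<lambda>h. f (x + h *\<^sub>R axis i 1)) (at 0)"

definition iter_partial :: "'d::finite list \<Rightarrow> (real^'d \<Rightarrow> complex) \<Rightarrow> real^'d \<Rightarrow> complex" where
  "iter_partial is f = foldr partial_deriv is f"

definition schwartz :: "(real^'d::finite \<Rightarrow> complex) \<Rightarrow> bool" where
  "schwartz f \<longleftrightarrow> (\<forall>is. (\<forall>x. iter_partial is f differentiable (at x)) \<and>
     (\<forall>N. bdd_above (range (\<lambda>x. (1 + norm x) ^ N * norm (iter_partial is f x)))))"

definition schwartz_seminorm :: "nat \<Rightarrow> (real^'d::finite \<Rightarrow> complex) \<Rightarrow> real" where
  "schwartz_seminorm N f =
     (SUP (is, x) \<in> {is. length is \<le> N} \<times> UNIV. (1 + norm x) ^ N * norm (iter_partial is f x))"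

text \<open>A tempered distribution is a continuous linear functional on the Schwartz space. The
  functionals are defined on all functions; the value 0 outside the Schwartz space makes equality
  of functionals coincide with equality of distributions.\<close>

definition tempered_functional :: "((real^'d::finite \<Rightarrow> complex) \<Rightarrow> complex) \<Rightarrow> bool" where
  "tempered_functional T \<longleftrightarrow>
     (\<forall>f g a b. schwartz f \<longrightarrow> schwartz g \<longrightarrow> T (\<lambda>x. a * f x + b * g x) = a * T f + b * T g) \<and>
     (\<exists>N C. \<forall>f. schwartz f \<longrightarrow> norm (T f) \<le> C * schwartz_seminorm N f) \<and>
     (\<forall>f. \<not> schwartz f \<longrightarrow> T f = 0)"

lemma schwartz_seminorm_bdd:
  assumes "schwartz f"
  shows "bdd_above ((\<lambda>(is, x). (1 + norm x) ^ N * norm (iter_partial is f x))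
           ` ({is :: 'd::finite list. length is \<le> N} \<times> (UNIV :: (real^'d) set)))"
proof -
  have "finite {is :: 'd list. set is \<subseteq> UNIV \<and> length is \<le> N}"
    by (rule finite_lists_length_le) simp
  then have "finite {is :: 'd list. length is \<le> N}"
    by simp
  moreover have "(\<lambda>(is, x). (1 + norm x) ^ N * norm (iter_partial is f x))
           ` ({is :: 'd list. length is \<le> N} \<times> (UNIV :: (real^'d) set)) =
      (\<Union>is\<in>{is :: 'd list. length is \<le> N}. range (\<lambda>x. (1 + norm x) ^ N * norm (iter_partial is f x)))"
    by auto
  ultimately show ?thesis
    using assms by (simp add: schwartz_def bdd_above_UN)
qed

lemma schwartz_seminorm_nonneg:
  fixes f :: "real^'d::finite \<Rightarrow> complex"
  assumes "schwartz f"
  shows "0 \<le> schwartz_seminorm N f"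
proof -
  have "0 \<le> (1 + norm (0 :: real^'d)) ^ N * norm (iter_partial [] f 0)"
    by simp
  also have "\<dots> \<le> schwartz_seminorm N f"
    unfolding schwartz_seminorm_def
    by (rule cSUP_upper2[OF schwartz_seminorm_bdd[OF assms], where x = "([], 0)"]) auto
  finally show ?thesis .
qed

lemma schwartz_seminorm_mono:
  assumes "schwartz f" "N \<le> N'"
  shows "schwartz_seminorm N f \<le> schwartz_seminorm N' f"
  unfolding schwartz_seminorm_def
proof (rule cSUP_mono[OF _ schwartz_seminorm_bdd[OF assms(1)]])
  show "{is :: 'a list. length is \<le> N} \<times> (UNIV :: (real^'a) set) \<noteq> {}"
    by (auto intro: exI[of _ "[]"])
next
  fix p assume "p \<in> {is :: 'a list. length is \<le> N} \<times> (UNIV :: (real^'a) set)"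
  then obtain "is" x where p: "p = (is, x)" "length is \<le> N" by auto
  have "(1 + norm x) ^ N * norm (iter_partial is f x) \<le> (1 + norm x) ^ N' * norm (iter_partial is f x)"
    by (intro mult_right_mono power_increasing assms) auto
  then show "\<exists>m\<in>{is. length is \<le> N'} \<times> UNIV.
      (case p of (is, x) \<Rightarrow> (1 + norm x) ^ N * norm (iter_partial is f x))
      \<le> (case m of (is, x) \<Rightarrow> (1 + norm x) ^ N' * norm (iter_partial is f x))"
    using p assms(2) by (intro bexI[of _ p]) auto
qed

typedef (overloaded) 'd tempered =
  "{T :: (real^'d::finite \<Rightarrow> complex) \<Rightarrow> complex. tempered_functional T}"
  morphisms apply_dist Tempered
  by (rule exI[of _ "\<lambda>_. 0"]) (auto simp: tempered_functional_def intro!: exI[of _ 0])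

lemma tempered_functional_zero: "tempered_functional (\<lambda>_. 0)"
  by (auto simp: tempered_functional_def intro!: exI[of _ 0])

lemma tempered_functional_add:
  assumes "tempered_functional S" "tempered_functional T"
  shows "tempered_functional (\<lambda>f. S f + T f)"
proof -
  obtain N C N' C' where
    S: "\<And>f. schwartz f \<Longrightarrow> norm (S f) \<le> C * schwartz_seminorm N f" and
    T: "\<And>f. schwartz f \<Longrightarrow> norm (T f) \<le> C' * schwartz_seminorm N' f"
    using assms unfolding tempered_functional_def by metis
  have "norm (S f + T f) \<le> (\<bar>C\<bar> + \<bar>C'\<bar>) * schwartz_seminorm (max N N') f" if f: "schwartz f" for f
  proof -
    have "norm (S f) \<le> \<bar>C\<bar> * schwartz_seminorm (max N N') f"
      by (rule order_trans[OF S[OF f]], rule mult_mono)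
        (auto intro: schwartz_seminorm_mono schwartz_seminorm_nonneg f)
    moreover have "norm (T f) \<le> \<bar>C'\<bar> * schwartz_seminorm (max N N') f"
      by (rule order_trans[OF T[OF f]], rule mult_mono)
        (auto intro: schwartz_seminorm_mono schwartz_seminorm_nonneg f)
    ultimately show ?thesis
      using norm_triangle_ineq[of "S f" "T f"] by (simp add: algebra_simps)
  qed
  then have "\<exists>N C. \<forall>f. schwartz f \<longrightarrow> norm (S f + T f) \<le> C * schwartz_seminorm N f"
    by blast
  then show ?thesis
    using assms unfolding tempered_functional_def by (simp add: algebra_simps)
qed

lemma tempered_functional_scaleR:
  assumes "tempered_functional T"
  shows "tempered_functional (\<lambda>f. c *\<^sub>R T f)"
proof -
  obtain N C where T: "\<And>f. schwartz f \<Longrightarrow> norm (T f) \<le> C * schwartz_seminorm N f"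
    using assms unfolding tempered_functional_def by metis
  have "norm (c *\<^sub>R T f) \<le> (\<bar>c\<bar> * C) * schwartz_seminorm N f" if "schwartz f" for f
    using mult_left_mono[OF T[OF that], of "\<bar>c\<bar>"] by (simp add: mult.assoc)
  then have "\<exists>N C. \<forall>f. schwartz f \<longrightarrow> norm (c *\<^sub>R T f) \<le> C * schwartz_seminorm N f"
    by blast
  then show ?thesis
    using assms unfolding tempered_functional_def by (simp add: scaleR_conv_of_real algebra_simps)
qed

setup_lifting type_definition_tempered

instantiation tempered :: (finite) real_vector
begin

lift_definition zero_tempered :: "'a tempered" is "\<lambda>_. 0"
  by (rule tempered_functional_zero)

lift_definition plus_tempered :: "'a tempered \<Rightarrow> 'a tempered \<Rightarrow> 'a tempered"
  is "\<lambda>S T f. S f + T f"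
  by (rule tempered_functional_add)

lift_definition scaleR_tempered :: "real \<Rightarrow> 'a tempered \<Rightarrow> 'a tempered"
  is "\<lambda>c T f. c *\<^sub>R T f"
  by (rule tempered_functional_scaleR)

lift_definition uminus_tempered :: "'a tempered \<Rightarrow> 'a tempered" is "\<lambda>T f. - T f"
  using tempered_functional_scaleR[where c = "-1"] by simp

lift_definition minus_tempered :: "'a tempered \<Rightarrow> 'a tempered \<Rightarrow> 'a tempered"
  is "\<lambda>S T f. S f - T f"
  using tempered_functional_add tempered_functional_scaleR[where c = "-1"] by fastforce

instance
  by standard (transfer; simp add: fun_eq_iff algebra_simps)+

end

section \<open>Fourier transform and Sobolev spaces\<close>

definition fourier :: "(real^'d::finite \<Rightarrow> complex) \<Rightarrow> real^'d \<Rightarrow> complex" where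
  "fourier f \<xi> = (LINT x|lborel. cis (- (\<xi> \<bullet> x)) * f x)"

text \<open>The Fourier transform of a distribution, defined by duality, is a function.\<close>

definition has_fourier :: "'d::finite tempered \<Rightarrow> (real^'d \<Rightarrow> complex) \<Rightarrow> bool" where
  "has_fourier T g \<longleftrightarrow> g \<in> borel_measurable borel \<and>
     (\<forall>f. schwartz f \<longrightarrow> integrable lborel (\<lambda>\<xi>. g \<xi> * f \<xi>) \<and>
        apply_dist T (fourier f) = (LINT \<xi>|lborel. g \<xi> * f \<xi>))"

text \<open>The choice is among functions that agree almost everywhere.\<close>

definition ft :: "'d::finite tempered \<Rightarrow> real^'d \<Rightarrow> complex" where
  "ft T = (SOME g. has_fourier T g)"

definition real_valued :: "'d::finite tempered \<Rightarrow> bool" where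
  "real_valued T \<longleftrightarrow> (\<forall>f. schwartz f \<longrightarrow> apply_dist T (\<lambda>x. cnj (f x)) = cnj (apply_dist T f))"

definition sobolev :: "real \<Rightarrow> 'd::finite tempered set" where
  "sobolev s = {T. real_valued T \<and> (\<exists>g. has_fourier T g \<and>
     integrable lborel (\<lambda>\<xi>. ((1 + (norm \<xi>)\<^sup>2) powr (s / 2) * cmod (g \<xi>))\<^sup>2))}"

definition sobolev_norm :: "real \<Rightarrow> 'd::finite tempered \<Rightarrow> real" where
  "sobolev_norm s T = sqrt (LINT \<xi>|lborel. ((1 + (norm \<xi>)\<^sup>2) powr (s / 2) * cmod (ft T \<xi>))\<^sup>2)"

definition sobolev_vec :: "real \<Rightarrow> ('d::finite tempered ^ 'n::finite) set" where
  "sobolev_vec s = {u. \<forall>i. u $ i \<in> sobolev s}"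

definition sobolev_vec_norm :: "real \<Rightarrow> 'd::finite tempered ^ 'n::finite \<Rightarrow> real" where
  "sobolev_vec_norm s u = sqrt (\<Sum>i\<in>UNIV. (sobolev_norm s (u $ i))\<^sup>2)"

text \<open>Unconditional convergence of the series to \<open>w\<close> in the norm of \<open>(H\<^sup>s)\<^sup>n\<close>.\<close>

definition sobolev_has_sum ::
  "real \<Rightarrow> ('k \<Rightarrow> 'd::finite tempered ^ 'n::finite) \<Rightarrow> 'k set \<Rightarrow> 'd tempered ^ 'n \<Rightarrow> bool" where
  "sobolev_has_sum s f I w \<longleftrightarrow> (\<forall>k\<in>I. f k \<in> sobolev_vec s) \<and> w \<in> sobolev_vec s \<and>
     ((\<lambda>F. sobolev_vec_norm s (w - sum f F)) \<longlongrightarrow> 0) (finite_subsets_at_top I)"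

section \<open>Constant coefficient operators\<close>

text \<open>Linear continuous operators \<open>(H\<^sup>t\<^sup>/\<^sup>2)\<^sup>n \<rightarrow> (H\<^sup>-\<^sup>t\<^sup>/\<^sup>2)\<^sup>n\<close> with symbol matrix \<open>M\<close>;
  the values of \<open>A\<close> outside \<open>(H\<^sup>t\<^sup>/\<^sup>2)\<^sup>n\<close> are irrelevant.\<close>

definition const_coeff_operator ::
  "real \<Rightarrow> (real^'d::finite \<Rightarrow> complex^'n^'n) \<Rightarrow>
   ('d tempered ^ 'n \<Rightarrow> 'd tempered ^ 'n::finite) \<Rightarrow> bool" where
  "const_coeff_operator t M A \<longleftrightarrow>
     (\<forall>u\<in>sobolev_vec (t / 2). A u \<in> sobolev_vec (- t / 2)) \<and>
     (\<forall>u\<in>sobolev_vec (t / 2). \<forall>w\<in>sobolev_vec (t / 2). \<forall>a b.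
        A (a *\<^sub>R u + b *\<^sub>R w) = a *\<^sub>R A u + b *\<^sub>R A w) \<and>
     (\<exists>C. \<forall>u\<in>sobolev_vec (t / 2). sobolev_vec_norm (- t / 2) (A u) \<le> C * sobolev_vec_norm (t / 2) u) \<and>
     (\<forall>u\<in>sobolev_vec (t / 2). AE \<xi> in lborel.
        (\<chi> i. ft (A u $ i) \<xi>) = M \<xi> *v (\<chi> j. ft (u $ j) \<xi>))"

text \<open>Riemann (Jordan) measure zero: finite covers by boxes of arbitrarily small total volume.\<close>

definition riemann_null :: "(real^'d::finite) set \<Rightarrow> bool" where
  "riemann_null S \<longleftrightarrow> (\<forall>e>0. \<exists>D. finite D \<and> S \<subseteq> (\<Union>(a, b)\<in>D. cbox a b) \<and>
     (\<Sum>(a, b)\<in>D. measure lborel (cbox a b)) < e)"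

section \<open>Shannon wavelet packets\<close>

definition shannon_hat :: "real \<Rightarrow> complex" where
  "shannon_hat \<xi> = cis (- \<xi> / 2) * indicator ({-2 * pi..-pi} \<union> {pi..2 * pi}) \<xi>"

text \<open>The representative of \<open>\<xi>\<close> modulo \<open>2\<pi>\<close> in \<open>[-\<pi>/2, 3\<pi>/2)\<close>.\<close>

definition wrap :: "real \<Rightarrow> real" where
  "wrap \<xi> = \<xi> - 2 * pi * of_int \<lfloor>(\<xi> + pi / 2) / (2 * pi)\<rfloor>"

definition lowpass :: "real \<Rightarrow> complex" where
  "lowpass \<xi> = indicator {-pi / 2..pi / 2} (wrap \<xi>)"

definition highpass :: "real \<Rightarrow> complex" where
  "highpass \<xi> = - cis (- wrap \<xi>) * indicator {pi / 2..3 * pi / 2} (wrap \<xi>)"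

text \<open>Fourier transforms of the packets \<open>\<psi>\<^sub>w\<close>; the head of the word \<open>w\<close> is the filter applied last
  (\<open>False\<close>: low-pass, \<open>True\<close>: high-pass). Thus \<open>[False]\<close> is \<open>\<psi>\<^sub>(\<^sub>1\<^sub>0\<^sub>)\<close> and \<open>[True]\<close> is \<open>\<psi>\<^sub>(\<^sub>1\<^sub>1\<^sub>)\<close>.\<close>

fun packet_hat1 :: "bool list \<Rightarrow> real \<Rightarrow> complex" where
  "packet_hat1 [] \<xi> = shannon_hat \<xi>"
| "packet_hat1 (b # w) \<xi> = (if b then highpass (\<xi> / 2) else lowpass (\<xi> / 2)) * packet_hat1 w (\<xi> / 2)"

text \<open>A level consists of a dilation exponent \<open>j\<close> and a filter word \<open>w\<close> in each coordinate.\<close>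

type_synonym 'd level = "(int \<times> bool list) ^ 'd"

text \<open>Fourier transform of the tensor product of the functions \<open>2\<^sup>j\<^sup>/\<^sup>2 \<psi>\<^sub>w(2\<^sup>j x\<^sub>i - k\<^sub>i)\<close>.\<close>

definition packet_hat :: "'d::finite level \<Rightarrow> int^'d \<Rightarrow> real^'d \<Rightarrow> complex" where
  "packet_hat l k \<xi> = (\<Prod>i\<in>UNIV. case l $ i of (j, w) \<Rightarrow>
     complex_of_real (2 powr (- of_int j / 2)) * cis (- of_int (k $ i) * (2 powi (- j) * \<xi> $ i)) *
       packet_hat1 w (2 powi (- j) * \<xi> $ i))"

definition packet :: "'d::finite level \<Rightarrow> int^'d \<Rightarrow> 'd tempered" where
  "packet l k = (THE T. has_fourier T (packet_hat l k))"

text \<open>Coefficient of \<open>v\<close> on the orthonormal family of packets: the \<open>L\<^sup>2\<close> inner product, expressed by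
  Parseval's identity so that it makes sense for \<open>v\<close> in any Sobolev space. It is real for
  real-valued \<open>v\<close>, so that taking the real part loses nothing.\<close>

definition packet_coeff :: "'d::finite level \<Rightarrow> int^'d \<Rightarrow> 'd tempered \<Rightarrow> real" where
  "packet_coeff l k v =
     Re ((LINT \<xi>|lborel. ft v \<xi> * cnj (packet_hat l k \<xi>)) / (2 * pi) ^ CARD('d))"

text \<open>The projector \<open>P\<^sub>l\<close>, acting componentwise on \<open>(H\<^sup>s)\<^sup>n\<close>.\<close>

definition packet_proj ::
  "real \<Rightarrow> 'd::finite level \<Rightarrow> 'd tempered ^ 'n::finite \<Rightarrow> 'd tempered ^ 'n" where
  "packet_proj s l v = (THE w.
     sobolev_has_sum s (\<lambda>k. \<chi> i. packet_coeff l k (v $ i) *\<^sub>R packet l k) UNIV w)"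

text \<open>The Fourier support does not depend on the translation parameter.\<close>

definition fourier_support :: "'d::finite level \<Rightarrow> (real^'d) set" where
  "fourier_support l = closure {\<xi>. packet_hat l 0 \<xi> \<noteq> 0}"

text \<open>The set \<open>J\<close> of levels (countable because the type of levels is) yields a partition of the frequency domain,
  up to null sets.\<close>

definition packet_partition :: "'d::finite level set \<Rightarrow> bool" where
  "packet_partition J \<longleftrightarrow>
     (\<forall>l\<in>J. \<forall>l'\<in>J. l \<noteq> l' \<longrightarrow> negligible (fourier_support l \<inter> fourier_support l')) \<and>
     negligible (- (\<Union>l\<in>J. fourier_support l))"

section \<open>The preconditioned Richardson iteration\<close>

definition pseudo_inverse :: "real^'n^'n \<Rightarrow> real^'n^'n::finite" where
  "pseudo_inverse B = (THE X. B ** X ** B = B \<and> X ** B ** X = X \<and>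
     transpose (B ** X) = B ** X \<and> transpose (X ** B) = X ** B)"

definition matrix_act :: "real^'n^'n \<Rightarrow> 'd::finite tempered ^ 'n \<Rightarrow> 'd tempered ^ 'n::finite" where
  "matrix_act B u = (\<chi> i. \<Sum>j\<in>UNIV. (B $ i $ j) *\<^sub>R u $ j)"

text \<open>On each Fourier support the constant matrix approximates the symbol up to \<open>\<delta>\<close>, measured
  relative to the norm of operators \<open>H\<^sup>t\<^sup>/\<^sup>2 \<rightarrow> H\<^sup>-\<^sup>t\<^sup>/\<^sup>2\<close>, that is, with the weight
  \<open>(1 + |\<xi>|\<^sup>2)\<^sup>t\<^sup>/\<^sup>2\<close>.\<close>

definition approximates_symbol ::
  "real \<Rightarrow> real \<Rightarrow> (real^'d::finite \<Rightarrow> complex^'n^'n) \<Rightarrow> 'd level set \<Rightarrow>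
   ('d level \<Rightarrow> real^'n^'n::finite) \<Rightarrow> bool" where
  "approximates_symbol \<delta> t M J B \<longleftrightarrow> (\<forall>l\<in>J. \<forall>\<xi>\<in>fourier_support l.
     norm (M \<xi> - map_matrix complex_of_real (B l)) \<le> \<delta> * (1 + (norm \<xi>)\<^sup>2) powr (t / 2))"

text \<open>\<open>u\<close> and \<open>r\<close> are the sequences of iterates \<open>u\<^sub>p\<close> and residuals \<open>v\<^sub>p\<close>. The series
  defining the preconditioner applied to \<open>v\<^sub>p\<close> is required to converge in the domain of \<open>A\<close>.\<close>

definition richardson ::
  "real \<Rightarrow> ('d tempered ^ 'n \<Rightarrow> 'd tempered ^ 'n) \<Rightarrow> 'd::finite level set \<Rightarrow>
   ('d level \<Rightarrow> real^'n^'n::finite) \<Rightarrow> 'd tempered ^ 'n \<Rightarrow>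
   (nat \<Rightarrow> 'd tempered ^ 'n) \<Rightarrow> (nat \<Rightarrow> 'd tempered ^ 'n) \<Rightarrow> bool" where
  "richardson t A J B v u r \<longleftrightarrow> u 0 = 0 \<and> r 0 = v \<and>
     (\<forall>p. (\<exists>w. sobolev_has_sum (t / 2)
              (\<lambda>l. matrix_act (pseudo_inverse (B l)) (packet_proj (- t / 2) l (r p))) J w \<and>
            u (Suc p) = u p + w) \<and>
          r (Suc p) = r p - A (u (Suc p) - u p))"

end

theory Submission
  imports Defs "HOL-Probability.Sinc_Integral" "HOL-Computational_Algebra.Polynomial"
begin

text \<open>On the Fourier side the distributions in \<open>H\<^sup>s\<close> are the Hermitian functions that are square integrable
  with the weight \<open>(1 + \<bar>\<xi>\<bar>\<^sup>2)\<^sup>s\<close>; a packet projection multiplies by the indicator of a union of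
  \<open>2\<^sup>d\<close> reflected boxes, because the exponentials of a level form an orthogonal basis there; and one step of
  the iteration multiplies the residual by \<open>I - M B\<^sup>-\<^sup>1\<close>. By (iii) and reality, \<open>M\<close> is real and nearly
  constant on the boxes of a sufficiently fine partition. With \<open>B\<close> chosen \<open>\<tau>\<close>-close to \<open>M\<close> and
  \<open>\<bar>B\<^sup>-\<^sup>1\<bar> \<le> 1 / \<tau>\<close> (relative to the weight), \<open>I - M B\<^sup>-\<^sup>1 = (B - M) B\<^sup>-\<^sup>1\<close> is bounded uniformly
  in \<open>\<tau>\<close> and tends to \<open>0\<close> as \<open>\<tau> \<rightarrow> 0\<close> wherever \<open>M\<close> is invertible. By dominated convergence
  the first residual already has norm less than \<open>\<epsilon>\<close> when \<open>\<tau>\<close> is small.\<close>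

section \<open>Schwartz functions\<close>

text \<open>\<open>M\<close> is merely continuous and may be singular on a null set, so there is
  neither a uniform modulus of continuity nor a bound on its inverses. The first defect is met by
  letting the depth of subdivision depend on the dyadic cell, where compactness suffices. The second
  is met by spending one parameter twice: \<open>B\<close> may miss \<open>M\<close> by \<tau>, and
  this freedom is used to move it away from the singular matrices. A matrix of maximal |det| in the
  cube of radius \<tau> realises the inverse bound.

  The reflected boxes come from the filters, whose pass bands are symmetric about 0, so a packet
  carries both signs of every frequency. Condition (iii) makes the symbol agree on all reflections,
  so that one constant matrix can serve the whole union.

  Because the transform of a distribution is defined by duality, the passage to functions rests on
  two facts about test functions: \<open>fourier\<close> maps the Schwartz space onto itself, and
  Schwartz functions separate measurable functions up to null sets. One Stone-Weierstrass argument
  on the torus gives both this separation and the completeness of the exponentials on a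
  shell.\<close>

lemma iter_partial_simps [simp]:
  "iter_partial [] f = f"
  "iter_partial (i # is) f = partial_deriv i (iter_partial is f)"
  by (simp_all add: iter_partial_def)

lemma iter_partial_append: "iter_partial (is @ js) f = iter_partial is (iter_partial js f)"
  by (simp add: iter_partial_def)

text \<open>Stability of a class under \<open>partial_deriv\<close> puts all iterated derivatives
  into the class, so differentiability and decay need checking for its members only. Each closure
  property then costs one product or chain rule instead of a formula for
  \<open>iter_partial\<close>.\<close>

lemma schwartz_coinduct:
  assumes "P f"
    and diff: "\<And>f x. P f \<Longrightarrow> f differentiable (at x)"
    and bdd: "\<And>f N. P f \<Longrightarrow> \<exists>C. \<forall>x. (1 + norm x) ^ N * norm (f x) \<le> C"
    and step: "\<And>f i. P f \<Longrightarrow> P (partial_deriv i f)"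
  shows "schwartz f"
proof -
  have P: "P (iter_partial is f)" for "is"
    by (induction "is") (auto intro: step \<open>P f\<close>)
  have "bdd_above (range (\<lambda>x. (1 + norm x) ^ N * norm (iter_partial is f x)))" for N "is"
    using bdd[OF P, of N "is"] by (auto simp: bdd_above_def)
  with diff[OF P] show ?thesis
    unfolding schwartz_def by (intro allI conjI) simp_all
qed

lemma schwartz_differentiable: "schwartz f \<Longrightarrow> f differentiable (at x)"
  unfolding schwartz_def by (metis iter_partial_simps(1))

lemma schwartz_partial_deriv:
  assumes "schwartz f"
  shows "schwartz (partial_deriv i f)"
proof -
  have "iter_partial is (partial_deriv i f) = iter_partial (is @ [i]) f" for "is"
    by (simp add: iter_partial_append)
  then show ?thesis
    using assms unfolding schwartz_def by presburger
qed

lemma schwartz_iter_partial: "schwartz f \<Longrightarrow> schwartz (iter_partial is f)"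
  by (induction "is") (auto intro: schwartz_partial_deriv)

lemma schwartz_decay:
  assumes "schwartz f"
  obtains C where "0 \<le> C" "\<And>x. (1 + norm x) ^ N * norm (f x) \<le> C"
proof -
  have "bdd_above (range (\<lambda>x. (1 + norm x) ^ N * norm (f x)))"
    using assms unfolding schwartz_def by (metis iter_partial_simps(1))
  then obtain C where C: "\<And>x. (1 + norm x) ^ N * norm (f x) \<le> C"
    by (auto simp: bdd_above_def)
  moreover have "0 \<le> C"
    by (rule order_trans[OF _ C[of 0]]) simp
  ultimately show ?thesis using that by blast
qed

lemma schwartz_seminorm_ge:
  assumes "schwartz f" "length is \<le> N"
  shows "(1 + norm x) ^ N * norm (iter_partial is f x) \<le> schwartz_seminorm N f"
  unfolding schwartz_seminorm_def
  by (rule cSUP_upper2[OF schwartz_seminorm_bdd[OF assms(1)], where x = "(is, x)"]) (use assms in auto)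

lemma schwartz_continuous: "schwartz f \<Longrightarrow> continuous_on UNIV f"
  by (meson continuous_at_imp_continuous_on differentiable_imp_continuous_within schwartz_differentiable)

lemma schwartz_measurable [measurable_dest]: "schwartz f \<Longrightarrow> f \<in> borel_measurable borel"
  by (intro borel_measurable_continuous_onI schwartz_continuous)

text \<open>\<open>partial_deriv\<close> differentiates at parameter 0 of a line; moving the base
  point along that line gives the derivative at every parameter \<open>s\<close>, as a mean value
  estimate on a segment requires.\<close>

lemma partial_deriv_has_vector_derivative:
  assumes "f differentiable (at (x + s *\<^sub>R axis i 1))"
  shows "((\<lambda>h. f (x + h *\<^sub>R axis i 1)) has_vector_derivative
    partial_deriv i f (x + s *\<^sub>R axis i 1)) (at s)"
proof -
  obtain D where D: "(f has_derivative D) (at (x + s *\<^sub>R axis i 1))"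
    using assms by (auto simp: differentiable_def)
  have lin: "linear D" using D has_derivative_linear by blast
  have key: "((\<lambda>h. f (y + h *\<^sub>R axis i 1)) has_vector_derivative D (axis i 1)) (at r)"
    if "y + r *\<^sub>R axis i 1 = x + s *\<^sub>R axis i 1" for y r
  proof -
    have "((\<lambda>h. y + h *\<^sub>R axis i 1) has_derivative (\<lambda>h. h *\<^sub>R axis i 1)) (at r)"
      by (auto intro!: derivative_eq_intros)
    from has_derivative_compose[OF this, of f D] D that
    have "((\<lambda>h. f (y + h *\<^sub>R axis i 1)) has_derivative (\<lambda>h. D (h *\<^sub>R axis i 1))) (at r)"
      by simp
    then show ?thesis
      by (simp add: has_vector_derivative_def linear_scale[OF lin])
  qed
  have "partial_deriv i f (x + s *\<^sub>R axis i 1) = D (axis i 1)"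
    unfolding partial_deriv_def by (rule vector_derivative_at, rule key) simp
  with key[of x s] show ?thesis by simp
qed

lemma partial_deriv_eq:
  assumes "(f has_derivative D) (at x)"
  shows "partial_deriv i f x = D (axis i 1)"
proof -
  have lin: "linear D" using assms has_derivative_linear by blast
  have "((\<lambda>h. x + h *\<^sub>R axis i 1) has_derivative (\<lambda>h. h *\<^sub>R axis i 1)) (at 0)"
    by (auto intro!: derivative_eq_intros)
  from has_derivative_compose[OF this, of f D] assms
  have "((\<lambda>h. f (x + h *\<^sub>R axis i 1)) has_derivative (\<lambda>h. D (h *\<^sub>R axis i 1))) (at 0)"
    by simp
  then have "((\<lambda>h. f (x + h *\<^sub>R axis i 1)) has_vector_derivative D (axis i 1)) (at 0)"
    by (simp add: has_vector_derivative_def linear_scale[OF lin])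
  then show ?thesis
    unfolding partial_deriv_def by (rule vector_derivative_at)
qed

lemma partial_deriv_lincomb:
  assumes "\<And>x. f differentiable (at x)" "\<And>x. g differentiable (at x)"
  shows "partial_deriv i (\<lambda>x. a * f x + b * g x) = (\<lambda>x. a * partial_deriv i f x + b * partial_deriv i g x)"
proof
  fix x
  obtain D E where D: "(f has_derivative D) (at x)" and E: "(g has_derivative E) (at x)"
    using assms unfolding differentiable_def by blast
  have "((\<lambda>x. a * f x + b * g x) has_derivative (\<lambda>h. a * D h + b * E h)) (at x)"
    by (auto intro!: derivative_eq_intros D E)
  from partial_deriv_eq[OF this] partial_deriv_eq[OF D] partial_deriv_eq[OF E]
  show "partial_deriv i (\<lambda>x. a * f x + b * g x) x = a * partial_deriv i f x + b * partial_deriv i g x"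
    by simp
qed

lemma has_derivative_coord_mult:
  fixes f :: "real^'d::finite \<Rightarrow> complex"
  assumes "(f has_derivative D) (at x)"
  shows "((\<lambda>x. of_real (x $ i) * f x) has_derivative
    (\<lambda>h. of_real (x $ i) * D h + of_real (h $ i) * f x)) (at x)"
proof -
  have "bounded_linear (\<lambda>x::real^'d. complex_of_real (x $ i))"
    using bounded_linear_compose[OF bounded_linear_of_real bounded_linear_vec_nth] .
  then have "((\<lambda>x::real^'d. complex_of_real (x $ i)) has_derivative (\<lambda>h. of_real (h $ i))) (at x)"
    by (rule bounded_linear_imp_has_derivative)
  from has_derivative_mult[OF this assms] show ?thesis .
qed

lemma partial_deriv_coord_mult:
  assumes "\<And>x. f differentiable (at x)"
  shows "partial_deriv k (\<lambda>x. of_real (x $ i) * f x) =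
    (\<lambda>x. of_real (x $ i) * partial_deriv k f x + (if k = i then 1 else 0) * f x)"
proof
  fix x
  obtain D where D: "(f has_derivative D) (at x)"
    using assms unfolding differentiable_def by blast
  from partial_deriv_eq[OF has_derivative_coord_mult[OF D]] partial_deriv_eq[OF D]
  show "partial_deriv k (\<lambda>x. of_real (x $ i) * f x) x =
      of_real (x $ i) * partial_deriv k f x + (if k = i then 1 else 0) * f x"
    by (simp add: axis_def)
qed

lemma decay_lincomb:
  fixes f g :: "real^'d::finite \<Rightarrow> complex"
  assumes "\<forall>x. (1 + norm x) ^ N * norm (f x) \<le> C" "\<forall>x. (1 + norm x) ^ N * norm (g x) \<le> D"
  shows "\<exists>C. \<forall>x. (1 + norm x) ^ N * norm (a * f x + b * g x) \<le> C"
proof (intro exI allI)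
  fix x
  have "norm (a * f x + b * g x) \<le> norm a * norm (f x) + norm b * norm (g x)"
    by (metis norm_mult norm_triangle_ineq)
  then have "(1 + norm x) ^ N * norm (a * f x + b * g x)
      \<le> (1 + norm x) ^ N * (norm a * norm (f x) + norm b * norm (g x))"
    by (intro mult_left_mono) auto
  also have "\<dots> = norm a * ((1 + norm x) ^ N * norm (f x)) + norm b * ((1 + norm x) ^ N * norm (g x))"
    by (simp add: algebra_simps)
  also have "\<dots> \<le> norm a * C + norm b * D"
    using assms by (intro add_mono mult_left_mono) auto
  finally show "(1 + norm x) ^ N * norm (a * f x + b * g x) \<le> norm a * C + norm b * D" .
qed

lemma decay_coord_mult:
  fixes f :: "real^'d::finite \<Rightarrow> complex"
  assumes "\<forall>x. (1 + norm x) ^ Suc N * norm (f x) \<le> C"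
  shows "\<forall>x. (1 + norm x) ^ N * norm (of_real (x $ i) * f x) \<le> C"
proof
  fix x
  have "norm (of_real (x $ i) * f x) \<le> (1 + norm x) * norm (f x)"
    using component_le_norm_cart[of x i] by (auto simp: norm_mult intro!: mult_right_mono)
  then have "(1 + norm x) ^ N * norm (of_real (x $ i) * f x) \<le> (1 + norm x) ^ N * ((1 + norm x) * norm (f x))"
    by (intro mult_left_mono) auto
  with assms show "(1 + norm x) ^ N * norm (of_real (x $ i) * f x) \<le> C"
    by (smt (verit) mult.assoc mult.commute power_Suc)
qed

section \<open>Closure properties of the Schwartz space\<close>

lemma schwartz_lincomb:
  assumes "schwartz f" "schwartz g"
  shows "schwartz (\<lambda>x. a * f x + b * g x)"
proof (rule schwartz_coinduct[where P = "\<lambda>h. \<exists>f g. schwartz f \<and> schwartz g \<and> h = (\<lambda>x. a * f x + b * g x)"])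
  show "\<exists>f' g'. schwartz f' \<and> schwartz g' \<and> (\<lambda>x. a * f x + b * g x) = (\<lambda>x. a * f' x + b * g' x)"
    using assms by (intro exI[of _ f] exI[of _ g]) simp
next
  fix h :: "real^'a \<Rightarrow> complex" and x N i
  assume "\<exists>f g. schwartz f \<and> schwartz g \<and> h = (\<lambda>x. a * f x + b * g x)"
  then obtain f g where f: "schwartz f" and g: "schwartz g" and h: "h = (\<lambda>x. a * f x + b * g x)"
    by blast
  show "h differentiable at x"
    unfolding h by (intro differentiable_add differentiable_mult differentiable_const schwartz_differentiable f g)
  show "\<exists>C. \<forall>x. (1 + norm x) ^ N * norm (h x) \<le> C"
  proof -
    obtain C where "\<forall>x. (1 + norm x) ^ N * norm (f x) \<le> C"
      using schwartz_decay[OF f, of N] by blast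
    moreover obtain D where "\<forall>x. (1 + norm x) ^ N * norm (g x) \<le> D"
      using schwartz_decay[OF g, of N] by blast
    ultimately show ?thesis
      unfolding h by (rule decay_lincomb)
  qed
  show "\<exists>f g. schwartz f \<and> schwartz g \<and> partial_deriv i h = (\<lambda>x. a * f x + b * g x)"
    unfolding h partial_deriv_lincomb[OF schwartz_differentiable[OF f] schwartz_differentiable[OF g]]
    using schwartz_partial_deriv[OF f, of i] schwartz_partial_deriv[OF g, of i]
    by (intro exI[of _ "partial_deriv i f"] exI[of _ "partial_deriv i g"]) simp
qed

lemma schwartz_cmult: "schwartz f \<Longrightarrow> schwartz (\<lambda>x. a * f x)"
  using schwartz_lincomb[of f f a 0] by simp

lemma schwartz_coord_mult:
  assumes "schwartz f"
  shows "schwartz (\<lambda>x. of_real (x $ i) * f x)"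
\<comment> \<open>Differentiating x_i f along the same axis leaves an extra f, so the multiples of
  x_i alone are not a stable class; the summand \<open>g\<close> absorbs these terms. The factors
  \<open>1\<close> give the class the shape that \<open>partial_deriv_lincomb\<close> and
  \<open>decay_lincomb\<close> match.\<close>
proof (rule schwartz_coinduct[where P = "\<lambda>h. \<exists>f g. schwartz f \<and> schwartz g \<and> h = (\<lambda>x. 1 * (of_real (x $ i) * f x) + 1 * g x)"])
  show "\<exists>f' g. schwartz f' \<and> schwartz g \<and> (\<lambda>x. of_real (x $ i) * f x) = (\<lambda>x. 1 * (of_real (x $ i) * f' x) + 1 * g x)"
    using assms schwartz_cmult[OF assms, of 0] by (intro exI[of _ f] exI[of _ "\<lambda>x. 0 * f x"]) auto
next
  have d: "(\<lambda>x. of_real (x $ i) * f x) differentiable at x" if "schwartz f"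
    for f :: "real^'a \<Rightarrow> complex" and x
    using has_derivative_coord_mult schwartz_differentiable[OF that] unfolding differentiable_def by blast
  {
    fix h :: "real^'a \<Rightarrow> complex" and x
    assume "\<exists>f g. schwartz f \<and> schwartz g \<and> h = (\<lambda>x. 1 * (of_real (x $ i) * f x) + 1 * g x)"
    then show "h differentiable at x"
      by (elim exE conjE) (simp only: mult_1, intro differentiable_add d schwartz_differentiable)
  next
    fix h :: "real^'a \<Rightarrow> complex" and N
    assume "\<exists>f g. schwartz f \<and> schwartz g \<and> h = (\<lambda>x. 1 * (of_real (x $ i) * f x) + 1 * g x)"
    then obtain f g where f: "schwartz f" and g: "schwartz g"
      and h: "h = (\<lambda>x. 1 * (of_real (x $ i) * f x) + 1 * g x)" by blast
    obtain C where "\<forall>x. (1 + norm x) ^ Suc N * norm (f x) \<le> C"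
      using schwartz_decay[OF f, of "Suc N"] by blast
    then have "\<forall>x. (1 + norm x) ^ N * norm (of_real (x $ i) * f x) \<le> C"
      by (rule decay_coord_mult)
    moreover obtain D where "\<forall>x. (1 + norm x) ^ N * norm (g x) \<le> D"
      using schwartz_decay[OF g, of N] by blast
    ultimately show "\<exists>C. \<forall>x. (1 + norm x) ^ N * norm (h x) \<le> C"
      unfolding h by (rule decay_lincomb)
  next
    fix h :: "real^'a \<Rightarrow> complex" and k
    assume "\<exists>f g. schwartz f \<and> schwartz g \<and> h = (\<lambda>x. 1 * (of_real (x $ i) * f x) + 1 * g x)"
    then obtain f g where f: "schwartz f" and g: "schwartz g"
      and h: "h = (\<lambda>x. 1 * (of_real (x $ i) * f x) + 1 * g x)" by blast
    let ?g = "\<lambda>x. (if k = i then 1 else 0) * f x + 1 * partial_deriv k g x"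
    have "partial_deriv k h = (\<lambda>x. 1 * (of_real (x $ i) * partial_deriv k f x) + 1 * ?g x)"
      unfolding h partial_deriv_lincomb[OF d[OF f] schwartz_differentiable[OF g]]
        partial_deriv_coord_mult[OF schwartz_differentiable[OF f]]
      by (auto simp: fun_eq_iff)
    moreover have "schwartz ?g"
      by (intro schwartz_lincomb f g schwartz_partial_deriv)
    ultimately show "\<exists>f g. schwartz f \<and> schwartz g \<and>
        partial_deriv k h = (\<lambda>x. 1 * (of_real (x $ i) * f x) + 1 * g x)"
      using schwartz_partial_deriv[OF f, of k] by (intro exI[of _ "partial_deriv k f"] exI[of _ ?g]) simp
  }
qed

lemma schwartz_cnj:
  assumes "schwartz f"
  shows "schwartz (\<lambda>x. cnj (f x))"
proof (rule schwartz_coinduct[where P = "\<lambda>h. \<exists>f. schwartz f \<and> h = (\<lambda>x. cnj (f x))"])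
  show "\<exists>f'. schwartz f' \<and> (\<lambda>x. cnj (f x)) = (\<lambda>x. cnj (f' x))"
    using assms by (intro exI[of _ f]) simp
next
  fix h :: "real^'a \<Rightarrow> complex" and x
  assume "\<exists>f. schwartz f \<and> h = (\<lambda>x. cnj (f x))"
  then obtain f D where f: "h = (\<lambda>x. cnj (f x))" "(f has_derivative D) (at x)"
    using schwartz_differentiable unfolding differentiable_def by blast
  then show "h differentiable at x"
    unfolding differentiable_def using has_derivative_cnj by blast
next
  fix h :: "real^'a \<Rightarrow> complex" and N
  assume "\<exists>f. schwartz f \<and> h = (\<lambda>x. cnj (f x))"
  then obtain f where f: "schwartz f" "h = (\<lambda>x. cnj (f x))" by blast
  show "\<exists>C. \<forall>x. (1 + norm x) ^ N * norm (h x) \<le> C"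
    using schwartz_decay[OF f(1), of N] unfolding f(2) complex_mod_cnj by metis
next
  fix h :: "real^'a \<Rightarrow> complex" and i
  assume "\<exists>f. schwartz f \<and> h = (\<lambda>x. cnj (f x))"
  then obtain f where f: "schwartz f" "h = (\<lambda>x. cnj (f x))" by blast
  have "partial_deriv i h x = cnj (partial_deriv i f x)" for x
  proof -
    obtain D where D: "(f has_derivative D) (at x)"
      using schwartz_differentiable[OF f(1)] unfolding differentiable_def by blast
    show ?thesis
      unfolding f(2) using partial_deriv_eq[OF has_derivative_cnj[OF D]] partial_deriv_eq[OF D] by simp
  qed
  then show "\<exists>f. schwartz f \<and> partial_deriv i h = (\<lambda>x. cnj (f x))"
    using schwartz_partial_deriv[OF f(1), of i] by (intro exI[of _ "partial_deriv i f"]) auto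
qed

lemma schwartz_reflect:
  assumes "schwartz f"
  shows "schwartz (\<lambda>x. f (- x))"
proof (rule schwartz_coinduct[where P = "\<lambda>h. \<exists>f. schwartz f \<and> h = (\<lambda>x. f (- x))"])
  show "\<exists>f'. schwartz f' \<and> (\<lambda>x. f (- x)) = (\<lambda>x. f' (- x))"
    using assms by (intro exI[of _ f]) simp
next
  have d: "((\<lambda>x. f (- x)) has_derivative (\<lambda>h. D (- h))) (at x)" if "(f has_derivative D) (at (- x))"
    for f :: "real^'a \<Rightarrow> complex" and x D
    using has_derivative_compose[OF has_derivative_minus[OF has_derivative_ident] that] by simp
  {
    fix h :: "real^'a \<Rightarrow> complex" and x
    assume "\<exists>f. schwartz f \<and> h = (\<lambda>x. f (- x))"
    then obtain f D where f: "h = (\<lambda>x. f (- x))" "(f has_derivative D) (at (- x))"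
      using schwartz_differentiable unfolding differentiable_def by blast
    then show "h differentiable at x"
      unfolding differentiable_def using d by blast
  next
    fix h :: "real^'a \<Rightarrow> complex" and N
    assume "\<exists>f. schwartz f \<and> h = (\<lambda>x. f (- x))"
    then obtain f where f: "schwartz f" "h = (\<lambda>x. f (- x))" by blast
    show "\<exists>C. \<forall>x. (1 + norm x) ^ N * norm (h x) \<le> C"
      using schwartz_decay[OF f(1), of N] unfolding f(2) by (metis norm_minus_cancel)
  next
    fix h :: "real^'a \<Rightarrow> complex" and i
    assume "\<exists>f. schwartz f \<and> h = (\<lambda>x. f (- x))"
    then obtain f where f: "schwartz f" "h = (\<lambda>x. f (- x))" by blast
    have "partial_deriv i h x = - 1 * partial_deriv i f (- x)" for x
    proof -
      obtain D where D: "(f has_derivative D) (at (- x))"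
        using schwartz_differentiable[OF f(1)] unfolding differentiable_def by blast
      have "linear D" using D has_derivative_linear by blast
      then show ?thesis
        unfolding f(2) using partial_deriv_eq[OF d[OF D]] partial_deriv_eq[OF D]
        by (simp add: linear_neg)
    qed
    then show "\<exists>f. schwartz f \<and> partial_deriv i h = (\<lambda>x. f (- x))"
      using schwartz_cmult[OF schwartz_partial_deriv[OF f(1)], of "-1"]
      by (intro exI[of _ "\<lambda>x. - 1 * partial_deriv i f x"]) auto
  }
qed

subsection \<open>Integrability\<close>

lemma prod_Basis_cart: "(\<Prod>b\<in>(Basis :: (real^'d::finite) set). f b) = (\<Prod>i\<in>UNIV. f (axis i 1))"
proof -
  have i: "inj (\<lambda>i::'d. axis i (1::real))"
    by (auto simp: inj_on_def axis_eq_axis)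
  have b: "(Basis :: (real^'d) set) = range (\<lambda>i. axis i 1)"
    by (auto simp: Basis_vec_def)
  show ?thesis
    unfolding b using i by (subst prod.reindex) simp_all
qed

text \<open>Each 1 + x_i^2 is at most (1 + |x|)^2, so the function is dominated by a product of
  one-dimensional functions 1 / (1 + t^2), integrable by Tonelli. Hence the exponent is twice the
  dimension.\<close>

lemma integrable_inverse_polynomial:
  "integrable lborel (\<lambda>x::real^'d::finite. 1 / (1 + norm x) ^ (2 * CARD('d)))"
proof -
  define p where "p x = (\<Prod>b\<in>Basis. inverse (1 + (x \<bullet> b)\<^sup>2))" for x :: "real^'d"
  have [measurable]: "p \<in> borel_measurable borel"
    unfolding p_def by measurable
  have one: "integrable lborel (\<lambda>x::real. inverse (1 + x\<^sup>2))"
    using integrable_inverse_1_plus_square by (simp add: set_integrable_def)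
  have p0: "0 \<le> p x" for x
    unfolding p_def by (intro prod_nonneg) auto
  have "(\<integral>\<^sup>+x. ennreal (norm (p x)) \<partial>lborel) = (\<integral>\<^sup>+x. (\<Prod>b\<in>Basis. ennreal (inverse (1 + (x \<bullet> b)\<^sup>2))) \<partial>(lborel :: (real^'d) measure))"
    using p0 by (simp add: p_def prod_ennreal)
  also have "\<dots> = (\<Prod>b\<in>(Basis::(real^'d) set). (\<integral>\<^sup>+x. ennreal (inverse (1 + x\<^sup>2)) \<partial>lborel))"
    by (rule nn_integral_lborel_prod) auto
  also have "\<dots> < \<infinity>"
    using one by (simp add: integrable_iff_bounded power_less_top_ennreal)
  finally have ip: "integrable lborel p"
    by (simp add: integrable_iff_bounded)
  show ?thesis
  proof (rule Bochner_Integration.integrable_bound[OF ip])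
    show "AE x in lborel. norm (1 / (1 + norm x) ^ (2 * CARD('d))) \<le> norm (p x)"
    proof (intro AE_I2)
      fix x :: "real^'d"
      have "(\<Prod>b\<in>Basis. 1 + (x \<bullet> b)\<^sup>2) \<le> (\<Prod>b\<in>(Basis::(real^'d) set). (1 + norm x)\<^sup>2)"
      proof (rule prod_mono)
        fix b :: "real^'d" assume b: "b \<in> Basis"
        have "(x \<bullet> b)\<^sup>2 \<le> (norm x)\<^sup>2"
          using Basis_le_norm[OF b, of x] by (simp add: abs_le_square_iff[symmetric])
        moreover have "(1 + norm x)\<^sup>2 = 1 + 2 * norm x + (norm x)\<^sup>2"
          by (simp add: power2_eq_square algebra_simps)
        ultimately show "0 \<le> 1 + (x \<bullet> b)\<^sup>2 \<and> 1 + (x \<bullet> b)\<^sup>2 \<le> (1 + norm x)\<^sup>2"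
          using norm_ge_zero[of x] zero_le_power2[of "x \<bullet> b"] by linarith
      qed
      also have "\<dots> = (1 + norm x) ^ (2 * CARD('d))"
        by (simp add: power_mult)
      finally have "inverse ((1 + norm x) ^ (2 * CARD('d))) \<le> inverse (\<Prod>b\<in>Basis. 1 + (x \<bullet> b)\<^sup>2)"
        by (intro le_imp_inverse_le) (auto intro!: prod_pos add_pos_nonneg)
      also have "\<dots> = p x"
        by (simp add: p_def prod_inversef[symmetric] o_def)
      finally show "norm (1 / (1 + norm x) ^ (2 * CARD('d))) \<le> norm (p x)"
        using p0[of x] by (simp add: inverse_eq_divide)
    qed
  qed measurable
qed

text \<open>The L1 norm of the reference decay; the \<open>itself\<close> argument carries the
  dimension.\<close>

definition decay_mass :: "'d::finite itself \<Rightarrow> real" where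
  "decay_mass _ = (LINT x|lborel. 1 / (1 + norm (x::real^'d)) ^ (2 * CARD('d)))"

lemma integrable_decay:
  fixes f :: "real^'d::finite \<Rightarrow> 'b::{banach,second_countable_topology}"
  assumes [measurable]: "f \<in> borel_measurable borel"
    and C: "\<And>x. (1 + norm x) ^ (2 * CARD('d)) * norm (f x) \<le> C"
  shows "integrable lborel f" "(LINT x|lborel. norm (f x)) \<le> C * decay_mass TYPE('d)"
proof -
  have i: "integrable lborel (\<lambda>x::real^'d. C * (1 / (1 + norm x) ^ (2 * CARD('d))))"
    by (intro integrable_mult_right integrable_inverse_polynomial)
  have *: "norm (f x) \<le> C * (1 / (1 + norm x) ^ (2 * CARD('d)))" for x
  proof -
    have "0 < (1 + norm x) ^ (2 * CARD('d))" by (simp add: add_pos_nonneg)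
    then show ?thesis using C[of x] by (simp add: pos_le_divide_eq mult.commute)
  qed
  show f: "integrable lborel f"
    by (rule Bochner_Integration.integrable_bound[OF i])
      (auto intro!: AE_I2 order_trans[OF *] divide_right_mono)
  show "(LINT x|lborel. norm (f x)) \<le> C * decay_mass TYPE('d)"
    unfolding decay_mass_def integral_mult_right_zero[symmetric]
    by (rule integral_mono[OF _ i]) (use * f in auto)
qed

lemma schwartz_integrable: "schwartz f \<Longrightarrow> integrable lborel f"
  by (metis integrable_decay(1) schwartz_decay schwartz_measurable)

lemma schwartz_bounded:
  assumes "schwartz f"
  obtains C where "\<And>x. norm (f x) \<le> C"
  using schwartz_decay[OF assms, of 0] by auto

subsection \<open>Translation, reflection, dilation\<close>

lemma lborel_integral_shift:
  fixes f :: "'a::euclidean_space \<Rightarrow> 'b::{banach,second_countable_topology}"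
  assumes [measurable]: "f \<in> borel_measurable borel"
  shows "(LINT x|lborel. f (x + c)) = (LINT x|lborel. f x)"
proof -
  have "(LINT x|lborel. f x) = (LINT x|distr lborel borel ((+) c). f x)"
    by (simp add: lborel_distr_plus)
  also have "\<dots> = (LINT x|lborel. f (c + x))"
    by (subst integral_distr) auto
  finally show ?thesis by (simp add: add.commute)
qed

lemma lborel_affine_integral:
  fixes f :: "'a::euclidean_space \<Rightarrow> 'b::{banach,second_countable_topology}"
  assumes [measurable]: "f \<in> borel_measurable borel" and c: "c \<noteq> 0"
  shows "(LINT x|lborel. f x) = \<bar>c\<bar> ^ DIM('a) *\<^sub>R (LINT x|lborel. f (t + c *\<^sub>R x))"
  by (subst lborel_affine[OF c, of t], subst integral_density)
     (auto simp: integral_distr)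

lemma lborel_distr_uminus': "distr lborel borel uminus = (lborel :: 'a::euclidean_space measure)"
  using lborel_affine[of "-1" "0::'a"] by (simp add: density_1)

lemma lborel_integral_reflect:
  fixes f :: "'a::euclidean_space \<Rightarrow> 'b::{banach,second_countable_topology}"
  assumes [measurable]: "f \<in> borel_measurable borel"
  shows "(LINT x|lborel. f (- x)) = (LINT x|lborel. f x)"
  using lborel_affine_integral[OF assms, of "-1" 0] by simp

lemma lborel_integrable_reflect:
  fixes f :: "'a::euclidean_space \<Rightarrow> 'b::{banach,second_countable_topology}"
  assumes [measurable]: "f \<in> borel_measurable borel" and "integrable lborel f"
  shows "integrable lborel (\<lambda>x. f (- x))"
proof -
  have "integrable (distr lborel borel uminus) f"
    using assms by (simp add: lborel_distr_uminus')
  then show ?thesis by (subst (asm) integrable_distr_eq) auto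
qed

lemma AE_lborel_reflect:
  fixes P :: "'a::euclidean_space \<Rightarrow> bool"
  assumes "AE x in lborel. P x"
  shows "AE x in lborel. P (- x)"
proof -
  have "AE x in distr lborel borel uminus. P x"
    unfolding lborel_distr_uminus' by fact
  from AE_distrD[OF _ this] show ?thesis by auto
qed

subsection \<open>The Fourier transform of a Schwartz function\<close>

lemma measurable_cis_comp [measurable (raw)]:
  "f \<in> borel_measurable M \<Longrightarrow> (\<lambda>x. cis (f x)) \<in> borel_measurable M"
  by (rule measurable_compose[of f M borel cis])
    (simp_all add: borel_measurable_continuous_onI continuous_on_cis[OF continuous_on_id])

lemma integrable_cis_mult:
  fixes f :: "'a \<Rightarrow> complex"
  assumes "integrable M f" and [measurable]: "g \<in> borel_measurable M"
  shows "integrable M (\<lambda>x. cis (g x) * f x)"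
proof (rule Bochner_Integration.integrable_bound[OF assms(1)])
  have [measurable]: "f \<in> borel_measurable M" using assms by auto
  show "(\<lambda>x. cis (g x) * f x) \<in> borel_measurable M" by measurable
qed (simp add: norm_mult)

lemma norm_fourier_le: "norm (fourier f \<xi>) \<le> (LINT x|lborel. norm (f x))"
  unfolding fourier_def by (rule order_trans[OF integral_norm_bound]) (simp add: norm_mult)

text \<open>The remainder of the exponential series after the linear term, at an imaginary argument.
  That it is quadratic makes differentiation under the Fourier integral uniform in the
  frequency.\<close>

lemma cis_first_order: "cmod (cis s - cis r - \<i> * of_real (s - r) * cis r) \<le> (s - r)\<^sup>2"
proof -
  have "cis s - cis r - \<i> * of_real (s - r) * cis r = cis r * (exp (\<i> * of_real (s - r)) - (1 + \<i> * of_real (s - r)))"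
    by (simp add: cis_conv_exp exp_add[symmetric] algebra_simps)
  moreover have "cmod (exp (\<i> * of_real (s - r)) - (1 + \<i> * of_real (s - r))) \<le> (s - r)\<^sup>2"
    using Taylor_exp[of "\<i> * of_real (s - r)" 1]
    by (simp add: norm_mult power2_eq_square norm_of_real abs_mult_self_eq del: of_real_diff)
  ultimately show ?thesis
    by (simp add: norm_mult)
qed

lemma schwartz_integrable_moment:
  fixes f :: "real^'d::finite \<Rightarrow> complex"
  assumes "schwartz f"
  shows "integrable lborel (\<lambda>x. (norm x) ^ N * norm (f x))"
proof -
  have [measurable]: "f \<in> borel_measurable borel" using assms by (rule schwartz_measurable)
  obtain C where C: "\<And>x. (1 + norm x) ^ (2 * CARD('d) + N) * norm (f x) \<le> C"
    using schwartz_decay[OF assms] by metis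
  show ?thesis
  proof (rule integrable_decay(1))
    fix x :: "real^'d"
    have "(norm x) ^ N \<le> (1 + norm x) ^ N" by (intro power_mono) auto
    then have "(1 + norm x) ^ (2 * CARD('d)) * ((norm x) ^ N * norm (f x)) \<le>
      (1 + norm x) ^ (2 * CARD('d)) * ((1 + norm x) ^ N * norm (f x))"
      by (intro mult_left_mono mult_right_mono) auto
    also have "\<dots> \<le> C"
      using C[of x] by (simp add: power_add mult.assoc)
    finally show "(1 + norm x) ^ (2 * CARD('d)) * norm (norm x ^ N * norm (f x)) \<le> C"
      by (simp add: abs_mult)
  qed measurable
qed

text \<open>The first-order remainder of the exponential is at most |(\<eta> - \<xi>) \<bullet>
  x|^2, so that of the transform is at most |\<eta> - \<xi>|^2 times the second moment
  \<open>Q\<close> of \<open>f\<close>: a direct estimate takes the place of an exchange of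
  limits.\<close>

lemma fourier_has_derivative:
  fixes f :: "real^'d::finite \<Rightarrow> complex"
  assumes f: "schwartz f"
  shows "(fourier f has_derivative
    (\<lambda>h. \<Sum>k\<in>UNIV. of_real (h $ k) * fourier (\<lambda>x. - \<i> * (of_real (x $ k) * f x)) \<xi>)) (at \<xi>)"
proof -
  define L where "L h = (\<Sum>k\<in>UNIV. of_real (h $ k) * fourier (\<lambda>x. - \<i> * (of_real (x $ k) * f x)) \<xi>)" for h :: "real^'d"
  define Q where "Q = (LINT x|lborel. (norm x)\<^sup>2 * norm (f x))"
  have [measurable]: "f \<in> borel_measurable borel" using f by (rule schwartz_measurable)
  have Q0: "0 \<le> Q" unfolding Q_def by (rule Bochner_Integration.integral_nonneg) auto
  have fi: "integrable lborel f" using f by (rule schwartz_integrable)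
  have xi: "integrable lborel (\<lambda>x. of_real (x $ k) * f x)" for k
    by (intro schwartz_integrable schwartz_coord_mult f)
  have ci: "integrable lborel (\<lambda>x. cis (- (\<eta> \<bullet> x)) * f x)" for \<eta> :: "real^'d"
    using fi by (rule integrable_cis_mult) measurable
  have cxi: "integrable lborel (\<lambda>x. cis (- (\<xi> \<bullet> x)) * (- \<i> * (of_real (x $ k) * f x)))" for k
    by (intro integrable_cis_mult integrable_mult_right xi) measurable
  have Lh: "L h = (LINT x|lborel. - \<i> * of_real (h \<bullet> x) * cis (- (\<xi> \<bullet> x)) * f x)" for h
  proof -
    have "L h = (LINT x|lborel. (\<Sum>k\<in>UNIV. of_real (h $ k) * (cis (- (\<xi> \<bullet> x)) * (- \<i> * (of_real (x $ k) * f x)))))"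
      unfolding L_def fourier_def using cxi
      by (subst Bochner_Integration.integral_sum) (auto intro: integrable_mult_right simp del: mult_minus_left)
    also have "\<dots> = (LINT x|lborel. - \<i> * of_real (h \<bullet> x) * cis (- (\<xi> \<bullet> x)) * f x)"
      by (simp add: inner_vec_def sum_distrib_left sum_distrib_right mult_ac sum_negf)
    finally show ?thesis .
  qed
  have ih: "integrable lborel (\<lambda>x. - \<i> * of_real (h \<bullet> x) * cis (- (\<xi> \<bullet> x)) * f x)" for h
  proof -
    have "integrable lborel (\<lambda>x. (\<Sum>k\<in>UNIV. of_real (h $ k) * (cis (- (\<xi> \<bullet> x)) * (- \<i> * (of_real (x $ k) * f x)))))"
      using cxi by (intro Bochner_Integration.integrable_sum integrable_mult_right)
    then show ?thesis
      by (simp add: inner_vec_def sum_distrib_left sum_distrib_right mult_ac sum_negf)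
  qed
  have main: "norm (fourier f \<eta> - fourier f \<xi> - L (\<eta> - \<xi>)) \<le> Q * (norm (\<eta> - \<xi>))\<^sup>2" for \<eta>
  proof -
    let ?g = "\<lambda>x. (cis (- (\<eta> \<bullet> x)) - cis (- (\<xi> \<bullet> x)) - - \<i> * of_real ((\<eta> - \<xi>) \<bullet> x) * cis (- (\<xi> \<bullet> x))) * f x"
    have "fourier f \<eta> - fourier f \<xi> - L (\<eta> - \<xi>) = (LINT x|lborel. cis (- (\<eta> \<bullet> x)) * f x - cis (- (\<xi> \<bullet> x)) * f x
        - - \<i> * of_real ((\<eta> - \<xi>) \<bullet> x) * cis (- (\<xi> \<bullet> x)) * f x)"
      unfolding Lh fourier_def using ci[of \<eta>] ci[of \<xi>] ih[of "\<eta> - \<xi>"]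
      by (simp only: Bochner_Integration.integral_diff Bochner_Integration.integrable_diff)
    also have "\<dots> = (LINT x|lborel. ?g x)"
      by (simp only: left_diff_distrib)
    also have "norm \<dots> \<le> (LINT x|lborel. norm (?g x))"
      by (rule integral_norm_bound)
    also have "\<dots> \<le> (LINT x|lborel. (norm (\<eta> - \<xi>))\<^sup>2 * ((norm x)\<^sup>2 * norm (f x)))"
    proof (rule integral_mono')
      show "integrable lborel (\<lambda>x. (norm (\<eta> - \<xi>))\<^sup>2 * ((norm x)\<^sup>2 * norm (f x)))"
        using schwartz_integrable_moment[OF f, of 2] by (intro integrable_mult_right) simp
      fix x :: "real^'d"
      have "cmod (cis (- (\<eta> \<bullet> x)) - cis (- (\<xi> \<bullet> x)) - - \<i> * of_real ((\<eta> - \<xi>) \<bullet> x) * cis (- (\<xi> \<bullet> x)))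
         \<le> ((\<eta> - \<xi>) \<bullet> x)\<^sup>2"
        using cis_first_order[of "- (\<eta> \<bullet> x)" "- (\<xi> \<bullet> x)"]
        by (simp add: inner_diff_left algebra_simps power2_commute)
      also have "\<dots> \<le> (norm (\<eta> - \<xi>) * norm x)\<^sup>2"
        using Cauchy_Schwarz_ineq2[of "\<eta> - \<xi>" x] by (simp add: abs_le_square_iff[symmetric])
      finally show "norm (?g x) \<le> (norm (\<eta> - \<xi>))\<^sup>2 * ((norm x)\<^sup>2 * norm (f x))"
        unfolding norm_mult power_mult_distrib mult.assoc[symmetric] by (intro mult_right_mono) auto
    qed auto
    finally show ?thesis by (simp add: Q_def mult.commute)
  qed
  have "(fourier f has_derivative L) (at \<xi>)"
    unfolding has_derivative_at_alt
  proof (intro conjI allI impI)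
    show "bounded_linear L"
      unfolding L_def by (intro bounded_linear_sum bounded_linear_mult_const
        bounded_linear_compose[OF bounded_linear_of_real bounded_linear_vec_nth])
  next
    fix e :: real assume e: "0 < e"
    show "\<exists>d>0. \<forall>y. norm (y - \<xi>) < d \<longrightarrow> norm (fourier f y - fourier f \<xi> - L (y - \<xi>)) \<le> e * norm (y - \<xi>)"
    proof (intro exI[of _ "e / (Q + 1)"] conjI allI impI)
      show "0 < e / (Q + 1)" using e Q0 by simp
      fix y assume y: "norm (y - \<xi>) < e / (Q + 1)"
      have "Q * norm (y - \<xi>) \<le> (Q + 1) * norm (y - \<xi>)" by (simp add: algebra_simps)
      also have "\<dots> \<le> e" using y Q0 by (simp add: pos_less_divide_eq mult.commute less_imp_le)
      finally have "Q * norm (y - \<xi>) * norm (y - \<xi>) \<le> e * norm (y - \<xi>)"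
        by (intro mult_right_mono) auto
      then show "norm (fourier f y - fourier f \<xi> - L (y - \<xi>)) \<le> e * norm (y - \<xi>)"
        using main[of y] by (simp add: power2_eq_square mult.assoc)
    qed
  qed
  then show ?thesis by (simp add: L_def[abs_def])
qed

lemma partial_deriv_fourier:
  assumes "schwartz f"
  shows "partial_deriv k (fourier f) = fourier (\<lambda>x. - \<i> * (of_real (x $ k) * f x))"
proof
  fix \<xi>
  have "(\<Sum>j\<in>UNIV. of_real (axis k 1 $ j) * c j) = c k" for c :: "'a \<Rightarrow> complex"
    by (subst sum.remove[of _ k]) (auto simp: axis_def intro!: sum.neutral)
  then show "partial_deriv k (fourier f) \<xi> = fourier (\<lambda>x. - \<i> * (of_real (x $ k) * f x)) \<xi>"
    by (simp only: partial_deriv_eq[OF fourier_has_derivative[OF assms]])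
qed

text \<open>By translation invariance every difference quotient has integral zero, and the quotients
  converge to the derivative under a common integrable majorant.\<close>

lemma integral_partial_deriv_eq_0:
  fixes \<psi> :: "real^'d::finite \<Rightarrow> complex"
  assumes diff: "\<And>x. \<psi> differentiable (at x)"
    and C: "\<And>x. (1 + norm x) ^ (2 * CARD('d)) * norm (\<psi> x) \<le> C"
    and C': "\<And>x. (1 + norm x) ^ (2 * CARD('d)) * norm (partial_deriv k \<psi> x) \<le> C'"
    and [measurable]: "partial_deriv k \<psi> \<in> borel_measurable borel"
  shows "(LINT x|lborel. partial_deriv k \<psi> x) = 0"
proof -
  define e :: "real^'d" where "e = axis k 1"
  have ne: "norm e = 1" by (simp add: e_def)
  have "continuous_on UNIV \<psi>"
    using diff by (meson continuous_at_imp_continuous_on differentiable_imp_continuous_within)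
  then have [measurable]: "\<psi> \<in> borel_measurable borel"
    by (rule borel_measurable_continuous_onI)
  have int: "integrable lborel \<psi>"
    by (rule integrable_decay(1)[OF _ C]) measurable
  have der: "((\<lambda>h. \<psi> (x + h *\<^sub>R e)) has_vector_derivative partial_deriv k \<psi> (x + s *\<^sub>R e)) (at s)" for x s
    unfolding e_def by (rule partial_deriv_has_vector_derivative[OF diff])
  define h :: "nat \<Rightarrow> real" where "h n = 1 / (real n + 1)" for n
  have h: "0 < h n" "h n \<le> 1" for n by (auto simp: h_def)
  have hlim: "h \<longlonglongrightarrow> 0"
    unfolding h_def using LIMSEQ_inverse_real_of_nat by (simp add: inverse_eq_divide add.commute)
  define q where "q n x = (\<psi> (x + h n *\<^sub>R e) - \<psi> x) /\<^sub>R h n" for n x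
  have q0: "(LINT x|lborel. q n x) = 0" for n
  proof -
    have "integrable lborel (\<lambda>x. \<psi> (x + h n *\<^sub>R e))"
    proof -
      have "integrable (distr lborel borel ((+) (h n *\<^sub>R e))) \<psi>"
        unfolding lborel_distr_plus by (rule int)
      then show ?thesis by (subst (asm) integrable_distr_eq) (auto simp: add.commute)
    qed
    then show ?thesis
      unfolding q_def using int lborel_integral_shift[of \<psi> "h n *\<^sub>R e"] by simp
  qed
  \<comment> \<open>A shift of length at most one changes 1 + |x| by at most a factor 2, whence the
    power of 2; the mean value theorem along the segment passes from the derivative to the
    quotient.\<close>
  have bound: "norm (q n x) \<le> 2 ^ (2 * CARD('d)) * C' * (1 / (1 + norm x) ^ (2 * CARD('d)))" for n x
  proof -
    let ?B = "2 ^ (2 * CARD('d)) * C' * (1 / (1 + norm x) ^ (2 * CARD('d)))"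
    have B: "norm (partial_deriv k \<psi> (x + s *\<^sub>R e)) \<le> ?B" if "0 \<le> s" "s \<le> 1" for s
    proof -
      have "norm (s *\<^sub>R e) \<le> 1" using that by (simp add: ne)
      then have "norm x \<le> norm (x + s *\<^sub>R e) + 1"
        using norm_diff_ineq[of x "s *\<^sub>R e"] by linarith
      then have "1 + norm x \<le> 2 * (1 + norm (x + s *\<^sub>R e))"
        using norm_ge_zero[of "x + s *\<^sub>R e"] by (simp only: distrib_left)
      then have "(1 + norm x) ^ (2 * CARD('d)) \<le> (2 * (1 + norm (x + s *\<^sub>R e))) ^ (2 * CARD('d))"
        by (intro power_mono) auto
      then have "(1 + norm x) ^ (2 * CARD('d)) * norm (partial_deriv k \<psi> (x + s *\<^sub>R e)) \<le>
         2 ^ (2 * CARD('d)) * ((1 + norm (x + s *\<^sub>R e)) ^ (2 * CARD('d)) * norm (partial_deriv k \<psi> (x + s *\<^sub>R e)))"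
        unfolding power_mult_distrib mult.assoc[symmetric] by (intro mult_right_mono) auto
      also have "\<dots> \<le> 2 ^ (2 * CARD('d)) * C'"
        by (intro mult_left_mono C') auto
      finally have "(1 + norm x) ^ (2 * CARD('d)) * norm (partial_deriv k \<psi> (x + s *\<^sub>R e)) \<le> 2 ^ (2 * CARD('d)) * C'" .
      moreover have "0 < (1 + norm x) ^ (2 * CARD('d))"
        by (simp add: add_pos_nonneg)
      ultimately show ?thesis by (simp add: pos_le_divide_eq mult.commute)
    qed
    have "norm (\<psi> (x + h n *\<^sub>R e) - \<psi> (x + 0 *\<^sub>R e)) \<le> ?B * norm (h n - 0)"
    proof (rule differentiable_bound[where S = "{0..h n}" and f' = "\<lambda>s t. t *\<^sub>R partial_deriv k \<psi> (x + s *\<^sub>R e)"])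
      fix s assume s: "s \<in> {0..h n}"
      show "((\<lambda>s. \<psi> (x + s *\<^sub>R e)) has_derivative (\<lambda>t. t *\<^sub>R partial_deriv k \<psi> (x + s *\<^sub>R e))) (at s within {0..h n})"
        using der has_derivative_at_withinI unfolding has_vector_derivative_def by blast
      show "onorm (\<lambda>t. t *\<^sub>R partial_deriv k \<psi> (x + s *\<^sub>R e)) \<le> ?B"
      proof (rule onorm_le)
        fix t :: real
        have "norm (t *\<^sub>R partial_deriv k \<psi> (x + s *\<^sub>R e)) = norm (partial_deriv k \<psi> (x + s *\<^sub>R e)) * norm t"
          by simp
        also have "\<dots> \<le> ?B * norm t"
          using s h[of n] by (intro mult_right_mono B) auto
        finally show "norm (t *\<^sub>R partial_deriv k \<psi> (x + s *\<^sub>R e)) \<le> ?B * norm t" .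
      qed
    qed (use h[of n] in auto)
    then show ?thesis
      using h[of n] by (simp add: q_def divide_inverse_commute[symmetric] pos_divide_le_eq del: times_divide_eq_right)
  qed
  have "(\<lambda>n. LINT x|lborel. q n x) \<longlonglongrightarrow> (LINT x|lborel. partial_deriv k \<psi> x)"
  proof (rule integral_dominated_convergence)
    show "integrable lborel (\<lambda>x::real^'d. 2 ^ (2 * CARD('d)) * C' * (1 / (1 + norm x) ^ (2 * CARD('d))))"
      by (intro integrable_mult_right integrable_inverse_polynomial)
    show "AE x in lborel. (\<lambda>n. q n x) \<longlonglongrightarrow> partial_deriv k \<psi> x"
    proof (intro AE_I2)
      fix x
      have "((\<lambda>s. (\<psi> (x + s *\<^sub>R e) - \<psi> x) /\<^sub>R s) \<longlongrightarrow> partial_deriv k \<psi> x) (at 0)"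
      proof -
        have "((\<lambda>s. norm (\<psi> (x + s *\<^sub>R e) - \<psi> x - s *\<^sub>R partial_deriv k \<psi> x) / norm s) \<longlongrightarrow> 0) (at 0)"
          using der[of x 0] by (simp add: has_vector_derivative_def has_derivative_at)
        moreover have eq: "norm ((\<psi> (x + s *\<^sub>R e) - \<psi> x) /\<^sub>R s - partial_deriv k \<psi> x) =
            norm (\<psi> (x + s *\<^sub>R e) - \<psi> x - s *\<^sub>R partial_deriv k \<psi> x) / norm s" if "s \<noteq> 0" for s
        proof -
          have "(\<psi> (x + s *\<^sub>R e) - \<psi> x) /\<^sub>R s - partial_deriv k \<psi> x =
              (\<psi> (x + s *\<^sub>R e) - \<psi> x - s *\<^sub>R partial_deriv k \<psi> x) /\<^sub>R s"
            using that by (simp add: scaleR_diff_right)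
          then show ?thesis by (simp add: divide_inverse mult.commute)
        qed
        ultimately have "((\<lambda>s. norm ((\<psi> (x + s *\<^sub>R e) - \<psi> x) /\<^sub>R s - partial_deriv k \<psi> x)) \<longlongrightarrow> 0) (at 0)"
          by (elim Lim_transform_eventually) (auto simp: eventually_at_filter)
        then show ?thesis
          using tendsto_norm_zero_iff LIM_zero_iff by blast
      qed
      moreover have "filterlim h (at 0) sequentially"
        using hlim h(1) unfolding filterlim_at by (auto simp: less_imp_neq[symmetric])
      ultimately show "(\<lambda>n. q n x) \<longlonglongrightarrow> partial_deriv k \<psi> x"
        unfolding q_def by (rule filterlim_compose)
    qed
    show "AE x in lborel. norm (q n x) \<le> 2 ^ (2 * CARD('d)) * C' * (1 / (1 + norm x) ^ (2 * CARD('d)))" for n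
      using bound by auto
    show "q n \<in> borel_measurable lborel" for n
      unfolding q_def[abs_def] by measurable
  qed measurable
  then show ?thesis
    using LIMSEQ_unique q0 tendsto_const by (simp add: LIMSEQ_const_iff)
qed

text \<open>Integration by parts: the derivative of \<open>cis (- (\<xi> \<bullet> x)) * f x\<close>
  has integral zero, and the product rule splits that derivative into the two sides.\<close>

lemma fourier_partial_deriv:
  fixes f :: "real^'d::finite \<Rightarrow> complex"
  assumes f: "schwartz f"
  shows "fourier (partial_deriv k f) \<xi> = \<i> * of_real (\<xi> $ k) * fourier f \<xi>"
proof -
  let ?\<psi> = "\<lambda>x. cis (- (\<xi> \<bullet> x)) * f x"
  note [measurable] = schwartz_measurable[OF f] schwartz_measurable[OF schwartz_partial_deriv[OF f]]
  have der: "(?\<psi> has_derivative (\<lambda>h. cis (- (\<xi> \<bullet> x)) * D h - \<i> * of_real (\<xi> \<bullet> h) * cis (- (\<xi> \<bullet> x)) * f x)) (at x)"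
    if "(f has_derivative D) (at x)" for x D
    using that by (auto intro!: derivative_eq_intros simp: scaleR_conv_of_real algebra_simps)
  have pd: "partial_deriv k ?\<psi> = (\<lambda>x. cis (- (\<xi> \<bullet> x)) * partial_deriv k f x - \<i> * of_real (\<xi> $ k) * (cis (- (\<xi> \<bullet> x)) * f x))"
  proof
    fix x
    obtain D where D: "(f has_derivative D) (at x)"
      using schwartz_differentiable[OF f] unfolding differentiable_def by blast
    show "partial_deriv k ?\<psi> x = cis (- (\<xi> \<bullet> x)) * partial_deriv k f x - \<i> * of_real (\<xi> $ k) * (cis (- (\<xi> \<bullet> x)) * f x)"
      using partial_deriv_eq[OF der[OF D]] partial_deriv_eq[OF D] by (simp add: inner_axis)
  qed
  obtain C where C: "\<And>x. (1 + norm x) ^ (2 * CARD('d)) * norm (f x) \<le> C"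
    using schwartz_decay[OF f] by metis
  obtain C' where C': "\<And>x. (1 + norm x) ^ (2 * CARD('d)) * norm (partial_deriv k f x) \<le> C'"
    using schwartz_decay[OF schwartz_partial_deriv[OF f]] by metis
  have "(LINT x|lborel. partial_deriv k ?\<psi> x) = 0"
  proof (rule integral_partial_deriv_eq_0)
    show "?\<psi> differentiable at x" for x
      using der schwartz_differentiable[OF f] unfolding differentiable_def by blast
    show "(1 + norm x) ^ (2 * CARD('d)) * norm (?\<psi> x) \<le> C" for x
      using C by (simp add: norm_mult)
    show "(1 + norm x) ^ (2 * CARD('d)) * norm (partial_deriv k ?\<psi> x) \<le> C' + \<bar>\<xi> $ k\<bar> * C" for x
    proof -
      have "norm (partial_deriv k ?\<psi> x) \<le> norm (partial_deriv k f x) + \<bar>\<xi> $ k\<bar> * norm (f x)"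
        unfolding pd by (rule order_trans[OF norm_triangle_ineq4]) (simp add: norm_mult)
      then have "(1 + norm x) ^ (2 * CARD('d)) * norm (partial_deriv k ?\<psi> x) \<le>
         (1 + norm x) ^ (2 * CARD('d)) * (norm (partial_deriv k f x) + \<bar>\<xi> $ k\<bar> * norm (f x))"
        by (intro mult_left_mono) auto
      also have "\<dots> = (1 + norm x) ^ (2 * CARD('d)) * norm (partial_deriv k f x) + \<bar>\<xi> $ k\<bar> * ((1 + norm x) ^ (2 * CARD('d)) * norm (f x))"
        by (simp add: algebra_simps)
      also have "\<dots> \<le> C' + \<bar>\<xi> $ k\<bar> * C"
        by (intro add_mono C' mult_left_mono C) auto
      finally show ?thesis .
    qed
    show "partial_deriv k ?\<psi> \<in> borel_measurable borel"
      unfolding pd by measurable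
  qed
  moreover have "integrable lborel (\<lambda>x. cis (- (\<xi> \<bullet> x)) * partial_deriv k f x)" "integrable lborel (\<lambda>x. cis (- (\<xi> \<bullet> x)) * f x)"
    by (intro integrable_cis_mult schwartz_integrable schwartz_partial_deriv f; measurable)+
  ultimately show ?thesis
    unfolding pd fourier_def by simp
qed

lemma fourier_iter_partial_replicate:
  assumes "schwartz f"
  shows "fourier (iter_partial (replicate n k) f) \<xi> = (\<i> * of_real (\<xi> $ k)) ^ n * fourier f \<xi>"
  by (induction n) (simp_all add: fourier_partial_deriv schwartz_iter_partial assms)

text \<open>Both sides are compared with the largest of 1 and the \<open>a k\<close>, whose
  \<open>N\<close>-th power is dominated by a single summand on the right.\<close>

lemma power_one_plus_sum_le:
  fixes a :: "'k::finite \<Rightarrow> real"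
  assumes "\<And>k. 0 \<le> a k"
  shows "(1 + (\<Sum>k\<in>UNIV. a k)) ^ N \<le> (1 + real CARD('k)) ^ N * (1 + (\<Sum>k\<in>UNIV. a k ^ N))"
proof -
  define m where "m = Max (insert 1 (range a))"
  have m: "1 \<le> m" "a k \<le> m" for k by (auto simp: m_def intro: Max_ge simp del: Max_insert)
  have mN: "m ^ N \<le> 1 + (\<Sum>k\<in>UNIV. a k ^ N)"
  proof -
    have "m \<in> insert 1 (range a)" unfolding m_def by (rule Max_in) auto
    then show ?thesis
    proof
      assume "m = 1" then show ?thesis using assms by (simp add: sum_nonneg)
    next
      assume "m \<in> range a"
      then obtain k where "m = a k" by auto
      moreover have "a k ^ N \<le> (\<Sum>k\<in>UNIV. a k ^ N)"
        by (rule member_le_sum) (use assms in auto)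
      ultimately show ?thesis by simp
    qed
  qed
  have "(\<Sum>k\<in>UNIV. a k) \<le> (\<Sum>k\<in>(UNIV::'k set). m)" by (intro sum_mono m)
  then have "1 + (\<Sum>k\<in>UNIV. a k) \<le> (1 + real CARD('k)) * m"
    using m(1) by (simp add: algebra_simps)
  then have "(1 + (\<Sum>k\<in>UNIV. a k)) ^ N \<le> ((1 + real CARD('k)) * m) ^ N"
    using assms by (intro power_mono) (auto simp: sum_nonneg)
  also have "\<dots> \<le> (1 + real CARD('k)) ^ N * (1 + (\<Sum>k\<in>UNIV. a k ^ N))"
    unfolding power_mult_distrib by (intro mult_left_mono mN) auto
  finally show ?thesis .
qed

text \<open>Powers of a frequency coordinate turn into derivatives of \<open>f\<close>, whose L1
  norms are controlled by a seminorm. The constants precede \<open>f\<close>: this uniformity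
  becomes the continuity of the functional in \<open>sobolev_fun_has_fourier\<close>.\<close>

lemma fourier_seminorm_bound:
  "\<exists>C N'. \<forall>f::real^'d::finite \<Rightarrow> complex. schwartz f \<longrightarrow>
     (\<forall>\<xi>. (1 + norm \<xi>) ^ N * norm (fourier f \<xi>) \<le> C * schwartz_seminorm N' f)"
proof -
  define N' where "N' = max N (2 * CARD('d))"
  define C where "C = (1 + real CARD('d)) ^ N * ((1 + real CARD('d)) * decay_mass TYPE('d))"
  have "(1 + norm \<xi>) ^ N * norm (fourier f \<xi>) \<le> C * schwartz_seminorm N' f"
    if f: "schwartz f" for f :: "real^'d \<Rightarrow> complex" and \<xi>
  proof -
    let ?S = "schwartz_seminorm N' f * decay_mass TYPE('d)"
    have b: "norm (fourier (iter_partial is f) \<xi>) \<le> ?S" if "length is \<le> N" for "is"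
    proof -
      have "(LINT x|lborel. norm (iter_partial is f x)) \<le> ?S"
      proof (rule integrable_decay(2))
        show "iter_partial is f \<in> borel_measurable borel"
          by (intro schwartz_measurable schwartz_iter_partial f)
        fix x :: "real^'d"
        have "(1 + norm x) ^ (2 * CARD('d)) * norm (iter_partial is f x) \<le> (1 + norm x) ^ N' * norm (iter_partial is f x)"
          by (intro mult_right_mono power_increasing) (auto simp: N'_def)
        also have "\<dots> \<le> schwartz_seminorm N' f"
          using that by (intro schwartz_seminorm_ge f) (auto simp: N'_def)
        finally show "(1 + norm x) ^ (2 * CARD('d)) * norm (iter_partial is f x) \<le> schwartz_seminorm N' f" .
      qed
      then show ?thesis using norm_fourier_le order_trans by blast
    qed
    have "1 + norm \<xi> \<le> 1 + (\<Sum>k\<in>UNIV. \<bar>\<xi> $ k\<bar>)" using norm_le_l1_cart by auto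
    then have "(1 + norm \<xi>) ^ N \<le> (1 + (\<Sum>k\<in>UNIV. \<bar>\<xi> $ k\<bar>)) ^ N" by (intro power_mono) auto
    also have "\<dots> \<le> (1 + real CARD('d)) ^ N * (1 + (\<Sum>k\<in>UNIV. \<bar>\<xi> $ k\<bar> ^ N))"
      by (rule power_one_plus_sum_le) auto
    finally have "(1 + norm \<xi>) ^ N * norm (fourier f \<xi>) \<le>
       (1 + real CARD('d)) ^ N * (1 + (\<Sum>k\<in>UNIV. \<bar>\<xi> $ k\<bar> ^ N)) * norm (fourier f \<xi>)"
      by (intro mult_right_mono) auto
    also have "\<dots> = (1 + real CARD('d)) ^ N * (norm (fourier f \<xi>) + (\<Sum>k\<in>UNIV. norm (fourier (iter_partial (replicate N k) f) \<xi>)))"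
      unfolding fourier_iter_partial_replicate[OF f]
      by (simp add: norm_mult norm_power sum_distrib_right distrib_right)
    also have "\<dots> \<le> (1 + real CARD('d)) ^ N * (?S + (\<Sum>k\<in>(UNIV::'d set). ?S))"
      using b[of "[]"] by (intro mult_left_mono add_mono sum_mono b) auto
    also have "\<dots> = C * schwartz_seminorm N' f"
      by (simp add: C_def algebra_simps)
    finally show ?thesis .
  qed
  then show ?thesis by blast
qed

lemma schwartz_fourier:
  fixes f :: "real^'d::finite \<Rightarrow> complex"
  assumes "schwartz f"
  shows "schwartz (fourier f)"
proof (rule schwartz_coinduct[where P = "\<lambda>h. \<exists>f. schwartz f \<and> h = fourier f"])
  show "\<exists>f'. schwartz f' \<and> fourier f = fourier f'"
    using assms by (intro exI[of _ f]) simp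
next
  fix h :: "real^'d \<Rightarrow> complex" and x N i
  assume "\<exists>f. schwartz f \<and> h = fourier f"
  then obtain f where f: "schwartz f" and h: "h = fourier f" by blast
  show "h differentiable at x"
    unfolding h differentiable_def using fourier_has_derivative[OF f] by blast
  show "\<exists>C. \<forall>x. (1 + norm x) ^ N * norm (h x) \<le> C"
    unfolding h using fourier_seminorm_bound[of N] f by blast
  show "\<exists>f. schwartz f \<and> partial_deriv i h = fourier f"
    unfolding h partial_deriv_fourier[OF f]
    using schwartz_cmult[OF schwartz_coord_mult[OF f, of i], of "- \<i>"] by blast
qed

subsection \<open>Gaussians and Fourier inversion\<close>

text \<open>Modulated Gaussians: varying \<open>a\<close> brings every character, times one fixed
  integrable factor, into the Schwartz space.\<close>

definition gauss :: "real^'d::finite \<Rightarrow> real^'d \<Rightarrow> complex" where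
  "gauss a x = exp (of_real (- (x \<bullet> x) / 2) + \<i> * of_real (a \<bullet> x))"

lemma gauss_eq: "gauss a x = cis (a \<bullet> x) * of_real (exp (- (x \<bullet> x) / 2))"
  unfolding gauss_def exp_add exp_of_real cis_conv_exp by simp

lemma norm_gauss: "norm (gauss a x) = exp (- (x \<bullet> x) / 2)"
  by (simp add: gauss_eq norm_mult)

lemma norm_gauss_le_1: "norm (gauss a x) \<le> 1"
  by (simp add: norm_gauss)

lemma gauss_has_derivative:
  "(gauss a has_derivative (\<lambda>h. (of_real (- (x \<bullet> h)) + \<i> * of_real (a \<bullet> h)) * gauss a x)) (at x)"
proof -
  have "((\<lambda>x. of_real (- (x \<bullet> x) / 2) + \<i> * of_real (a \<bullet> x)) has_derivative
      (\<lambda>h. of_real (- (x \<bullet> h)) + \<i> * of_real (a \<bullet> h))) (at x)"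
    by (auto intro!: derivative_eq_intros simp: inner_commute field_simps)
  moreover have "(exp has_derivative (\<lambda>h. h * exp z)) (at z)" for z :: complex
    using DERIV_exp[of z] unfolding has_field_derivative_def mult_commute_abs by (simp add: mult.commute)
  ultimately show ?thesis
    unfolding gauss_def[abs_def] by (rule has_derivative_compose)
qed

lemma gauss_differentiable: "gauss a differentiable (at x)"
  using gauss_has_derivative unfolding differentiable_def by blast

lemma partial_deriv_gauss:
  "partial_deriv k (gauss a) = (\<lambda>x. (- 1) * (of_real (x $ k) * gauss a x) + (\<i> * of_real (a $ k)) * gauss a x)"
  using partial_deriv_eq[OF gauss_has_derivative] by (auto simp: fun_eq_iff inner_axis algebra_simps)

text \<open>Polynomials times a Gaussian, generated just far enough to be stable under
  \<open>partial_deriv\<close>; this is the invariant for \<open>schwartz_coinduct\<close>.\<close>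

inductive gauss_poly :: "real^'d::finite \<Rightarrow> (real^'d \<Rightarrow> complex) \<Rightarrow> bool" for a where
  base: "gauss_poly a (gauss a)"
| coord: "gauss_poly a f \<Longrightarrow> gauss_poly a (\<lambda>x. of_real (x $ i) * f x)"
| lincomb: "gauss_poly a f \<Longrightarrow> gauss_poly a g \<Longrightarrow> gauss_poly a (\<lambda>x. b * f x + c * g x)"

lemma gauss_poly_differentiable: "gauss_poly a f \<Longrightarrow> f differentiable (at x)"
proof (induction rule: gauss_poly.induct)
  case base then show ?case by (rule gauss_differentiable)
next
  case (coord f i)
  then show ?case
    using has_derivative_coord_mult unfolding differentiable_def by blast
next
  case (lincomb f g b c)
  then show ?case by (intro differentiable_add differentiable_mult differentiable_const)
qed

lemma gauss_poly_decay: "gauss_poly a f \<Longrightarrow> \<exists>C. \<forall>x. (1 + norm x) ^ N * norm (f x) \<le> C"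
proof (induction arbitrary: N rule: gauss_poly.induct)
  case base
  have "(1 + norm x) ^ N * norm (gauss a x) \<le> exp ((real N)\<^sup>2 / 2)" for x
  proof -
    have "(1 + norm x) ^ N \<le> exp (norm x) ^ N"
      by (intro power_mono exp_ge_add_one_self) auto
    also have "\<dots> = exp (real N * norm x)" by (simp add: exp_of_nat_mult)
    finally have "(1 + norm x) ^ N * norm (gauss a x) \<le> exp (real N * norm x) * exp (- (x \<bullet> x) / 2)"
      unfolding norm_gauss by (intro mult_right_mono) auto
    also have "\<dots> = exp (real N * norm x - (norm x)\<^sup>2 / 2)"
      by (simp add: exp_add[symmetric] power2_norm_eq_inner)
    \<comment> \<open>Completing the square: N r - r^2 / 2 is largest at r = N.\<close>
    also have "\<dots> \<le> exp ((real N)\<^sup>2 / 2)"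
      using zero_le_power2[of "real N - norm x"] by (simp add: power2_eq_square algebra_simps)
    finally show ?thesis .
  qed
  then show ?case by blast
next
  case (coord f i)
  then obtain C where "\<forall>x. (1 + norm x) ^ Suc N * norm (f x) \<le> C" by blast
  then show ?case using decay_coord_mult by blast
next
  case (lincomb f g b c)
  from lincomb.IH(1)[of N] obtain C where C: "\<forall>x. (1 + norm x) ^ N * norm (f x) \<le> C" by blast
  from lincomb.IH(2)[of N] obtain D where "\<forall>x. (1 + norm x) ^ N * norm (g x) \<le> D" by blast
  with C show ?case by (rule decay_lincomb)
qed

lemma gauss_poly_partial_deriv: "gauss_poly a f \<Longrightarrow> gauss_poly a (partial_deriv k f)"
proof (induction rule: gauss_poly.induct)
  case base
  show ?case
    unfolding partial_deriv_gauss by (intro gauss_poly.intros)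
next
  case (coord f i)
  have "partial_deriv k (\<lambda>x. of_real (x $ i) * f x) =
      (\<lambda>x. 1 * (of_real (x $ i) * partial_deriv k f x) + (if k = i then 1 else 0) * f x)"
    using partial_deriv_coord_mult[of f k i] gauss_poly_differentiable[OF coord.hyps] by simp
  then show ?case
    using gauss_poly.lincomb[OF gauss_poly.coord[OF coord.IH, of i] coord.hyps] by (metis (no_types))
next
  case (lincomb f g b c)
  show ?case
    unfolding partial_deriv_lincomb[OF gauss_poly_differentiable[OF lincomb.hyps(1)]
      gauss_poly_differentiable[OF lincomb.hyps(2)]]
    by (intro gauss_poly.lincomb lincomb.IH)
qed

lemma fourier_cmult: "fourier (\<lambda>x. c * f x) \<xi> = c * fourier f \<xi>"
  unfolding fourier_def integral_mult_right_zero[symmetric] by (simp add: mult.left_commute)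

lemma schwartz_gauss: "schwartz (gauss a)"
  by (rule schwartz_coinduct[where P = "gauss_poly a"])
    (auto intro: gauss_poly.base gauss_poly_differentiable gauss_poly_decay gauss_poly_partial_deriv)

text \<open>This is (2 pi)^(d/2). It occurs once as the ratio of the transformed Gaussian to the
  Gaussian and once as a total mass, so inversion carries its square.\<close>

definition gauss_const :: "'d::finite itself \<Rightarrow> complex" where
  "gauss_const _ = (LINT x|lborel. gauss (0::real^'d) x)"

text \<open>Both the Gaussian and its transform satisfy \<open>\<partial>\<^sub>k g = - x\<^sub>k g\<close>, so they are proportional.\<close>

lemma fourier_gauss: "fourier (gauss 0) \<xi> = gauss_const TYPE('d) * gauss 0 (\<xi>::real^'d::finite)"
proof -
  define E where "E \<xi> = of_real (exp ((\<xi> \<bullet> \<xi>) / 2)) * fourier (gauss 0) \<xi>" for \<xi> :: "real^'d"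
  have coef: "fourier (\<lambda>x. - \<i> * (of_real (x $ k) * gauss 0 x)) \<xi> = - of_real (\<xi> $ k) * fourier (gauss 0) \<xi>"
    for k and \<xi> :: "real^'d"
  proof -
    have "(\<lambda>x. - \<i> * (of_real (x $ k) * gauss (0::real^'d) x)) = (\<lambda>x. \<i> * partial_deriv k (gauss 0) x)"
      unfolding partial_deriv_gauss by auto
    then have "fourier (\<lambda>x. - \<i> * (of_real (x $ k) * gauss 0 x)) \<xi> = \<i> * fourier (partial_deriv k (gauss 0)) \<xi>"
      by (simp only: fourier_cmult)
    then show ?thesis
      by (simp add: fourier_partial_deriv[OF schwartz_gauss] mult.assoc[symmetric])
  qed
  have "(E has_derivative (\<lambda>h. 0)) (at \<xi>)" for \<xi>
  proof -
    have 1: "(fourier (gauss 0) has_derivative (\<lambda>h. - of_real (\<xi> \<bullet> h) * fourier (gauss 0) \<xi>)) (at \<xi>)"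
    proof -
      have "(\<Sum>k\<in>UNIV. of_real (h $ k) * fourier (\<lambda>x. - \<i> * (of_real (x $ k) * gauss 0 x)) \<xi>) =
          - of_real (\<xi> \<bullet> h) * fourier (gauss 0) \<xi>" for h
        unfolding coef by (simp add: inner_vec_def sum_distrib_left sum_negf mult_ac)
      with fourier_has_derivative[OF schwartz_gauss[of "0::real^'d"], of \<xi>] show ?thesis by simp
    qed
    have 2: "((\<lambda>\<xi>. complex_of_real (exp ((\<xi> \<bullet> \<xi>) / 2))) has_derivative
        (\<lambda>h. of_real ((\<xi> \<bullet> h) * exp ((\<xi> \<bullet> \<xi>) / 2)))) (at \<xi>)"
      by (auto intro!: derivative_eq_intros simp: inner_commute field_simps)
    show ?thesis
      unfolding E_def[abs_def] using has_derivative_mult[OF 2 1] by (simp add: algebra_simps)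
  qed
  then obtain c where c: "E x = c" for x
    using has_derivative_zero_constant[of UNIV E] by auto
  have "E \<xi> = E 0" unfolding c ..
  also have "E 0 = gauss_const TYPE('d)"
    by (simp add: E_def gauss_const_def fourier_def)
  finally have "of_real (exp (- (\<xi> \<bullet> \<xi>) / 2)) * E \<xi> = gauss_const TYPE('d) * gauss 0 \<xi>"
    by (simp add: gauss_eq)
  then show ?thesis
    unfolding E_def mult.assoc[symmetric] of_real_mult[symmetric] exp_add[symmetric] by simp
qed

lemma gauss_const_nonzero: "gauss_const TYPE('d::finite) \<noteq> 0"
proof
  assume 0: "gauss_const TYPE('d) = 0"
  let ?g = "\<lambda>x::real^'d. exp (- (x \<bullet> x) / 2)"
  have i: "integrable lborel ?g"
    using integrable_norm[OF schwartz_integrable[OF schwartz_gauss[of "0::real^'d"]]] by (simp add: norm_gauss)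
  have "gauss_const TYPE('d) = of_real (LINT x|lborel. ?g x)"
    unfolding gauss_const_def gauss_eq using i by simp
  with 0 have "(LINT x|lborel. ?g x) = 0" by simp
  then have "AE x::real^'d in lborel. ?g x = 0"
    by (subst (asm) integral_nonneg_eq_0_iff_AE[OF i]) auto
  then have "AE x::real^'d in lborel. False" by simp
  then have "emeasure lborel (UNIV :: (real^'d) set) = 0"
    by (simp add: AE_iff_measurable[OF _ refl])
  then show False by simp
qed

lemma fourier_multiplication_formula:
  fixes f g :: "real^'d::finite \<Rightarrow> complex"
  assumes f: "integrable lborel f" and g: "integrable lborel g"
  shows "(LINT x|lborel. fourier f x * g x) = (LINT x|lborel. f x * fourier g x)"
proof -
  have [measurable]: "f \<in> borel_measurable borel" "g \<in> borel_measurable borel"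
    using f g by auto
  define h where "h x y = cis (- (y \<bullet> x)) * f x * g y" for x y
  have hm: "case_prod h \<in> borel_measurable (lborel \<Otimes>\<^sub>M lborel)"
    unfolding h_def by measurable
  have "integrable (lborel \<Otimes>\<^sub>M lborel) (case_prod h)"
  proof (rule lborel_pair.Fubini_integrable[OF hm])
    have "(LINT y|lborel. norm (case_prod h (x, y))) = norm (f x) * (LINT y|lborel. norm (g y))" for x
      by (simp add: h_def norm_mult)
    then show "integrable lborel (\<lambda>x. LINT y|lborel. norm (case_prod h (x, y)))"
      using f by simp
    show "AE x in lborel. integrable lborel (\<lambda>y. case_prod h (x, y))"
    proof (intro AE_I2)
      fix x
      have "integrable lborel (\<lambda>y. f x * (cis (- (y \<bullet> x)) * g y))"
        by (intro integrable_mult_right integrable_cis_mult g) measurable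
      then show "integrable lborel (\<lambda>y. case_prod h (x, y))"
        by (simp add: h_def mult_ac)
    qed
  qed
  from lborel_pair.Fubini_integral[OF this]
  have "(LINT y|lborel. LINT x|lborel. h x y) = (LINT x|lborel. LINT y|lborel. h x y)" .
  moreover have "(LINT x|lborel. h x y) = fourier f y * g y" for y
    unfolding fourier_def h_def by simp
  moreover have "(LINT y|lborel. h x y) = f x * fourier g x" for x
    unfolding fourier_def h_def
    by (subst integral_mult_right_zero[symmetric]) (simp add: inner_commute mult_ac)
  ultimately show ?thesis by simp
qed

text \<open>A Gaussian factor of scale \<open>\<epsilon> n\<close> opens the inversion integral to
  the multiplication formula, which moves the transform onto a function concentrating at
  \<open>x\<close>. As the scale tends to zero both forms converge by dominated convergence;
  \<open>?c\<close> arises once from transforming the Gaussian and once from integrating it.\<close>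

lemma fourier_inversion:
  fixes f :: "real^'d::finite \<Rightarrow> complex"
  assumes f: "schwartz f"
  shows "(LINT \<xi>|lborel. cis (x \<bullet> \<xi>) * fourier f \<xi>) = (gauss_const TYPE('d))\<^sup>2 * f x"
proof -
  let ?c = "gauss_const TYPE('d)"
  note fm [measurable] = schwartz_measurable[OF f]
  note gm [measurable] = schwartz_measurable[OF schwartz_gauss[of "0::real^'d"]]
  note Fm [measurable] = schwartz_measurable[OF schwartz_fourier[OF f]]
  note gi = schwartz_integrable[OF schwartz_gauss[of "0::real^'d"]]
  define \<epsilon> where "\<epsilon> n = 1 / (real n + 1)" for n
  have \<epsilon>: "0 < \<epsilon> n" for n by (simp add: \<epsilon>_def)
  have \<epsilon>lim: "\<epsilon> \<longlonglongrightarrow> 0"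
    unfolding \<epsilon>_def using LIMSEQ_inverse_real_of_nat by (simp add: inverse_eq_divide add.commute)
  have cg: "continuous_on UNIV (gauss (0::real^'d))" by (rule schwartz_continuous[OF schwartz_gauss])
  have cf: "continuous_on UNIV f" by (rule schwartz_continuous[OF f])
  have eq: "(LINT \<xi>|lborel. fourier f \<xi> * (cis (x \<bullet> \<xi>) * gauss 0 (\<epsilon> n *\<^sub>R \<xi>))) = (LINT z|lborel. f (x + \<epsilon> n *\<^sub>R z) * (?c * gauss 0 z))" for n
  proof -
    let ?e = "\<epsilon> n"
    define g where "g \<xi> = cis (x \<bullet> \<xi>) * gauss 0 (?e *\<^sub>R \<xi>)" for \<xi> :: "real^'d"
    have [measurable]: "g \<in> borel_measurable borel" unfolding g_def by measurable
    have gint: "integrable lborel g"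
    proof -
      have "integrable lborel (\<lambda>\<xi>. gauss (0::real^'d) (?e *\<^sub>R \<xi>))"
      proof -
        have "integrable (density (distr lborel borel (\<lambda>x. 0 + ?e *\<^sub>R x)) (\<lambda>_. \<bar>?e\<bar> ^ DIM(real^'d))) (gauss (0::real^'d))"
          using gi lborel_affine[of ?e "0::real^'d"] \<epsilon>[of n] by simp
        then have "integrable (distr lborel borel (\<lambda>x. 0 + ?e *\<^sub>R x)) (\<lambda>x. (\<bar>?e\<bar> ^ DIM(real^'d)) *\<^sub>R gauss (0::real^'d) x)"
          by (subst (asm) integrable_density) auto
        then have "integrable (distr lborel borel (\<lambda>x. 0 + ?e *\<^sub>R x)) (gauss (0::real^'d))"
          using \<epsilon>[of n] integrable_scaleR_right[of "inverse (\<bar>?e\<bar> ^ DIM(real^'d))" _ "\<lambda>x. (\<bar>?e\<bar> ^ DIM(real^'d)) *\<^sub>R gauss (0::real^'d) x"]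
          by simp
        then show ?thesis
          by (subst (asm) integrable_distr_eq) auto
      qed
      then show ?thesis
        unfolding g_def by (rule integrable_cis_mult) measurable
    qed
    \<comment> \<open>Dilation turns the transform into a bump of width \<open>?e\<close> around
      \<open>x\<close>, whose height cancels the Jacobian of the substitution y = x +
      \<open>?e\<close> z made afterwards.\<close>
    have Fg: "fourier g y = (1 / ?e) ^ CARD('d) *\<^sub>R (?c * gauss 0 ((y - x) /\<^sub>R ?e))" for y
    proof -
      have "fourier g y = (LINT \<xi>|lborel. cis (- ((y - x) \<bullet> \<xi>)) * gauss 0 (?e *\<^sub>R \<xi>))"
        unfolding fourier_def g_def by (simp add: mult.assoc[symmetric] cis_mult inner_diff_left)
      also have "\<dots> = (1 / ?e) ^ CARD('d) *\<^sub>R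
          (LINT \<xi>|lborel. cis (- ((y - x) \<bullet> (0 + (1 / ?e) *\<^sub>R \<xi>))) * gauss 0 (?e *\<^sub>R (0 + (1 / ?e) *\<^sub>R \<xi>)))"
        using \<epsilon>[of n] by (subst lborel_affine_integral[of _ "1 / ?e" 0]) auto
      also have "\<dots> = (1 / ?e) ^ CARD('d) *\<^sub>R fourier (gauss 0) ((y - x) /\<^sub>R ?e)"
        unfolding fourier_def using \<epsilon>[of n] by (simp add: inverse_eq_divide)
      finally show ?thesis by (simp add: fourier_gauss)
    qed
    have "(LINT \<xi>|lborel. fourier f \<xi> * g \<xi>) = (LINT y|lborel. f y * fourier g y)"
      by (rule fourier_multiplication_formula[OF schwartz_integrable[OF f] gint])
    also have "\<dots> = \<bar>?e\<bar> ^ DIM(real^'d) *\<^sub>R (LINT z|lborel. f (x + ?e *\<^sub>R z) * fourier g (x + ?e *\<^sub>R z))"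
      unfolding Fg by (rule lborel_affine_integral) (use \<epsilon>[of n] in auto)
    also have "\<dots> = (LINT z|lborel. f (x + ?e *\<^sub>R z) * (?c * gauss 0 z))"
      unfolding Fg using \<epsilon>[of n]
      by (subst integral_scaleR_right[symmetric]) (simp add: power_divide inverse_eq_divide)
    finally show ?thesis unfolding g_def .
  qed
  have lim1: "(\<lambda>n. LINT \<xi>|lborel. fourier f \<xi> * (cis (x \<bullet> \<xi>) * gauss 0 (\<epsilon> n *\<^sub>R \<xi>))) \<longlonglongrightarrow> (LINT \<xi>|lborel. cis (x \<bullet> \<xi>) * fourier f \<xi>)"
  proof (rule integral_dominated_convergence)
    show "integrable lborel (\<lambda>\<xi>. norm (fourier f \<xi>))"
      by (intro integrable_norm schwartz_integrable schwartz_fourier f)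
    show "AE \<xi> in lborel. (\<lambda>n. fourier f \<xi> * (cis (x \<bullet> \<xi>) * gauss 0 (\<epsilon> n *\<^sub>R \<xi>))) \<longlonglongrightarrow> cis (x \<bullet> \<xi>) * fourier f \<xi>"
    proof (intro AE_I2)
      fix \<xi> :: "real^'d"
      have "(\<lambda>n. \<epsilon> n *\<^sub>R \<xi>) \<longlonglongrightarrow> 0 *\<^sub>R \<xi>" by (intro tendsto_intros \<epsilon>lim)
      then have "(\<lambda>n. gauss 0 (\<epsilon> n *\<^sub>R \<xi>)) \<longlonglongrightarrow> gauss 0 (0 *\<^sub>R \<xi>)"
        by (rule continuous_on_tendsto_compose[OF cg]) auto
      then have "(\<lambda>n. fourier f \<xi> * (cis (x \<bullet> \<xi>) * gauss 0 (\<epsilon> n *\<^sub>R \<xi>))) \<longlonglongrightarrow> fourier f \<xi> * (cis (x \<bullet> \<xi>) * gauss 0 (0 *\<^sub>R \<xi>))"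
        by (intro tendsto_intros)
      then show "(\<lambda>n. fourier f \<xi> * (cis (x \<bullet> \<xi>) * gauss 0 (\<epsilon> n *\<^sub>R \<xi>))) \<longlonglongrightarrow> cis (x \<bullet> \<xi>) * fourier f \<xi>"
        by (simp add: gauss_eq mult.commute)
    qed
    show "AE \<xi> in lborel. norm (fourier f \<xi> * (cis (x \<bullet> \<xi>) * gauss 0 (\<epsilon> n *\<^sub>R \<xi>))) \<le> norm (fourier f \<xi>)" for n
      by (intro AE_I2) (simp only: norm_mult norm_cis mult_1_left, intro mult_left_le norm_gauss_le_1 norm_ge_zero)
  qed measurable
  obtain B where B: "\<And>x. norm (f x) \<le> B" using schwartz_bounded[OF f] by blast
  have lim2: "(\<lambda>n. LINT z|lborel. f (x + \<epsilon> n *\<^sub>R z) * (?c * gauss 0 z)) \<longlonglongrightarrow> (LINT z|lborel. f x * (?c * gauss (0::real^'d) z))"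
  proof (rule integral_dominated_convergence)
    show "integrable lborel (\<lambda>z. B * (norm ?c * norm (gauss (0::real^'d) z)))"
      by (intro integrable_mult_right integrable_norm gi)
    show "AE z in lborel. (\<lambda>n. f (x + \<epsilon> n *\<^sub>R z) * (?c * gauss 0 z)) \<longlonglongrightarrow> f x * (?c * gauss 0 z)"
    proof (intro AE_I2)
      fix z :: "real^'d"
      have "(\<lambda>n. x + \<epsilon> n *\<^sub>R z) \<longlonglongrightarrow> x + 0 *\<^sub>R z" by (intro tendsto_intros \<epsilon>lim)
      then have "(\<lambda>n. f (x + \<epsilon> n *\<^sub>R z)) \<longlonglongrightarrow> f (x + 0 *\<^sub>R z)"
        by (rule continuous_on_tendsto_compose[OF cf]) auto
      then show "(\<lambda>n. f (x + \<epsilon> n *\<^sub>R z) * (?c * gauss 0 z)) \<longlonglongrightarrow> f x * (?c * gauss 0 z)"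
        by (intro tendsto_intros) simp
    qed
    show "AE z in lborel. norm (f (x + \<epsilon> n *\<^sub>R z) * (?c * gauss 0 z)) \<le> B * (norm ?c * norm (gauss (0::real^'d) z))" for n
      using B by (intro AE_I2) (simp add: norm_mult mult_right_mono)
  qed measurable
  have "(LINT \<xi>|lborel. cis (x \<bullet> \<xi>) * fourier f \<xi>) = (LINT z|lborel. f x * (?c * gauss (0::real^'d) z))"
    using LIMSEQ_unique[OF lim1[unfolded eq] lim2] .
  also have "\<dots> = f x * (?c * ?c)"
    by (simp add: gauss_const_def)
  finally show ?thesis by (simp add: power2_eq_square mult.commute)
qed

text \<open>The two-sided inverse of \<open>fourier\<close> on the Schwartz space, with the
  normalisation read off from \<open>fourier_inversion\<close>.\<close>

definition ifourier :: "(real^'d::finite \<Rightarrow> complex) \<Rightarrow> real^'d \<Rightarrow> complex" where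
  "ifourier \<phi> \<xi> = 1 / (gauss_const TYPE('d))\<^sup>2 * fourier \<phi> (- \<xi>)"

lemma schwartz_ifourier: "schwartz \<phi> \<Longrightarrow> schwartz (ifourier \<phi>)"
  unfolding ifourier_def[abs_def] by (intro schwartz_cmult schwartz_reflect schwartz_fourier)

lemma ifourier_fourier: "schwartz f \<Longrightarrow> ifourier (fourier f) = f"
  using fourier_inversion[of f] gauss_const_nonzero
  by (auto simp: ifourier_def fourier_def[of "fourier f"] fun_eq_iff)

lemma fourier_ifourier:
  fixes \<phi> :: "real^'d::finite \<Rightarrow> complex"
  assumes "schwartz \<phi>"
  shows "fourier (ifourier \<phi>) = \<phi>"
proof
  fix \<xi> :: "real^'d"
  let ?c = "(gauss_const TYPE('d))\<^sup>2"
  note [measurable] = schwartz_measurable[OF schwartz_fourier[OF assms]]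
  have "fourier (ifourier \<phi>) \<xi> = 1 / ?c * (LINT x|lborel. cis (\<xi> \<bullet> (- x)) * fourier \<phi> (- x))"
    unfolding fourier_def[of "ifourier \<phi>"] ifourier_def integral_mult_right_zero[symmetric]
    by (simp add: mult_ac)
  also have "(LINT x|lborel. cis (\<xi> \<bullet> (- x)) * fourier \<phi> (- x)) = (LINT x|lborel. cis (\<xi> \<bullet> x) * fourier \<phi> x)"
    by (rule lborel_integral_reflect) measurable
  finally show "fourier (ifourier \<phi>) \<xi> = \<phi> \<xi>"
    using fourier_inversion[OF assms] gauss_const_nonzero[where 'd = 'd] by simp
qed

section \<open>Approximation by trigonometric polynomials\<close>

lemma tendsto_clamped_1:
  fixes c d :: real
  assumes "0 < d"
  shows "(\<lambda>n. min 1 (max 0 ((real n + 1) * d - c))) \<longlonglongrightarrow> 1"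
proof (rule tendsto_eventually)
  obtain N :: nat where N: "(1 + c) / d \<le> real N" using real_arch_simple by blast
  show "\<forall>\<^sub>F n in sequentially. min 1 (max 0 ((real n + 1) * d - c)) = 1"
    unfolding eventually_sequentially
  proof (intro exI[of _ N] allI impI)
    fix n assume "N \<le> n"
    then have "(1 + c) / d \<le> real n + 1" using N by linarith
    then have "1 + c \<le> (real n + 1) * d" using assms by (simp add: pos_divide_le_eq)
    then show "min 1 (max 0 ((real n + 1) * d - c)) = 1" by simp
  qed
qed

text \<open>A measurable function is almost everywhere a limit of continuous ones. Retraction onto
  the ball of radius \<open>B\<close> restores the bound, and cutting off near the complement of
  \<open>S\<close> and near infinity makes the supports compact. The common bound is kept for
  dominated convergence.\<close>

lemma compact_support_approximation:
  fixes b :: "'a::euclidean_space \<Rightarrow> complex"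
  assumes [measurable]: "b \<in> borel_measurable borel"
    and B: "\<And>x. norm (b x) \<le> B" and S: "open S" "S \<noteq> UNIV"
  obtains \<phi> K where "\<And>n::nat. continuous_on UNIV (\<phi> n)" "\<And>n. compact (K n)" "\<And>n. K n \<subseteq> S"
    "\<And>n x. x \<notin> K n \<Longrightarrow> \<phi> n x = 0" "\<And>n x. norm (\<phi> n x) \<le> B"
    "AE x in lborel. x \<in> S \<longrightarrow> (\<lambda>n. \<phi> n x) \<longlonglongrightarrow> b x"
proof -
  have B0: "0 \<le> B" using B[of 0] norm_ge_zero order_trans by blast
  have "b measurable_on UNIV"
    by (rule lebesgue_measurable_imp_measurable_on) (auto intro: measurable_completion)
  then obtain N g where N: "negligible N" and g: "\<And>n. continuous_on UNIV (g n)"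
    and lim: "\<And>x. x \<notin> N \<Longrightarrow> (\<lambda>n. g n x) \<longlonglongrightarrow> b x"
    by (auto simp: measurable_on_def)
  define P where "P = closest_point (cball (0::complex) B)"
  have P: "continuous_on UNIV P" "norm (P z) \<le> B" "norm z \<le> B \<Longrightarrow> P z = z" for z
    using continuous_on_closest_point[of "cball (0::complex) B"] closest_point_in_set[of "cball (0::complex) B" z]
      closest_point_self[of z "cball (0::complex) B"] B0
    unfolding P_def by auto
  \<comment> \<open>The first factor vanishes up to distance 1/(n+1) from the complement of
    \<open>S\<close> and is 1 from distance 2/(n+1) on; the second is 1 up to radius n and vanishes
    from radius n+1 on.\<close>
  define cut where "cut n x = min 1 (max 0 ((real n + 1) * infdist x (- S) - 1)) * min 1 (max 0 ((real n + 1) * 1 - norm x))"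
    for n and x :: 'a
  have cut: "0 \<le> cut n x" "cut n x \<le> 1" for n x
    unfolding cut_def by (auto intro!: mult_nonneg_nonneg mult_le_one)
  have ccut: "continuous_on UNIV (cut n)" for n
    unfolding cut_def by (intro continuous_intros)
  define K where "K n = {x. 1 \<le> (real n + 1) * infdist x (- S)} \<inter> cball 0 (real n + 1)" for n
  define \<phi> where "\<phi> n x = cut n x *\<^sub>R P (g n x)" for n x
  show ?thesis
  proof (rule that[of \<phi> K])
    show "continuous_on UNIV (\<phi> n)" for n
      unfolding \<phi>_def by (intro continuous_intros ccut continuous_on_compose2[OF P(1) g]) auto
    show "compact (K n)" for n
      unfolding K_def by (intro closed_Int_compact closed_Collect_le continuous_intros) auto
    show "K n \<subseteq> S" for n
    proof
      fix x assume "x \<in> K n"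
      then have "infdist x (- S) \<noteq> 0" unfolding K_def by auto
      then have "x \<notin> - S" by (metis infdist_zero)
      then show "x \<in> S" by simp
    qed
    show "\<phi> n x = 0" if "x \<notin> K n" for n x
      using that unfolding K_def \<phi>_def cut_def by (auto simp: min_def max_def not_le)
    show "norm (\<phi> n x) \<le> B" for n x
    proof -
      have "norm (\<phi> n x) = cut n x * norm (P (g n x))" using cut[of n x] by (simp add: \<phi>_def)
      also have "\<dots> \<le> 1 * B" using cut[of n x] P(2) by (intro mult_mono) auto
      finally show ?thesis by simp
    qed
    show "AE x in lborel. x \<in> S \<longrightarrow> (\<lambda>n. \<phi> n x) \<longlonglongrightarrow> b x"
    proof -
      have "AE x in lebesgue. x \<notin> N"
        using N by (intro AE_not_in) (simp add: negligible_iff_null_sets)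
      then have "AE x in lborel. x \<notin> N"
        by (simp add: AE_completion_iff)
      then show ?thesis
      proof (rule AE_mp, intro AE_I2 impI)
        fix x assume x: "x \<notin> N" "x \<in> S"
        \<comment> \<open>Here \<open>S \<noteq> UNIV\<close> matters: \<open>infdist\<close> to the
          empty set is 0, and the cut-off would vanish everywhere.\<close>
        have "infdist x (- S) \<noteq> 0"
          using in_closed_iff_infdist_zero[of "- S" x] S x by auto
        then have "0 < infdist x (- S)" using infdist_nonneg[of x "- S"] by linarith
        then have "(\<lambda>n. cut n x) \<longlonglongrightarrow> 1 * 1"
          unfolding cut_def by (intro tendsto_mult tendsto_clamped_1) auto
        moreover have "(\<lambda>n. P (g n x)) \<longlonglongrightarrow> P (b x)"
          by (rule continuous_on_tendsto_compose[OF P(1) lim[OF x(1)]]) auto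
        ultimately have "(\<lambda>n. \<phi> n x) \<longlonglongrightarrow> (1 * 1) *\<^sub>R P (b x)"
          unfolding \<phi>_def by (rule tendsto_scaleR)
        then show "(\<lambda>n. \<phi> n x) \<longlonglongrightarrow> b x"
          using P(3)[OF B] by simp
      qed
    qed
  qed
qed

section \<open>Trigonometric polynomials of period 2 pi / a_i in the i-th coordinate\<close>

definition torus_char :: "real^'d::finite \<Rightarrow> int^'d \<Rightarrow> real^'d \<Rightarrow> complex" where
  "torus_char a k \<xi> = cis (- (\<Sum>i\<in>UNIV. of_int (k $ i) * (a $ i * \<xi> $ i)))"

lemma torus_char_0 [simp]: "torus_char a 0 \<xi> = 1"
  by (simp add: torus_char_def)

lemma torus_char_add: "torus_char a (k + m) \<xi> = torus_char a k \<xi> * torus_char a m \<xi>"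
  by (simp add: torus_char_def cis_mult algebra_simps sum.distrib)

lemma norm_torus_char [simp]: "norm (torus_char a k \<xi>) = 1"
  by (simp add: torus_char_def)

lemma torus_char_measurable [measurable]: "torus_char a k \<in> borel_measurable borel"
  unfolding torus_char_def[abs_def] by measurable

inductive trig_poly :: "real^'d::finite \<Rightarrow> (real^'d \<Rightarrow> complex) \<Rightarrow> bool" for a where
  monom: "trig_poly a (\<lambda>\<xi>. c * torus_char a k \<xi>)"
| add: "trig_poly a p \<Longrightarrow> trig_poly a q \<Longrightarrow> trig_poly a (\<lambda>\<xi>. p \<xi> + q \<xi>)"

lemma trig_poly_const: "trig_poly a (\<lambda>\<xi>. c)"
  using trig_poly.monom[of a c 0] by simp

lemma trig_poly_mult:
  assumes "trig_poly a p" "trig_poly a q"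
  shows "trig_poly a (\<lambda>\<xi>. p \<xi> * q \<xi>)"
  using assms(1)
proof induction
  case (monom c k)
  from assms(2) show ?case
  proof induction
    case (monom d m)
    have "(\<lambda>\<xi>. c * torus_char a k \<xi> * (d * torus_char a m \<xi>)) = (\<lambda>\<xi>. (c * d) * torus_char a (k + m) \<xi>)"
      by (simp add: torus_char_add mult_ac)
    then show ?case by (simp only: trig_poly.monom)
  next
    case (add p q)
    then show ?case by (simp only: distrib_left trig_poly.add)
  qed
next
  case (add p q)
  then show ?case by (simp only: distrib_right trig_poly.add)
qed

lemma trig_poly_sum: "finite F \<Longrightarrow> (\<And>i. i \<in> F \<Longrightarrow> trig_poly a (p i)) \<Longrightarrow> trig_poly a (\<lambda>\<xi>. \<Sum>i\<in>F. p i \<xi>)"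
  by (induction F rule: finite_induct) (auto intro: trig_poly_const trig_poly.add)

lemma trig_poly_measurable [measurable_dest]: "trig_poly a p \<Longrightarrow> p \<in> borel_measurable borel"
  by (induction rule: trig_poly.induct) simp_all

lemma trig_poly_bounded: "trig_poly a p \<Longrightarrow> \<exists>B. \<forall>\<xi>. norm (p \<xi>) \<le> B"
proof (induction rule: trig_poly.induct)
  case (monom c k) then show ?case by (auto simp: norm_mult)
next
  case (add p q)
  then obtain B C where "\<And>\<xi>. norm (p \<xi>) \<le> B" "\<And>\<xi>. norm (q \<xi>) \<le> C" by blast
  then have "norm (p \<xi> + q \<xi>) \<le> B + C" for \<xi>
    using norm_triangle_mono by blast
  then show ?case by blast
qed

text \<open>A derivation of \<open>trig_poly\<close> may produce a frequency several times.
  Collecting the coefficients gives the form with distinct frequencies in which best approximations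
  are compared.\<close>

lemma trig_poly_expand:
  assumes "trig_poly a p"
  shows "\<exists>F c. finite F \<and> p = (\<lambda>\<xi>. \<Sum>k\<in>F. c k * torus_char a k \<xi>)"
  using assms
proof induction
  case (monom c k)
  show ?case by (rule exI[of _ "{k}"], rule exI[of _ "\<lambda>_. c"]) simp
next
  case (add p q)
  then obtain F c G d where F: "finite F" "p = (\<lambda>\<xi>. \<Sum>k\<in>F. c k * torus_char a k \<xi>)"
    and G: "finite G" "q = (\<lambda>\<xi>. \<Sum>k\<in>G. d k * torus_char a k \<xi>)" by blast
  define c' where "c' k = (if k \<in> F then c k else 0)" for k
  define d' where "d' k = (if k \<in> G then d k else 0)" for k
  have p: "p \<xi> = (\<Sum>k\<in>F \<union> G. c' k * torus_char a k \<xi>)" for \<xi>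
    unfolding F(2) using F(1) G(1) by (intro sum.mono_neutral_cong_left) (auto simp: c'_def)
  have q: "q \<xi> = (\<Sum>k\<in>F \<union> G. d' k * torus_char a k \<xi>)" for \<xi>
    unfolding G(2) using F(1) G(1) by (intro sum.mono_neutral_cong_left) (auto simp: d'_def)
  have "(\<lambda>\<xi>. p \<xi> + q \<xi>) = (\<lambda>\<xi>. \<Sum>k\<in>F \<union> G. (c' k + d' k) * torus_char a k \<xi>)"
    unfolding p q by (simp add: sum.distrib distrib_right)
  then show ?case
    using F(1) G(1) by (intro exI[of _ "F \<union> G"] exI[of _ "\<lambda>k. c' k + d' k"]) simp
qed

definition torus_map :: "real^'d::finite \<Rightarrow> real^'d \<Rightarrow> complex^'d" where
  "torus_map a \<xi> = (\<chi> i. cis (a $ i * \<xi> $ i))"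

lemma trig_poly_cis_coord: "trig_poly a (\<lambda>\<xi>. cis (of_int m * (a $ i * \<xi> $ i)))"
proof -
  have "torus_char a (\<chi> j. if j = i then - m else 0) \<xi> = cis (of_int m * (a $ i * \<xi> $ i))" for \<xi>
  proof -
    have "(\<Sum>j\<in>UNIV. of_int ((\<chi> j. if j = i then - m else 0) $ j) * (a $ j * \<xi> $ j)) =
      (\<Sum>j\<in>UNIV. if j = i then - (of_int m * (a $ i * \<xi> $ i)) else 0)"
      by (intro sum.cong) auto
    then show ?thesis by (simp add: torus_char_def)
  qed
  with trig_poly.monom[of a 1 "\<chi> j. if j = i then - m else 0"] show ?thesis by simp
qed

text \<open>The link with Stone-Weierstrass. A real-linear functional on the torus is a combination
  of cosines and sines of single coordinates, hence of exponentials with frequency 1 and -1, and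
  products add frequencies.\<close>

lemma trig_poly_real_polynomial:
  assumes "real_polynomial_function p"
  shows "trig_poly a (\<lambda>\<xi>. of_real (p (torus_map a \<xi>)))"
  using assms
proof induction
  case (linear f)
  interpret bounded_linear f by fact
  have z: "z = (\<Sum>i\<in>UNIV. Re (z $ i) *\<^sub>R axis i 1 + Im (z $ i) *\<^sub>R axis i \<i>)" for z :: "complex^'d"
  proof (simp add: vec_eq_iff sum.distrib, intro allI)
    fix j
    have "(\<Sum>i\<in>UNIV. Re (z $ i) *\<^sub>R axis i 1 $ j) = (\<Sum>i\<in>UNIV. if i = j then of_real (Re (z $ i)) else (0::complex))"
      by (intro sum.cong) (auto simp: axis_def scaleR_conv_of_real)
    moreover have "(\<Sum>i\<in>UNIV. Im (z $ i) *\<^sub>R axis i \<i> $ j) = (\<Sum>i\<in>UNIV. if i = j then of_real (Im (z $ i)) * \<i> else (0::complex))"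
      by (intro sum.cong) (auto simp: axis_def scaleR_conv_of_real)
    ultimately show "z $ j = (\<Sum>i\<in>UNIV. Re (z $ i) *\<^sub>R axis i 1 $ j) + (\<Sum>i\<in>UNIV. Im (z $ i) *\<^sub>R axis i \<i> $ j)"
      by (simp add: complex_eq mult.commute)
  qed
  have fz: "f z = (\<Sum>i\<in>UNIV. Re (z $ i) * f (axis i 1) + Im (z $ i) * f (axis i \<i>))" for z
    by (subst z) (simp add: sum add scaleR)
  have re: "trig_poly a (\<lambda>\<xi>. of_real (cos (a $ i * \<xi> $ i)))" for i
  proof -
    have "complex_of_real (cos t) = (1/2) * cis t + (1/2) * cis (- t)" for t by (simp add: complex_eq_iff)
    moreover have "trig_poly a (\<lambda>\<xi>. (1/2) * cis (a $ i * \<xi> $ i) + (1/2) * cis (- (a $ i * \<xi> $ i)))"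
      using trig_poly_cis_coord[of a 1 i] trig_poly_cis_coord[of a "-1" i]
      by (intro trig_poly.add trig_poly_mult trig_poly_const) simp_all
    ultimately show ?thesis by simp
  qed
  have im: "trig_poly a (\<lambda>\<xi>. of_real (sin (a $ i * \<xi> $ i)))" for i
  proof -
    have "complex_of_real (sin t) = (-\<i>/2) * cis t + (\<i>/2) * cis (- t)" for t by (simp add: complex_eq_iff)
    moreover have "trig_poly a (\<lambda>\<xi>. (-\<i>/2) * cis (a $ i * \<xi> $ i) + (\<i>/2) * cis (- (a $ i * \<xi> $ i)))"
      using trig_poly_cis_coord[of a 1 i] trig_poly_cis_coord[of a "-1" i]
      by (intro trig_poly.add trig_poly_mult trig_poly_const) simp_all
    ultimately show ?thesis by simp
  qed
  have "trig_poly a (\<lambda>\<xi>. \<Sum>i\<in>UNIV. of_real (cos (a $ i * \<xi> $ i)) * of_real (f (axis i 1)) + of_real (sin (a $ i * \<xi> $ i)) * of_real (f (axis i \<i>)))"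
    by (intro trig_poly_sum trig_poly.add trig_poly_mult re im trig_poly_const) simp
  moreover have "f (torus_map a \<xi>) =
      (\<Sum>i\<in>UNIV. cos (a $ i * \<xi> $ i) * f (axis i 1) + sin (a $ i * \<xi> $ i) * f (axis i \<i>))" for \<xi>
    by (subst fz) (simp add: torus_map_def)
  ultimately show ?case by simp
next
  case (const c) then show ?case by (rule trig_poly_const)
next
  case (add f g) then show ?case by (simp add: trig_poly.add)
next
  case (mult f g) then show ?case by (simp add: trig_poly_mult)
qed

definition shell :: "real^'d::finite \<Rightarrow> ('d \<Rightarrow> nat) \<Rightarrow> (real^'d) set" where
  "shell a m = {\<xi>. \<forall>i. real (m i) * pi \<le> \<bar>a $ i * \<xi> $ i\<bar> \<and> \<bar>a $ i * \<xi> $ i\<bar> \<le> (real (m i) + 1) * pi}"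

definition open_shell :: "real^'d::finite \<Rightarrow> ('d \<Rightarrow> nat) \<Rightarrow> (real^'d) set" where
  "open_shell a m = {\<xi>. \<forall>i. real (m i) * pi < \<bar>a $ i * \<xi> $ i\<bar> \<and> \<bar>a $ i * \<xi> $ i\<bar> < (real (m i) + 1) * pi}"

text \<open>On the two intervals \<open>m \<pi> < \<bar>t\<bar> < (m + 1) \<pi>\<close>, which together form a period, \<open>t\<close> differs from
  \<open>Arg (cis t)\<close> by a multiple of \<open>2 \<pi>\<close> that only depends on the half plane of \<open>cis t\<close>.\<close>

definition branch :: "nat \<Rightarrow> real" where
  "branch m = (if even m then real m else - (real m + 1)) * pi"

text \<open>Of m and -(m + 1) \<open>branch\<close> takes the even one, so the shift is a multiple
  of 2 pi for each value of the sign.\<close>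

lemma cis_branch: "cis (branch m * sgn y) = 1"
proof -
  obtain n :: int where n: "branch m = 2 * pi * of_int n"
  proof (cases "even m")
    case True
    then obtain j where "m = 2 * j" by blast
    then show ?thesis using that[of "int j"] by (simp add: branch_def)
  next
    case False
    then obtain j where "m = 2 * j + 1" by (blast elim: oddE)
    then show ?thesis using that[of "- int (j + 1)"] by (simp add: branch_def algebra_simps)
  qed
  have "branch m * sgn y = 2 * pi * of_int (n * (if y = 0 then 0 else if 0 < y then 1 else - 1))"
    by (auto simp: n sgn_if)
  then show ?thesis by (simp only: cis_multiple_2pi Ints_of_int)
qed

text \<open>The parity of \<open>m\<close> decides the half plane of \<open>cis t\<close> for
  positive \<open>t\<close>: the upper one for even \<open>m\<close>, the lower one for odd
  \<open>m\<close>. Multiplying the shift by the sign of the imaginary part thus recovers both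
  intervals with one formula; the negative value of \<open>branch\<close> for odd \<open>m\<close>
  compensates the exchanged half planes.\<close>

lemma branch_unwrap:
  assumes "real m * pi < \<bar>t\<bar>" "\<bar>t\<bar> < (real m + 1) * pi"
  shows "Im (cis t) \<noteq> 0" "Arg (cis t) + branch m * sgn (Im (cis t)) = t"
proof -
  have shift: "cis t = cis (t - 2 * pi * of_int n)" for n :: int
  proof -
    have "cis (t - 2 * pi * of_int n) = cis t * cis (- (2 * pi * of_int n))" by (simp add: cis_mult)
    also have "cis (- (2 * pi * of_int n)) = 1" using cis_multiple_2pi[of "of_int (- n)"] by simp
    finally show ?thesis by simp
  qed
  have pos: "Im (cis t) > 0 \<and> Arg (cis t) = t - 2 * pi * of_int n" if "0 < t - 2 * pi * of_int n" "t - 2 * pi * of_int n < pi" for n :: int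
    unfolding shift[of n] using that by (auto simp: Arg_cis sin_gt_zero)
  have neg: "Im (cis t) < 0 \<and> Arg (cis t) = t - 2 * pi * of_int n" if "- pi < t - 2 * pi * of_int n" "t - 2 * pi * of_int n < 0" for n :: int
    unfolding shift[of n] using that sin_gt_zero[of "- (t - 2 * pi * of_int n)"]
    by (auto simp: Arg_cis simp del: minus_diff_eq)
  have "Im (cis t) \<noteq> 0 \<and> Arg (cis t) + branch m * sgn (Im (cis t)) = t"
  proof (cases "even m")
    case True
    then obtain j where j: "m = 2 * j" by blast
    show ?thesis
    proof (cases "0 \<le> t")
      case True
      with assms have "0 < t - 2 * pi * of_int (int j)" "t - 2 * pi * of_int (int j) < pi"
        by (auto simp: j algebra_simps)
      from pos[OF this] show ?thesis by (auto simp: j branch_def)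
    next
      case False
      with assms have "- pi < t - 2 * pi * of_int (- int j)" "t - 2 * pi * of_int (- int j) < 0"
        by (auto simp: j algebra_simps)
      from neg[OF this] show ?thesis by (auto simp: j branch_def)
    qed
  next
    case False
    then obtain j where j: "m = 2 * j + 1" by (blast elim: oddE)
    show ?thesis
    proof (cases "0 \<le> t")
      case True
      with assms have "- pi < t - 2 * pi * of_int (int j + 1)" "t - 2 * pi * of_int (int j + 1) < 0"
        by (auto simp: j algebra_simps)
      from neg[OF this] show ?thesis by (auto simp: j branch_def algebra_simps)
    next
      case False
      with assms have "0 < t - 2 * pi * of_int (- int j - 1)" "t - 2 * pi * of_int (- int j - 1) < pi"
        by (auto simp: j algebra_simps)
      from pos[OF this] show ?thesis by (auto simp: j branch_def algebra_simps)
    qed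
  qed
  then show "Im (cis t) \<noteq> 0" "Arg (cis t) + branch m * sgn (Im (cis t)) = t" by auto
qed

lemma sin_boundary_zero: "\<bar>t\<bar> = real m * pi \<Longrightarrow> sin t = 0"
  by (cases "0 \<le> t") (auto simp: minus_equation_iff[of t])

text \<open>On the open shell \<open>torus_map\<close> has the inverse \<open>\<theta>\<close>. A
  function with compact support there becomes, extended by zero, a continuous function on the torus,
  where Stone-Weierstrass applies. Since the approximant is a polynomial on the torus, it is bounded
  at all frequencies and not only on the shell; dominated convergence over growing shells relies on
  that.\<close>

lemma trig_poly_approximation:
  fixes \<phi> :: "real^'d::finite \<Rightarrow> complex"
  assumes a: "\<And>i. 0 < a $ i" and \<phi>: "continuous_on UNIV \<phi>" and K: "compact K" "K \<subseteq> open_shell a m"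
    and supp: "\<And>x. x \<notin> K \<Longrightarrow> \<phi> x = 0" and B: "\<And>x. norm (\<phi> x) \<le> B" and e: "0 < e"
  obtains q where "trig_poly a q" "\<And>\<xi>. \<xi> \<in> shell a m \<Longrightarrow> norm (\<phi> \<xi> - q \<xi>) < e"
    "\<And>\<xi>. norm (q \<xi>) \<le> B + e"
proof -
  define S :: "(complex^'d) set" where "S = {z. \<forall>i. norm (z $ i) = 1}"
  define U :: "(complex^'d) set" where "U = {z. \<forall>i. Im (z $ i) \<noteq> 0}"
  define \<theta> :: "complex^'d \<Rightarrow> real^'d" where "\<theta> z = (\<chi> i. (Arg (z $ i) + branch (m i) * sgn (Im (z $ i))) / a $ i)" for z
  define G where "G z = (if z \<in> U then \<phi> (\<theta> z) else 0)" for z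
  have cont_E: "continuous_on UNIV (torus_map a)"
    unfolding torus_map_def by (intro continuous_intros)
  have B0: "0 \<le> B" using B[of 0] norm_ge_zero order_trans by blast
  have G_B: "norm (G z) \<le> B" for z using B B0 by (simp add: G_def)
  have E_S: "torus_map a \<xi> \<in> S" for \<xi> by (simp add: torus_map_def S_def)
  have \<theta>E: "torus_map a \<xi> \<in> U \<and> \<theta> (torus_map a \<xi>) = \<xi>" if "\<xi> \<in> open_shell a m" for \<xi>
  proof -
    have "Im (cis (a $ i * \<xi> $ i)) \<noteq> 0"
      "Arg (cis (a $ i * \<xi> $ i)) + branch (m i) * sgn (Im (cis (a $ i * \<xi> $ i))) = a $ i * \<xi> $ i" for i
      using that branch_unwrap[of "m i" "a $ i * \<xi> $ i"] unfolding open_shell_def by blast+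
    then show ?thesis
      using a unfolding U_def \<theta>_def torus_map_def by (simp add: vec_eq_iff less_imp_neq[symmetric])
  qed
  have E\<theta>: "torus_map a (\<theta> z) = z" if "z \<in> S" for z
  proof -
    have "cis (Arg (z $ i) + branch (m i) * sgn (Im (z $ i))) = z $ i" for i
    proof -
      have n: "norm (z $ i) = 1" using that by (simp add: S_def)
      then have "z $ i \<noteq> 0" by auto
      then have "cis (Arg (z $ i)) = z $ i" using n by (simp add: cis_Arg sgn_div_norm)
      then show ?thesis by (simp add: cis_mult[symmetric] cis_branch)
    qed
    then show ?thesis
      using a unfolding \<theta>_def torus_map_def by (simp add: vec_eq_iff less_imp_neq[symmetric])
  qed
  \<comment> \<open>A boundary point of the shell has some coordinate with vanishing imaginary part
    on the torus, where \<open>G\<close> is zero by definition; \<phi> vanishes there too, its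
    support lying in the open shell.\<close>
  have G_E: "G (torus_map a \<xi>) = \<phi> \<xi>" if "\<xi> \<in> shell a m" for \<xi>
  proof (cases "\<xi> \<in> open_shell a m")
    case True with \<theta>E show ?thesis by (simp add: G_def)
  next
    case False
    then obtain i where "\<not> (real (m i) * pi < \<bar>a $ i * \<xi> $ i\<bar> \<and> \<bar>a $ i * \<xi> $ i\<bar> < (real (m i) + 1) * pi)"
      unfolding open_shell_def by blast
    moreover have "real (m i) * pi \<le> \<bar>a $ i * \<xi> $ i\<bar> \<and> \<bar>a $ i * \<xi> $ i\<bar> \<le> (real (m i) + 1) * pi"
      using that unfolding shell_def by blast
    moreover have "real (Suc (m i)) = real (m i) + 1" by simp
    ultimately have "\<bar>a $ i * \<xi> $ i\<bar> = real (m i) * pi \<or> \<bar>a $ i * \<xi> $ i\<bar> = real (Suc (m i)) * pi"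
      by (simp only:) linarith
    then have "sin (a $ i * \<xi> $ i) = 0" using sin_boundary_zero by blast
    then have "torus_map a \<xi> \<notin> U" by (auto simp: U_def torus_map_def)
    moreover have "\<phi> \<xi> = 0" using False K(2) supp by blast
    ultimately show ?thesis by (simp add: G_def)
  qed
  have EK: "compact (torus_map a ` K)"
    by (rule compact_continuous_image[OF continuous_on_subset[OF cont_E] K(1)]) simp
  \<comment> \<open>Two relatively open pieces: where the inverse is continuous, and away from the
    image of the support, where \<open>G\<close> is zero. They cover \<open>S\<close> because the
    image of \<open>K\<close> lies in \<open>U\<close>.\<close>
  have "continuous_on ((S \<inter> U) \<union> (S - torus_map a ` K)) G"
  proof (rule continuous_on_Un_local_open)
    have un: "(S \<inter> U) \<union> (S - torus_map a ` K) = S"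
      using \<theta>E K(2) by auto
    have "U = (\<Inter>i\<in>UNIV. {z. Im (z $ i) \<noteq> 0})" by (auto simp: U_def)
    then have "open U"
      by (simp only:) (intro open_INT ballI open_Collect_neq continuous_intros, auto)
    then show "openin (top_of_set (S \<inter> U \<union> (S - torus_map a ` K))) (S \<inter> U)"
      unfolding un by (rule openin_open_Int)
    have "open (- torus_map a ` K)" using EK by (simp add: compact_imp_closed open_Compl)
    from openin_open_Int[OF this, of S]
    show "openin (top_of_set (S \<inter> U \<union> (S - torus_map a ` K))) (S - torus_map a ` K)"
      unfolding un by (simp add: Diff_eq)
    have "continuous_on (S \<inter> U) (\<lambda>z. \<phi> (\<theta> z))"
    proof (rule continuous_on_compose2[OF \<phi>])
      have "z $ i \<notin> \<real>\<^sub>\<le>\<^sub>0" if "z \<in> U" for z i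
        using that unfolding U_def by (auto simp: complex_nonpos_Reals_iff)
      then show "continuous_on (S \<inter> U) \<theta>"
        unfolding \<theta>_def using a
        by (intro continuous_intros) (auto simp: U_def less_imp_neq[symmetric])
    qed auto
    then show "continuous_on (S \<inter> U) G"
      by (rule continuous_on_eq) (simp add: G_def)
    have "G z = 0" if "z \<in> S - torus_map a ` K" for z
    proof (cases "z \<in> U")
      case True
      have "\<theta> z \<notin> K" using E\<theta>[of z] that by force
      then show ?thesis using supp by (simp add: G_def)
    qed (simp add: G_def)
    then show "continuous_on (S - torus_map a ` K) G"
      by (intro continuous_on_eq[OF continuous_on_const[of _ 0]]) simp
  qed
  moreover have "(S \<inter> U) \<union> (S - torus_map a ` K) = S"
    using \<theta>E K(2) by auto
  ultimately have "continuous_on S G" by simp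
  moreover have "compact S"
  proof -
    have "closed S" unfolding S_def by (intro closed_Collect_all closed_Collect_eq continuous_intros)
    moreover have "bounded S"
    proof (rule boundedI)
      fix z assume "z \<in> S"
      then have "(\<Sum>i\<in>UNIV. norm (z $ i)) = real CARD('d)" by (simp add: S_def)
      then show "norm z \<le> real CARD('d)"
        using L2_set_le_sum[of UNIV "\<lambda>i. norm (z $ i)"] by (simp add: norm_vec_def)
    qed
    ultimately show ?thesis by (simp add: compact_eq_bounded_closed)
  qed
  ultimately obtain g where g: "polynomial_function g" and gG: "\<And>z. z \<in> S \<Longrightarrow> norm (G z - g z) < e"
    using Stone_Weierstrass_polynomial_function[OF _ _ e] by metis
  have "real_polynomial_function (\<lambda>z. Re (g z))" "real_polynomial_function (\<lambda>z. Im (g z))"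
    using g bounded_linear_Re bounded_linear_Im unfolding polynomial_function_def o_def by blast+
  then have "trig_poly a (\<lambda>\<xi>. of_real (Re (g (torus_map a \<xi>))) + \<i> * of_real (Im (g (torus_map a \<xi>))))"
    by (intro trig_poly.add trig_poly_mult trig_poly_const trig_poly_real_polynomial)
  then have t: "trig_poly a (\<lambda>\<xi>. g (torus_map a \<xi>))"
    by (simp add: complex_eq[symmetric])
  show ?thesis
  proof (rule that[OF t])
    show "norm (\<phi> \<xi> - g (torus_map a \<xi>)) < e" if "\<xi> \<in> shell a m" for \<xi>
      using gG[OF E_S, of \<xi>] G_E[OF that] by simp
    show "norm (g (torus_map a \<xi>)) \<le> B + e" for \<xi>
      using gG[OF E_S, of \<xi>] G_B[of "torus_map a \<xi>"] norm_triangle_ineq2[of "g (torus_map a \<xi>)" "G (torus_map a \<xi>)"]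
      by (simp add: norm_minus_commute)
  qed
qed

subsection \<open>Shells\<close>

lemma open_open_shell: "open (open_shell a m)"
proof -
  have "open_shell a m = (\<Inter>i\<in>UNIV. {\<xi>. real (m i) * pi < \<bar>a $ i * \<xi> $ i\<bar>} \<inter> {\<xi>. \<bar>a $ i * \<xi> $ i\<bar> < (real (m i) + 1) * pi})"
    by (auto simp: open_shell_def)
  then show ?thesis
    by (simp only:) (intro open_INT ballI open_Int open_Collect_less continuous_intros finite)
qed

lemma closed_shell: "closed (shell a m)"
proof -
  have "shell a m = (\<Inter>i\<in>UNIV. {\<xi>. real (m i) * pi \<le> \<bar>a $ i * \<xi> $ i\<bar>} \<inter> {\<xi>. \<bar>a $ i * \<xi> $ i\<bar> \<le> (real (m i) + 1) * pi})"
    by (auto simp: shell_def)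
  then show ?thesis
    by (simp only:) (intro closed_INT ballI closed_Int closed_Collect_le continuous_intros)
qed

lemma shell_measurable [measurable]: "shell a m \<in> sets borel"
  using closed_shell by (rule borel_closed)

lemma open_shell_neq_UNIV: "open_shell a m \<noteq> UNIV"
proof -
  have "0 \<notin> open_shell a m" by (auto simp: open_shell_def not_less)
  then show ?thesis by blast
qed

lemma AE_coord_neq: "AE x::real^'d::finite in lborel. x $ i \<noteq> c"
proof -
  have "negligible {x::real^'d. axis i 1 \<bullet> x = c}"
    by (rule negligible_hyperplane) (simp add: axis_eq_0_iff)
  then have "AE x in lebesgue. x \<notin> {x::real^'d. axis i 1 \<bullet> x = c}"
    by (intro AE_not_in) (simp add: negligible_iff_null_sets)
  then have "AE x::real^'d in lebesgue. x $ i \<noteq> c"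
    by (simp add: inner_axis')
  then show ?thesis by (simp add: AE_completion_iff)
qed

lemma AE_shell_open_shell:
  fixes a :: "real^'d::finite"
  assumes a: "\<And>i. 0 < a $ i"
  shows "AE x in lborel. x \<in> shell a m \<longleftrightarrow> x \<in> open_shell a m"
proof -
  have ne: "AE x in lborel. a $ i * x $ i \<noteq> c" for i c
    using AE_coord_neq[of i "c / a $ i"] a[of i] by (simp add: eq_divide_eq mult.commute)
  have "AE x in lborel. \<forall>i\<in>UNIV. a $ i * x $ i \<noteq> real (m i) * pi \<and> a $ i * x $ i \<noteq> - (real (m i) * pi) \<and>
     a $ i * x $ i \<noteq> (real (m i) + 1) * pi \<and> a $ i * x $ i \<noteq> - ((real (m i) + 1) * pi)"
    by (intro AE_finite_allI AE_conjI ne) auto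
  then show ?thesis
  proof (rule AE_mp, intro AE_I2 impI)
    fix x :: "real^'d"
    assume x: "\<forall>i\<in>UNIV. a $ i * x $ i \<noteq> real (m i) * pi \<and> a $ i * x $ i \<noteq> - (real (m i) * pi) \<and>
     a $ i * x $ i \<noteq> (real (m i) + 1) * pi \<and> a $ i * x $ i \<noteq> - ((real (m i) + 1) * pi)"
    have "real (m i) * pi \<noteq> \<bar>a $ i * x $ i\<bar> \<and> \<bar>a $ i * x $ i\<bar> \<noteq> (real (m i) + 1) * pi" for i
      using x[rule_format, of i] unfolding abs_if by (metis UNIV_I minus_minus)
    then show "x \<in> shell a m \<longleftrightarrow> x \<in> open_shell a m"
      by (auto simp: shell_def open_shell_def less_le)
  qed
qed

lemma bounded_shell:
  fixes a :: "real^'d::finite"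
  assumes a: "\<And>i. 0 < a $ i"
  shows "bounded (shell a m)"
proof (rule boundedI)
  fix x assume x: "x \<in> shell a m"
  have "\<bar>x $ i\<bar> \<le> (real (m i) + 1) * pi / a $ i" for i
  proof -
    have "\<bar>x $ i\<bar> * a $ i = \<bar>a $ i * x $ i\<bar>" using a[of i] by (simp add: abs_mult)
    then show ?thesis using x a[of i] by (simp add: shell_def pos_le_divide_eq)
  qed
  then have "(\<Sum>i\<in>UNIV. \<bar>x $ i\<bar>) \<le> (\<Sum>i\<in>UNIV. (real (m i) + 1) * pi / a $ i)"
    by (intro sum_mono)
  then show "norm x \<le> (\<Sum>i\<in>UNIV. (real (m i) + 1) * pi / a $ i)"
    using norm_le_l1_cart[of x] by linarith
qed

lemma shell_uminus: "- x \<in> shell a m \<longleftrightarrow> x \<in> shell a m"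
  by (simp add: shell_def)

lemma emeasure_shell_finite: "(\<And>i. 0 < a $ i) \<Longrightarrow> emeasure lborel (shell a m) < \<infinity>"
  by (rule emeasure_bounded_finite[OF bounded_shell])

subsection \<open>Uniqueness of the Fourier transform\<close>

lemma integrable_bounded_mult:
  fixes H :: "'a \<Rightarrow> complex"
  assumes H: "integrable M H" and [measurable]: "q \<in> borel_measurable M" and B: "\<And>x. norm (q x) \<le> B"
  shows "integrable M (\<lambda>x. q x * H x)"
proof (rule Bochner_Integration.integrable_bound)
  show "integrable M (\<lambda>x. B * norm (H x))"
    using H by (intro integrable_mult_right integrable_norm)
  have [measurable]: "H \<in> borel_measurable M" using H by auto
  show "(\<lambda>x. q x * H x) \<in> borel_measurable M" by measurable
  have "norm (q x * H x) \<le> norm (B * norm (H x))" for x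
    using B[of x] norm_ge_zero[of "q x"] by (auto simp: norm_mult abs_mult intro!: mult_right_mono)
  then show "AE x in M. norm (q x * H x) \<le> norm (B * norm (H x))" by auto
qed

lemma measurable_cnj_comp [measurable (raw)]:
  "f \<in> borel_measurable M \<Longrightarrow> (\<lambda>x. cnj (f x)) \<in> borel_measurable M"
  by (rule measurable_compose[of f M borel cnj])
    (simp_all add: borel_measurable_continuous_onI continuous_on_cnj[OF continuous_on_id])

lemma trig_poly_integral_zero:
  fixes H :: "real^'d::finite \<Rightarrow> complex"
  assumes H: "integrable lborel H" and 0: "\<And>b. (LINT x|lborel. cis (b \<bullet> x) * H x) = 0"
    and q: "trig_poly a q"
  shows "(LINT x|lborel. q x * H x) = 0"
  using q
proof induction
  case (monom c k)
  have "torus_char a k x = cis ((\<chi> i. - (of_int (k $ i) * a $ i)) \<bullet> x)" for x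
    by (simp add: torus_char_def inner_vec_def sum_negf mult.assoc)
  then show ?case using 0 by (simp add: mult.assoc)
next
  case (add p q)
  have "integrable lborel (\<lambda>x. r x * H x)" if "trig_poly a r" for r
    using trig_poly_bounded[OF that] integrable_bounded_mult[OF H] trig_poly_measurable[OF that]
    by (metis measurable_lborel2)
  with add show ?case by (simp add: distrib_right)
qed

text \<open>With band index 0 and \<open>a n\<close> = pi / (n + 1) the shells are cubes of
  half-width n + 1, and \<open>K\<close> lies in one period once they are large. The approximants
  integrate to zero against \<open>H\<close>, are uniformly bounded, and converge to \<phi> on
  growing cubes. The coordinate hyperplanes are kept off \<open>K\<close> because
  \<open>open_shell\<close> omits them.\<close>

lemma compact_support_integral_zero:
  fixes H :: "real^'d::finite \<Rightarrow> complex"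
  assumes H: "integrable lborel H" and 0: "\<And>b. (LINT x|lborel. cis (b \<bullet> x) * H x) = 0"
    and \<phi>: "continuous_on UNIV \<phi>" and K: "compact K" "K \<subseteq> {x. \<forall>i. x $ i \<noteq> 0}"
    and supp: "\<And>x. x \<notin> K \<Longrightarrow> \<phi> x = 0" and B: "\<And>x. norm (\<phi> x) \<le> B"
  shows "(LINT x|lborel. \<phi> x * H x) = 0"
proof -
  have [measurable]: "H \<in> borel_measurable borel" using H by auto
  have [measurable]: "\<phi> \<in> borel_measurable borel" using \<phi> by (rule borel_measurable_continuous_onI)
  have B0: "0 \<le> B" using B[of 0] norm_ge_zero order_trans by blast
  define a :: "nat \<Rightarrow> real^'d" where "a n = (\<chi> i. pi / (real n + 1))" for n
  have a: "0 < a n $ i" for n i by (simp add: a_def)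
  obtain R where R: "\<And>x. x \<in> K \<Longrightarrow> norm x \<le> R"
    using compact_imp_bounded[OF K(1)] by (auto simp: bounded_iff)
  obtain N :: nat where N: "R \<le> real N" using real_arch_simple by blast
  have KN: "K \<subseteq> open_shell (a (n + N)) (\<lambda>_. 0)" for n
  proof
    fix x assume x: "x \<in> K"
    show "x \<in> open_shell (a (n + N)) (\<lambda>_. 0)"
    proof -
      have "0 < \<bar>x $ i\<bar> \<and> \<bar>x $ i\<bar> < real (n + N) + 1" for i
        using component_le_norm_cart[of x i] R[OF x] N K(2) x by auto
      then have "0 < pi * \<bar>x $ i\<bar> / (real (n + N) + 1) \<and> pi * \<bar>x $ i\<bar> / (real (n + N) + 1) < pi" for i
        by (simp add: pos_divide_less_eq)
      then show ?thesis by (simp add: open_shell_def a_def abs_mult)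
    qed
  qed
  have "\<exists>q. trig_poly (a (n + N)) q \<and> (\<forall>\<xi>\<in>shell (a (n + N)) (\<lambda>_. 0). norm (\<phi> \<xi> - q \<xi>) < 1 / (real n + 1)) \<and>
     (\<forall>\<xi>. norm (q \<xi>) \<le> B + 1 / (real n + 1))" for n
  proof -
    have e: "0 < 1 / (real n + 1)" by simp
    show ?thesis
      by (rule trig_poly_approximation[OF a \<phi> K(1) KN[of n] supp B e]) blast+
  qed
  then obtain q where q: "\<And>n. trig_poly (a (n + N)) (q n)"
    and qs: "\<And>n \<xi>. \<xi> \<in> shell (a (n + N)) (\<lambda>_. 0) \<Longrightarrow> norm (\<phi> \<xi> - q n \<xi>) < 1 / (real n + 1)"
    and qB: "\<And>n \<xi>. norm (q n \<xi>) \<le> B + 1 / (real n + 1)"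
    by metis
  note [measurable] = trig_poly_measurable[OF q]
  have qB': "norm (q n \<xi>) \<le> B + 1" for n \<xi>
    using qB[of n \<xi>] by (rule order_trans) simp
  have eq: "(LINT x|lborel. (\<phi> x - q n x) * H x) = (LINT x|lborel. \<phi> x * H x)" for n
  proof -
    have "integrable lborel (\<lambda>x. \<phi> x * H x)" "integrable lborel (\<lambda>x. q n x * H x)"
      using B qB' by (auto intro!: integrable_bounded_mult[OF H])
    then show ?thesis
      using trig_poly_integral_zero[OF H 0 q] by (simp add: left_diff_distrib)
  qed
  have "(\<lambda>n. LINT x|lborel. (\<phi> x - q n x) * H x) \<longlonglongrightarrow> (LINT x|lborel. (0 :: complex) * H x)"
  proof (rule integral_dominated_convergence)
    show "integrable lborel (\<lambda>x. (2 * B + 1) * norm (H x))"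
      by (intro integrable_mult_right integrable_norm H)
    show "AE x in lborel. norm ((\<phi> x - q n x) * H x) \<le> (2 * B + 1) * norm (H x)" for n
    proof (intro AE_I2)
      fix x
      have "norm (\<phi> x - q n x) \<le> 2 * B + 1"
        using norm_triangle_ineq4[of "\<phi> x" "q n x"] B[of x] qB'[of n x] by linarith
      then show "norm ((\<phi> x - q n x) * H x) \<le> (2 * B + 1) * norm (H x)"
        unfolding norm_mult by (intro mult_right_mono) auto
    qed
    show "AE x in lborel. (\<lambda>n. (\<phi> x - q n x) * H x) \<longlonglongrightarrow> 0 * H x"
    proof (intro AE_I2 tendsto_mult tendsto_const)
      fix x :: "real^'d"
      obtain M :: nat where M: "norm x \<le> real M" using real_arch_simple by blast
      have "norm (\<phi> x - q n x) \<le> 1 / (real n + 1)" if "M \<le> n" for n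
      proof -
        have "\<bar>x $ i\<bar> \<le> real (n + N) + 1" for i
          using component_le_norm_cart[of x i] M that by simp
        then have "pi * \<bar>x $ i\<bar> / (real (n + N) + 1) \<le> pi" for i
          by (simp add: pos_divide_le_eq)
        then have "x \<in> shell (a (n + N)) (\<lambda>_. 0)"
          by (simp add: shell_def a_def abs_mult)
        from qs[OF this] show ?thesis by simp
      qed
      moreover have "(\<lambda>n. 1 / (real n + 1)) \<longlonglongrightarrow> 0"
        using LIMSEQ_inverse_real_of_nat by (simp add: inverse_eq_divide add.commute)
      ultimately show "(\<lambda>n. \<phi> x - q n x) \<longlonglongrightarrow> 0"
        by (intro Lim_null_comparison[of "\<lambda>n. \<phi> x - q n x" "\<lambda>n. 1 / (real n + 1)"])
          (auto simp: eventually_sequentially)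
    qed
  qed measurable
  then have "(\<lambda>n::nat. LINT x|lborel. \<phi> x * H x) \<longlonglongrightarrow> 0"
    unfolding eq by simp
  then show ?thesis by (simp add: LIMSEQ_const_iff)
qed

text \<open>Testing with the conjugate sign of \<open>H\<close> turns the integral into the L1 norm;
  that sign is reached by continuous functions supported off the coordinate hyperplanes.\<close>

lemma AE_zero_if_fourier_zero:
  fixes H :: "real^'d::finite \<Rightarrow> complex"
  assumes H: "integrable lborel H" and 0: "\<And>b. (LINT x|lborel. cis (b \<bullet> x) * H x) = 0"
  shows "AE x in lborel. H x = 0"
proof -
  have [measurable]: "H \<in> borel_measurable borel" using H by auto
  define S where "S = {x::real^'d. \<forall>i. x $ i \<noteq> 0}"
  have "S = (\<Inter>i\<in>UNIV. {x. x $ i \<noteq> 0})" by (auto simp: S_def)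
  then have S: "open S"
    by (simp only:) (intro open_INT ballI open_Collect_neq continuous_intros finite)
  have S': "S \<noteq> UNIV"
  proof -
    have "0 \<notin> S" by (simp add: S_def)
    then show ?thesis by blast
  qed
  have aeS: "AE x in lborel. x \<in> S"
  proof -
    have "AE x::real^'d in lborel. \<forall>i\<in>UNIV. x $ i \<noteq> 0"
      by (intro AE_finite_allI AE_coord_neq) auto
    then show ?thesis by (simp add: S_def)
  qed
  define b where "b x = cnj (sgn (H x))" for x
  have [measurable]: "b \<in> borel_measurable borel"
    unfolding b_def by measurable
  have b1: "norm (b x) \<le> 1" for x by (simp add: b_def norm_sgn)
  obtain \<phi> K where \<phi>: "\<And>n::nat. continuous_on UNIV (\<phi> n)" "\<And>n. compact (K n)" "\<And>n. K n \<subseteq> S"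
    "\<And>n x. x \<notin> K n \<Longrightarrow> \<phi> n x = 0" "\<And>n x. norm (\<phi> n x) \<le> 1"
    "AE x in lborel. x \<in> S \<longrightarrow> (\<lambda>n. \<phi> n x) \<longlonglongrightarrow> b x"
    by (rule compact_support_approximation[OF \<open>b \<in> borel_measurable borel\<close> b1 S S']) (rule that; assumption)
  have [measurable]: "\<phi> n \<in> borel_measurable borel" for n
    using \<phi>(1) by (rule borel_measurable_continuous_onI)
  have z: "(LINT x|lborel. \<phi> n x * H x) = 0" for n
    by (rule compact_support_integral_zero[OF H 0 \<phi>(1) \<phi>(2) \<phi>(3)[unfolded S_def] \<phi>(4) \<phi>(5)])
  have "(\<lambda>n. LINT x|lborel. \<phi> n x * H x) \<longlonglongrightarrow> (LINT x|lborel. b x * H x)"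
  proof (rule integral_dominated_convergence)
    show "integrable lborel (\<lambda>x. norm (H x))" using H by (rule integrable_norm)
    show "AE x in lborel. norm (\<phi> n x * H x) \<le> norm (H x)" for n
      using \<phi>(5) by (intro AE_I2) (simp add: norm_mult mult_left_le_one_le)
    show "AE x in lborel. (\<lambda>n. \<phi> n x * H x) \<longlonglongrightarrow> b x * H x"
      using aeS \<phi>(6) by eventually_elim (auto intro!: tendsto_intros)
  qed measurable
  then have "(LINT x|lborel. b x * H x) = 0"
    unfolding z by (simp add: LIMSEQ_const_iff)
  moreover have "b x * H x = of_real (norm (H x))" for x
    by (cases "H x = 0") (simp_all add: b_def sgn_div_norm scaleR_conv_of_real complex_norm_square[symmetric] field_simps power2_eq_square)
  ultimately have "(LINT x|lborel. norm (H x)) = 0" by simp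
  then have "AE x in lborel. norm (H x) = 0"
    by (subst (asm) integral_nonneg_eq_0_iff_AE) (auto intro: integrable_norm H)
  then show ?thesis by simp
qed

text \<open>Tested on modulated Gaussians, equality of the pairings says that the integrable
  function (g - h) times a Gaussian has vanishing Fourier transform, and the Gaussian has no
  zeros.\<close>

lemma schwartz_separates:
  fixes g h :: "real^'d::finite \<Rightarrow> complex"
  assumes [measurable]: "g \<in> borel_measurable borel" "h \<in> borel_measurable borel"
    and g: "\<And>f. schwartz f \<Longrightarrow> integrable lborel (\<lambda>x. g x * f x)"
    and h: "\<And>f. schwartz f \<Longrightarrow> integrable lborel (\<lambda>x. h x * f x)"
    and eq: "\<And>f. schwartz f \<Longrightarrow> (LINT x|lborel. g x * f x) = (LINT x|lborel. h x * f x)"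
  shows "AE x in lborel. g x = h x"
proof -
  have "AE x in lborel. (g x - h x) * gauss 0 x = 0"
  proof (rule AE_zero_if_fourier_zero)
    show "integrable lborel (\<lambda>x. (g x - h x) * gauss 0 x)"
      using g[OF schwartz_gauss] h[OF schwartz_gauss] by (simp add: left_diff_distrib)
    fix b :: "real^'d"
    have "cis (b \<bullet> x) * ((g x - h x) * gauss 0 x) = g x * gauss b x - h x * gauss b x" for x
      by (simp add: gauss_eq algebra_simps)
    then show "(LINT x|lborel. cis (b \<bullet> x) * ((g x - h x) * gauss 0 x)) = 0"
      using g[OF schwartz_gauss[of b]] h[OF schwartz_gauss[of b]] eq[OF schwartz_gauss[of b]] by simp
  qed
  then show ?thesis by (rule AE_mp) (auto simp: gauss_eq)
qed

lemma has_fourier_AE_unique: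
  assumes "has_fourier T g" "has_fourier T h"
  shows "AE \<xi> in lborel. g \<xi> = h \<xi>"
  using assms unfolding has_fourier_def by (intro schwartz_separates) auto

lemma tempered_functional_apply_dist: "tempered_functional (apply_dist T)"
  using apply_dist by auto

text \<open>Agreement is known on transforms of Schwartz functions; by inversion these are all
  Schwartz functions. Elsewhere both functionals are 0 by convention.\<close>

lemma has_fourier_inject:
  assumes T: "has_fourier T g" and S: "has_fourier S h" and ae: "AE \<xi> in lborel. g \<xi> = h \<xi>"
  shows "T = S"
proof -
  have [measurable]: "g \<in> borel_measurable borel" "h \<in> borel_measurable borel"
    using T S by (auto simp: has_fourier_def)
  have "apply_dist T \<phi> = apply_dist S \<phi>" for \<phi>
  proof (cases "schwartz \<phi>")
    case True
    note f = schwartz_ifourier[OF True]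
    note [measurable] = schwartz_measurable[OF f]
    have "(LINT \<xi>|lborel. g \<xi> * ifourier \<phi> \<xi>) = (LINT \<xi>|lborel. h \<xi> * ifourier \<phi> \<xi>)"
      by (rule integral_cong_AE) (use ae in auto)
    then show ?thesis
      using T S f unfolding has_fourier_def by (metis fourier_ifourier[OF True])
  next
    case False
    then show ?thesis
      using tempered_functional_apply_dist unfolding tempered_functional_def by metis
  qed
  then show ?thesis by (simp add: apply_dist_inject[symmetric] fun_eq_iff)
qed

section \<open>Sobolev spaces as weighted spaces of functions\<close>

text \<open>\<open>wgt s\<close> multiplies the function before squaring, hence the half exponent.
  The ratio of the weights of orders \<open>t / 2\<close> and \<open>- t / 2\<close> is
  \<open>wgt t\<close>, the scale in which the symbol is measured.\<close>

abbreviation wgt :: "real \<Rightarrow> real^'d::finite \<Rightarrow> real" where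
  "wgt s \<xi> \<equiv> (1 + (norm \<xi>)\<^sup>2) powr (s / 2)"

lemma wgt_pos: "0 < wgt s \<xi>"
  by (rule powr_gt_zero[THEN iffD2]) (smt (verit) zero_le_power2)

lemma wgt_minus: "wgt (- s) \<xi> = 1 / wgt s \<xi>"
  by (simp add: powr_minus_divide)

lemma inverse_wgt_le: "1 / wgt s \<xi> \<le> (1 + norm \<xi>) ^ nat \<lceil>\<bar>s\<bar>\<rceil>"
proof -
  let ?r = "norm \<xi>"
  have "1 / wgt s \<xi> = (1 + ?r\<^sup>2) powr (- s / 2)" by (simp add: powr_minus_divide)
  also have "\<dots> \<le> (1 + ?r\<^sup>2) powr (\<bar>s\<bar> / 2)" by (intro powr_mono) auto
  also have "\<dots> \<le> ((1 + ?r)\<^sup>2) powr (\<bar>s\<bar> / 2)"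
    by (intro powr_mono2) (auto simp: power2_sum)
  also have "\<dots> = (1 + ?r) powr (2 * (\<bar>s\<bar> / 2))"
    by (subst powr_powr[symmetric]) (simp add: powr_realpow add_pos_nonneg flip: powr_numeral)
  also have "\<dots> \<le> (1 + ?r) powr (real (nat \<lceil>\<bar>s\<bar>\<rceil>))" by (intro powr_mono) auto
  also have "\<dots> = (1 + ?r) ^ nat \<lceil>\<bar>s\<bar>\<rceil>" by (intro powr_realpow) (simp add: add_pos_nonneg)
  finally show ?thesis .
qed

lemma mult_le_add_squares: "0 \<le> a \<Longrightarrow> 0 \<le> b \<Longrightarrow> a * b \<le> a\<^sup>2 + (b::real)\<^sup>2"
  using sum_squares_bound[of a b] mult_nonneg_nonneg[of a b] by linarith

definition sobolev_fun :: "real \<Rightarrow> (real^'d::finite \<Rightarrow> complex) \<Rightarrow> bool" where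
  "sobolev_fun s g \<longleftrightarrow> g \<in> borel_measurable borel \<and>
     integrable lborel (\<lambda>\<xi>. (wgt s \<xi> * cmod (g \<xi>))\<^sup>2) \<and> (AE \<xi> in lborel. g (- \<xi>) = cnj (g \<xi>))"

text \<open>The inequality ab \<le> a^2 + b^2 pairs the weighted square integrable function with the
  square integrable (1 + |\<xi>|)^(-d), after \<open>inverse_wgt_le\<close> has traded the weight
  for a polynomial. The exponent is the decay that a test function has to supply.\<close>

lemma sobolev_fun_decay_integrable:
  fixes g :: "real^'d::finite \<Rightarrow> complex"
  assumes [measurable]: "g \<in> borel_measurable borel"
    and g: "integrable lborel (\<lambda>\<xi>. (wgt s \<xi> * cmod (g \<xi>))\<^sup>2)"
  shows "integrable lborel (\<lambda>\<xi>. norm (g \<xi>) / (1 + norm \<xi>) ^ (nat \<lceil>\<bar>s\<bar>\<rceil> + CARD('d)))"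
proof (rule Bochner_Integration.integrable_bound)
  show "integrable lborel (\<lambda>\<xi>::real^'d. (wgt s \<xi> * cmod (g \<xi>))\<^sup>2 + 1 / (1 + norm \<xi>) ^ (2 * CARD('d)))"
    using g integrable_inverse_polynomial by (rule Bochner_Integration.integrable_add)
  show "AE \<xi> in lborel. norm (norm (g \<xi>) / (1 + norm \<xi>) ^ (nat \<lceil>\<bar>s\<bar>\<rceil> + CARD('d)))
      \<le> norm ((wgt s \<xi> * cmod (g \<xi>))\<^sup>2 + 1 / (1 + norm \<xi>) ^ (2 * CARD('d)))"
  proof (intro AE_I2)
    fix \<xi> :: "real^'d"
    let ?N = "(1 + norm \<xi>) ^ nat \<lceil>\<bar>s\<bar>\<rceil>" and ?D = "(1 + norm \<xi>) ^ CARD('d)"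
    have pos: "0 < ?N" "0 < ?D" by (simp_all add: add_pos_nonneg)
    have "1 \<le> ?N * wgt s \<xi>"
      using inverse_wgt_le[of \<xi> s] wgt_pos[of \<xi> s] by (simp add: pos_divide_le_eq)
    then have "norm (g \<xi>) / (?N * ?D) \<le> (?N * wgt s \<xi>) * norm (g \<xi>) / (?N * ?D)"
      using pos by (intro divide_right_mono mult_le_cancel_right1[THEN iffD2]) auto
    also have "\<dots> = (wgt s \<xi> * norm (g \<xi>)) * (1 / ?D)" using pos by simp
    also have "\<dots> \<le> (wgt s \<xi> * norm (g \<xi>))\<^sup>2 + (1 / ?D)\<^sup>2"
      using pos wgt_pos[of \<xi> s] by (intro mult_le_add_squares mult_nonneg_nonneg) auto
    also have "(1 / ?D)\<^sup>2 = 1 / (1 + norm \<xi>) ^ (2 * CARD('d))"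
      by (simp add: power_divide power_mult[symmetric] mult.commute)
    finally show "norm (norm (g \<xi>) / (1 + norm \<xi>) ^ (nat \<lceil>\<bar>s\<bar>\<rceil> + CARD('d)))
      \<le> norm ((wgt s \<xi> * cmod (g \<xi>))\<^sup>2 + 1 / (1 + norm \<xi>) ^ (2 * CARD('d)))"
      by (simp add: power_add abs_mult)
  qed
qed measurable

lemma sobolev_fun_mult_bound:
  fixes g h :: "real^'d::finite \<Rightarrow> complex"
  assumes [measurable]: "g \<in> borel_measurable borel" "h \<in> borel_measurable borel"
    and g: "integrable lborel (\<lambda>\<xi>. (wgt s \<xi> * cmod (g \<xi>))\<^sup>2)"
    and C: "\<And>\<xi>. (1 + norm \<xi>) ^ (nat \<lceil>\<bar>s\<bar>\<rceil> + CARD('d)) * norm (h \<xi>) \<le> C"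
  shows "integrable lborel (\<lambda>\<xi>. g \<xi> * h \<xi>)"
    "norm (LINT \<xi>|lborel. g \<xi> * h \<xi>) \<le> C * (LINT \<xi>|lborel. norm (g \<xi>) / (1 + norm \<xi>) ^ (nat \<lceil>\<bar>s\<bar>\<rceil> + CARD('d)))"
proof -
  let ?P = "\<lambda>\<xi>::real^'d. (1 + norm \<xi>) ^ (nat \<lceil>\<bar>s\<bar>\<rceil> + CARD('d))"
  note i = integrable_mult_right[OF sobolev_fun_decay_integrable[OF assms(1) g], of C]
  have le: "norm (g \<xi> * h \<xi>) \<le> C * (norm (g \<xi>) / ?P \<xi>)" for \<xi>
  proof -
    have "0 < ?P \<xi>" by (simp add: add_pos_nonneg)
    then have "norm (h \<xi>) \<le> C / ?P \<xi>" using C[of \<xi>] by (simp add: pos_le_divide_eq mult.commute)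
    then have "norm (g \<xi>) * norm (h \<xi>) \<le> norm (g \<xi>) * (C / ?P \<xi>)" by (intro mult_left_mono) auto
    then show ?thesis by (simp add: norm_mult mult.commute)
  qed
  show int: "integrable lborel (\<lambda>\<xi>. g \<xi> * h \<xi>)"
    by (rule Bochner_Integration.integrable_bound[OF i]) (auto intro!: AE_I2 order_trans[OF le] simp del: times_divide_eq_right)
  have "norm (LINT \<xi>|lborel. g \<xi> * h \<xi>) \<le> (LINT \<xi>|lborel. norm (g \<xi> * h \<xi>))"
    by (rule integral_norm_bound)
  also have "\<dots> \<le> (LINT \<xi>|lborel. C * (norm (g \<xi>) / ?P \<xi>))"
    by (rule integral_mono[OF integrable_norm[OF int] i]) (rule le)
  finally show "norm (LINT \<xi>|lborel. g \<xi> * h \<xi>) \<le> C * (LINT \<xi>|lborel. norm (g \<xi>) / ?P \<xi>)"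
    by (simp only: integral_mult_right_zero)
qed

lemma fourier_add:
  assumes "schwartz f" "schwartz g"
  shows "fourier (\<lambda>x. a * f x + b * g x) \<xi> = a * fourier f \<xi> + b * fourier g \<xi>"
proof -
  have "integrable lborel (\<lambda>x. cis (- (\<xi> \<bullet> x)) * f x)" "integrable lborel (\<lambda>x. cis (- (\<xi> \<bullet> x)) * g x)"
    using assms by (intro integrable_cis_mult schwartz_integrable; measurable)+
  then show ?thesis
    unfolding fourier_def by (simp add: distrib_left mult.left_commute)
qed

lemma ifourier_add:
  assumes "schwartz f" "schwartz g"
  shows "ifourier (\<lambda>x. a * f x + b * g x) \<xi> = a * ifourier f \<xi> + b * ifourier g \<xi>"
  unfolding ifourier_def fourier_add[OF assms] by (simp add: algebra_simps)

lemma cnj_fourier: "cnj (fourier f \<xi>) = fourier (\<lambda>x. cnj (f (- x))) \<xi>" if "schwartz f"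
proof -
  note [measurable] = schwartz_measurable[OF that]
  have "cnj (fourier f \<xi>) = (LINT x|lborel. cnj (cis (- (\<xi> \<bullet> x)) * f x))"
    unfolding fourier_def by (rule Bochner_Integration.integral_cnj[symmetric])
  also have "\<dots> = (LINT x|lborel. cis (- (\<xi> \<bullet> (- x))) * cnj (f (- (- x))))"
    by (simp add: cis_cnj)
  also have "\<dots> = fourier (\<lambda>x. cnj (f (- x))) \<xi>"
    unfolding fourier_def by (rule lborel_integral_reflect[where f = "\<lambda>x. cis (- (\<xi> \<bullet> x)) * cnj (f (- x))"]) measurable
  finally show ?thesis .
qed

lemma has_fourier_integrable: "has_fourier T g \<Longrightarrow> schwartz f \<Longrightarrow> integrable lborel (\<lambda>\<xi>. g \<xi> * f \<xi>)"
  and has_fourier_apply: "has_fourier T g \<Longrightarrow> schwartz f \<Longrightarrow> apply_dist T (fourier f) = (LINT \<xi>|lborel. g \<xi> * f \<xi>)"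
  and has_fourier_measurable: "has_fourier T g \<Longrightarrow> g \<in> borel_measurable borel"
  by (auto simp: has_fourier_def)

text \<open>Conjugating \<open>fourier f\<close> amounts to conjugating and reflecting
  \<open>f\<close>. Hence reality of \<open>T\<close> and Hermitian symmetry of \<open>g\<close> are
  one identity, tested on all Schwartz functions.\<close>

lemma real_valued_iff:
  assumes T: "has_fourier T g"
  shows "real_valued T \<longleftrightarrow> (AE \<xi> in lborel. g (- \<xi>) = cnj (g \<xi>))"
proof -
  note [measurable] = has_fourier_measurable[OF T]
  have left: "apply_dist T (\<lambda>x. cnj (fourier f x)) = (LINT \<xi>|lborel. g (- \<xi>) * cnj (f \<xi>))" if f: "schwartz f" for f
  proof -
    note [measurable] = schwartz_measurable[OF f]
    have "apply_dist T (\<lambda>x. cnj (fourier f x)) = (LINT \<xi>|lborel. g (- (- \<xi>)) * cnj (f (- \<xi>)))"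
      unfolding cnj_fourier[OF f] using has_fourier_apply[OF T schwartz_cnj[OF schwartz_reflect[OF f]]] by simp
    also have "\<dots> = (LINT \<xi>|lborel. g (- \<xi>) * cnj (f \<xi>))"
      by (rule lborel_integral_reflect[where f = "\<lambda>\<xi>. g (- \<xi>) * cnj (f \<xi>)"]) measurable
    finally show ?thesis .
  qed
  have right: "cnj (apply_dist T (fourier f)) = (LINT \<xi>|lborel. cnj (g \<xi>) * cnj (f \<xi>))" if f: "schwartz f" for f
    unfolding has_fourier_apply[OF T f] Bochner_Integration.integral_cnj[symmetric] by simp
  show ?thesis
  proof
    assume rv: "real_valued T"
    show "AE \<xi> in lborel. g (- \<xi>) = cnj (g \<xi>)"
    proof (rule schwartz_separates)
      fix f :: "real^'a \<Rightarrow> complex" assume f: "schwartz f"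
      note [measurable] = schwartz_measurable[OF f]
      show "integrable lborel (\<lambda>\<xi>. g (- \<xi>) * f \<xi>)"
        using lborel_integrable_reflect[OF _ has_fourier_integrable[OF T schwartz_reflect[OF f]]] by simp
      show "integrable lborel (\<lambda>\<xi>. cnj (g \<xi>) * f \<xi>)"
        using integrable_cnj[OF has_fourier_integrable[OF T schwartz_cnj[OF f]]] by simp
      have "apply_dist T (\<lambda>x. cnj (fourier (\<lambda>x. cnj (f x)) x)) = cnj (apply_dist T (fourier (\<lambda>x. cnj (f x))))"
        using rv schwartz_fourier[OF schwartz_cnj[OF f]] by (simp add: real_valued_def)
      then show "(LINT \<xi>|lborel. g (- \<xi>) * f \<xi>) = (LINT \<xi>|lborel. cnj (g \<xi>) * f \<xi>)"
        using left[OF schwartz_cnj[OF f]] right[OF schwartz_cnj[OF f]] by simp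
    qed measurable
  next
    assume ae: "AE \<xi> in lborel. g (- \<xi>) = cnj (g \<xi>)"
    show "real_valued T"
      unfolding real_valued_def
    proof (intro allI impI)
      fix \<phi> :: "real^'a \<Rightarrow> complex" assume \<phi>: "schwartz \<phi>"
      note f = schwartz_ifourier[OF \<phi>]
      note [measurable] = schwartz_measurable[OF f]
      have "(LINT \<xi>|lborel. g (- \<xi>) * cnj (ifourier \<phi> \<xi>)) = (LINT \<xi>|lborel. cnj (g \<xi>) * cnj (ifourier \<phi> \<xi>))"
        by (rule integral_cong_AE) (use ae in auto)
      with left[OF f] right[OF f] show "apply_dist T (\<lambda>x. cnj (\<phi> x)) = cnj (apply_dist T \<phi>)"
        by (simp add: fourier_ifourier[OF \<phi>])
    qed
  qed
qed

text \<open>Inversion forces the functional: pair \<open>g\<close> with \<open>ifourier\<close> of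
  the test function. Its continuity is the uniform estimate
  \<open>fourier_seminorm_bound\<close>.\<close>

lemma sobolev_fun_has_fourier:
  fixes g :: "real^'d::finite \<Rightarrow> complex"
  assumes g: "sobolev_fun s g"
  shows "\<exists>T. has_fourier T g"
proof -
  have [measurable]: "g \<in> borel_measurable borel"
    and int: "integrable lborel (\<lambda>\<xi>. (wgt s \<xi> * cmod (g \<xi>))\<^sup>2)"
    using g by (auto simp: sobolev_fun_def)
  define M where "M = nat \<lceil>\<bar>s\<bar>\<rceil> + CARD('d)"
  define G where "G = (LINT \<xi>|lborel. norm (g \<xi>) / (1 + norm \<xi>) ^ M)"
  have G0: "0 \<le> G"
    unfolding G_def by (rule Bochner_Integration.integral_nonneg) (simp add: add_nonneg_nonneg)
  define T where "T \<phi> = (if schwartz \<phi> then LINT \<xi>|lborel. g \<xi> * ifourier \<phi> \<xi> else 0)" for \<phi>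
  have gi: "integrable lborel (\<lambda>\<xi>. g \<xi> * f \<xi>)" if f: "schwartz f" for f
  proof -
    obtain C where C: "\<And>x. (1 + norm x) ^ M * norm (f x) \<le> C"
      using schwartz_decay[OF f, of M] by metis
    show ?thesis
      by (rule sobolev_fun_mult_bound(1)[OF _ _ int C[unfolded M_def]]) (use schwartz_measurable[OF f] in auto)
  qed
  have "tempered_functional T"
    unfolding tempered_functional_def
  proof (intro conjI allI impI)
    fix f h :: "real^'d \<Rightarrow> complex" and a b assume f: "schwartz f" and h: "schwartz h"
    show "T (\<lambda>x. a * f x + b * h x) = a * T f + b * T h"
      using f h schwartz_lincomb[OF f h, of a b] gi[OF schwartz_ifourier[OF f]] gi[OF schwartz_ifourier[OF h]]
      unfolding T_def ifourier_add[OF f h] by (simp add: distrib_left mult.left_commute)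
  next
    obtain C N where CN: "\<And>f \<xi>. schwartz (f :: real^'d \<Rightarrow> complex) \<Longrightarrow>
        (1 + norm \<xi>) ^ M * norm (fourier f \<xi>) \<le> C * schwartz_seminorm N f"
      using fourier_seminorm_bound[of M, where 'd = 'd] by blast
    let ?c = "norm (1 / (gauss_const TYPE('d))\<^sup>2)"
    have "norm (T f) \<le> (?c * C * G) * schwartz_seminorm N f" if f: "schwartz f" for f
    proof -
      have "(1 + norm \<xi>) ^ M * norm (ifourier f \<xi>) \<le> ?c * (C * schwartz_seminorm N f)" for \<xi>
      proof -
        have "(1 + norm \<xi>) ^ M * norm (ifourier f \<xi>) = ?c * ((1 + norm (- \<xi>)) ^ M * norm (fourier f (- \<xi>)))"
          by (simp add: ifourier_def norm_mult norm_divide)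
        also have "\<dots> \<le> ?c * (C * schwartz_seminorm N f)"
          by (intro mult_left_mono CN f) auto
        finally show ?thesis .
      qed
      then have "norm (LINT \<xi>|lborel. g \<xi> * ifourier f \<xi>) \<le> ?c * (C * schwartz_seminorm N f) * G"
        unfolding G_def M_def by (intro sobolev_fun_mult_bound(2) int)
          (use schwartz_measurable[OF schwartz_ifourier[OF f]] in auto)
      then show ?thesis using f by (simp add: T_def mult_ac)
    qed
    then show "\<exists>N C. \<forall>f. schwartz f \<longrightarrow> norm (T f) \<le> C * schwartz_seminorm N f"
      by (intro exI[of _ N] exI[of _ "?c * C * G"]) blast
  qed (simp add: T_def)
  then have ap: "apply_dist (Tempered T) = T"
    by (simp add: Tempered_inverse)
  have "has_fourier (Tempered T) g"
    unfolding has_fourier_def ap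
    by (auto intro: gi simp: T_def schwartz_fourier ifourier_fourier)
  then show ?thesis by blast
qed

lemma sobolev_iff: "T \<in> sobolev s \<longleftrightarrow> (\<exists>g. has_fourier T g \<and> sobolev_fun s g)"
  unfolding sobolev_def sobolev_fun_def using real_valued_iff has_fourier_measurable by blast

lemma has_fourier_ft: "has_fourier T g \<Longrightarrow> has_fourier T (ft T)"
  unfolding ft_def by (rule someI[of "has_fourier T" g])

lemma ft_AE: "has_fourier T g \<Longrightarrow> AE \<xi> in lborel. ft T \<xi> = g \<xi>"
  using has_fourier_ft has_fourier_AE_unique by blast

lemma sobolev_fun_cong_AE:
  assumes g: "sobolev_fun s g" and ae: "AE \<xi> in lborel. g \<xi> = h \<xi>" and [measurable]: "h \<in> borel_measurable borel"
  shows "sobolev_fun s h"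
proof -
  have [measurable]: "g \<in> borel_measurable borel" using g by (simp add: sobolev_fun_def)
  have "integrable lborel (\<lambda>\<xi>. (wgt s \<xi> * cmod (h \<xi>))\<^sup>2)"
    by (rule integrable_cong_AE_imp[of _ "\<lambda>\<xi>. (wgt s \<xi> * cmod (g \<xi>))\<^sup>2"]) (use g ae in \<open>auto simp: sobolev_fun_def\<close>)
  moreover have "AE \<xi> in lborel. h (- \<xi>) = cnj (h \<xi>)"
  proof -
    have "AE \<xi> in lborel. g (- \<xi>) = cnj (g \<xi>)" using g by (simp add: sobolev_fun_def)
    with ae AE_lborel_reflect[OF ae] show ?thesis by eventually_elim simp
  qed
  ultimately show ?thesis by (simp add: sobolev_fun_def)
qed

lemma sobolev_ft:
  assumes "T \<in> sobolev s"
  shows "has_fourier T (ft T)" "sobolev_fun s (ft T)"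
proof -
  obtain g where g: "has_fourier T g" "sobolev_fun s g" using assms by (auto simp: sobolev_iff)
  show f: "has_fourier T (ft T)" using g(1) by (rule has_fourier_ft)
  show "sobolev_fun s (ft T)"
    using sobolev_fun_cong_AE[OF g(2) has_fourier_AE_unique[OF g(1) f] has_fourier_measurable[OF f]] .
qed

lemma sobolev_norm_eq:
  assumes T: "has_fourier T g"
  shows "sobolev_norm s T = sqrt (LINT \<xi>|lborel. (wgt s \<xi> * cmod (g \<xi>))\<^sup>2)"
proof -
  note [measurable] = has_fourier_measurable[OF T] has_fourier_measurable[OF has_fourier_ft[OF T]]
  have "(LINT \<xi>|lborel. (wgt s \<xi> * cmod (ft T \<xi>))\<^sup>2) = (LINT \<xi>|lborel. (wgt s \<xi> * cmod (g \<xi>))\<^sup>2)"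
    by (rule integral_cong_AE) (use ft_AE[OF T] in auto)
  then show ?thesis by (simp add: sobolev_norm_def)
qed

lemma has_fourier_zero: "has_fourier 0 (\<lambda>\<xi>. 0)"
  by (simp add: has_fourier_def zero_tempered.rep_eq)

lemma has_fourier_add: "has_fourier S g \<Longrightarrow> has_fourier T h \<Longrightarrow> has_fourier (S + T) (\<lambda>\<xi>. g \<xi> + h \<xi>)"
  by (auto simp: has_fourier_def plus_tempered.rep_eq distrib_right)

lemma has_fourier_diff: "has_fourier S g \<Longrightarrow> has_fourier T h \<Longrightarrow> has_fourier (S - T) (\<lambda>\<xi>. g \<xi> - h \<xi>)"
  by (auto simp: has_fourier_def minus_tempered.rep_eq left_diff_distrib)

lemma has_fourier_scaleR: "has_fourier T g \<Longrightarrow> has_fourier (c *\<^sub>R T) (\<lambda>\<xi>. of_real c * g \<xi>)"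
  by (auto simp: has_fourier_def scaleR_tempered.rep_eq scaleR_conv_of_real mult.assoc)

lemma has_fourier_sum:
  "finite F \<Longrightarrow> (\<And>k. k \<in> F \<Longrightarrow> has_fourier (T k) (g k)) \<Longrightarrow> has_fourier (\<Sum>k\<in>F. T k) (\<lambda>\<xi>. \<Sum>k\<in>F. g k \<xi>)"
  by (induction F rule: finite_induct) (auto intro: has_fourier_zero has_fourier_add)

subsection \<open>Vector-valued functions\<close>

definition has_fourier_vec :: "'d::finite tempered ^ 'n::finite \<Rightarrow> (real^'d \<Rightarrow> complex^'n) \<Rightarrow> bool" where
  "has_fourier_vec u g \<longleftrightarrow> (\<forall>i. has_fourier (u $ i) (\<lambda>\<xi>. g \<xi> $ i))"

definition ft_vec :: "'d::finite tempered ^ 'n::finite \<Rightarrow> real^'d \<Rightarrow> complex^'n" where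
  "ft_vec u \<xi> = (\<chi> i. ft (u $ i) \<xi>)"

definition sobolev_vfun :: "real \<Rightarrow> (real^'d::finite \<Rightarrow> complex^'n::finite) \<Rightarrow> bool" where
  "sobolev_vfun s g \<longleftrightarrow> (\<forall>i. sobolev_fun s (\<lambda>\<xi>. g \<xi> $ i))"

text \<open>The squared norm on the Fourier side; without the root, limits follow directly from
  convergence theorems for integrals.\<close>

definition sobolev_mass :: "real \<Rightarrow> (real^'d::finite \<Rightarrow> complex^'n::finite) \<Rightarrow> real" where
  "sobolev_mass s g = (LINT \<xi>|lborel. (wgt s \<xi> * norm (g \<xi>))\<^sup>2)"

lemma norm_vec_power2: "(norm (x :: 'a::real_normed_vector^'n::finite))\<^sup>2 = (\<Sum>i\<in>UNIV. (norm (x $ i))\<^sup>2)"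
  by (simp add: norm_vec_def L2_set_def sum_nonneg)

lemma measurable_vec_components:
  fixes g :: "'a \<Rightarrow> complex^'n::finite"
  shows "(\<And>i. (\<lambda>x. g x $ i) \<in> borel_measurable M) \<Longrightarrow> g \<in> borel_measurable M"
proof -
  assume *[measurable]: "\<And>i. (\<lambda>x. g x $ i) \<in> borel_measurable M"
  have "(\<lambda>x. g x \<bullet> b) \<in> borel_measurable M" if "b \<in> Basis" for b :: "complex^'n"
    unfolding inner_vec_def by measurable
  then show ?thesis by (simp add: borel_measurable_euclidean_space[where 'c = "complex^'n"])
qed

lemma measurable_vec_nth [measurable (raw)]:
  fixes g :: "'a \<Rightarrow> complex^'n::finite"
  shows "g \<in> borel_measurable M \<Longrightarrow> (\<lambda>x. g x $ i) \<in> borel_measurable M"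
  by (rule measurable_compose[of g M borel "\<lambda>x. x $ i"])
    (auto intro!: borel_measurable_continuous_onI continuous_intros)

lemma sobolev_vfun_measurable: "sobolev_vfun s g \<Longrightarrow> g \<in> borel_measurable borel"
  by (rule measurable_vec_components) (auto simp: sobolev_vfun_def sobolev_fun_def)

lemma wgt_norm_vec: "(wgt s \<xi> * norm (x :: complex^'n::finite))\<^sup>2 = (\<Sum>i\<in>UNIV. (wgt s \<xi> * norm (x $ i))\<^sup>2)"
  by (simp add: power_mult_distrib norm_vec_power2 sum_distrib_left)

text \<open>Replaces conditions on components by one on the Euclidean norm, to which matrix
  estimates apply.\<close>

lemma sobolev_vfun_iff:
  fixes g :: "real^'d::finite \<Rightarrow> complex^'n::finite"
  shows "sobolev_vfun s g \<longleftrightarrow> g \<in> borel_measurable borel \<and> integrable lborel (\<lambda>\<xi>. (wgt s \<xi> * norm (g \<xi>))\<^sup>2) \<and>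
     (AE \<xi> in lborel. \<forall>i. g (- \<xi>) $ i = cnj (g \<xi> $ i))"
proof
  assume g: "sobolev_vfun s g"
  have "integrable lborel (\<lambda>\<xi>. (wgt s \<xi> * norm (g \<xi>))\<^sup>2)"
    unfolding wgt_norm_vec using g by (intro Bochner_Integration.integrable_sum) (auto simp: sobolev_vfun_def sobolev_fun_def)
  moreover have "AE \<xi> in lborel. \<forall>i\<in>UNIV. g (- \<xi>) $ i = cnj (g \<xi> $ i)"
    using g by (intro AE_finite_allI) (auto simp: sobolev_vfun_def sobolev_fun_def)
  ultimately show "g \<in> borel_measurable borel \<and> integrable lborel (\<lambda>\<xi>. (wgt s \<xi> * norm (g \<xi>))\<^sup>2) \<and>
     (AE \<xi> in lborel. \<forall>i. g (- \<xi>) $ i = cnj (g \<xi> $ i))"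
    using sobolev_vfun_measurable[OF g] by simp
next
  assume *: "g \<in> borel_measurable borel \<and> integrable lborel (\<lambda>\<xi>. (wgt s \<xi> * norm (g \<xi>))\<^sup>2) \<and>
     (AE \<xi> in lborel. \<forall>i. g (- \<xi>) $ i = cnj (g \<xi> $ i))"
  then have [measurable]: "g \<in> borel_measurable borel" by blast
  show "sobolev_vfun s g"
    unfolding sobolev_vfun_def sobolev_fun_def
  proof (intro allI conjI)
    fix i
    show "(\<lambda>\<xi>. g \<xi> $ i) \<in> borel_measurable borel" by measurable
    show "integrable lborel (\<lambda>\<xi>. (wgt s \<xi> * cmod (g \<xi> $ i))\<^sup>2)"
    proof (rule Bochner_Integration.integrable_bound)
      show "integrable lborel (\<lambda>\<xi>. (wgt s \<xi> * norm (g \<xi>))\<^sup>2)" using * by blast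
      show "AE \<xi> in lborel. norm ((wgt s \<xi> * cmod (g \<xi> $ i))\<^sup>2) \<le> norm ((wgt s \<xi> * norm (g \<xi>))\<^sup>2)"
        by (intro AE_I2) (auto intro!: power_mono mult_left_mono Finite_Cartesian_Product.norm_nth_le)
    qed measurable
    have "AE \<xi> in lborel. \<forall>i. g (- \<xi>) $ i = cnj (g \<xi> $ i)" using * by blast
    then show "AE \<xi> in lborel. g (- \<xi>) $ i = cnj (g \<xi> $ i)" by eventually_elim blast
  qed
qed

lemma sobolev_vec_ft:
  assumes "u \<in> sobolev_vec s"
  shows "has_fourier_vec u (ft_vec u)" "sobolev_vfun s (ft_vec u)"
  using assms by (auto simp: sobolev_vec_def has_fourier_vec_def ft_vec_def sobolev_vfun_def intro: sobolev_ft)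

lemma sobolev_vec_memI: "has_fourier_vec u g \<Longrightarrow> sobolev_vfun s g \<Longrightarrow> u \<in> sobolev_vec s"
  unfolding sobolev_vec_def has_fourier_vec_def sobolev_vfun_def sobolev_iff by blast

lemma sobolev_vfun_has_fourier:
  assumes "sobolev_vfun s g"
  obtains u where "has_fourier_vec u g"
proof -
  have "\<forall>i. \<exists>T. has_fourier T (\<lambda>\<xi>. g \<xi> $ i)"
    using assms sobolev_fun_has_fourier unfolding sobolev_vfun_def by blast
  then obtain T where "\<And>i. has_fourier (T i) (\<lambda>\<xi>. g \<xi> $ i)" by metis
  then have "has_fourier_vec (\<chi> i. T i) g" by (simp add: has_fourier_vec_def)
  then show ?thesis by (rule that)
qed

lemma has_fourier_vec_AE:
  assumes "has_fourier_vec u g" "has_fourier_vec u h"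
  shows "AE \<xi> in lborel. g \<xi> = h \<xi>"
proof -
  have "AE \<xi> in lborel. \<forall>i\<in>UNIV. g \<xi> $ i = h \<xi> $ i"
    using assms by (intro AE_finite_allI) (auto simp: has_fourier_vec_def intro: has_fourier_AE_unique)
  then show ?thesis by (simp add: vec_eq_iff)
qed

lemma has_fourier_vec_inject:
  assumes "has_fourier_vec u g" "has_fourier_vec v h" "AE \<xi> in lborel. g \<xi> = h \<xi>"
  shows "u = v"
  unfolding vec_eq_iff
proof
  fix i
  show "u $ i = v $ i"
    by (rule has_fourier_inject[of _ "\<lambda>\<xi>. g \<xi> $ i" _ "\<lambda>\<xi>. h \<xi> $ i"])
      (use assms in \<open>auto simp: has_fourier_vec_def\<close>)
qed

lemma sobolev_mass_nonneg: "0 \<le> sobolev_mass s g"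
  unfolding sobolev_mass_def by (rule Bochner_Integration.integral_nonneg) simp

lemma sobolev_vec_norm_eq:
  assumes u: "has_fourier_vec u g" and g: "sobolev_vfun s g"
  shows "sobolev_vec_norm s u = sqrt (sobolev_mass s g)"
proof -
  have "(sobolev_norm s (u $ i))\<^sup>2 = (LINT \<xi>|lborel. (wgt s \<xi> * cmod (g \<xi> $ i))\<^sup>2)" for i
  proof -
    have "has_fourier (u $ i) (\<lambda>\<xi>. g \<xi> $ i)" using u by (simp add: has_fourier_vec_def)
    from sobolev_norm_eq[OF this] show ?thesis by simp
  qed
  then show ?thesis
    unfolding sobolev_vec_norm_def sobolev_mass_def wgt_norm_vec using g
    by (subst Bochner_Integration.integral_sum) (auto simp: sobolev_vfun_def sobolev_fun_def)
qed

lemma sobolev_vfun_lincomb: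
  fixes g h :: "real^'d::finite \<Rightarrow> complex^'n::finite"
  assumes g: "sobolev_vfun s g" and h: "sobolev_vfun s h"
  shows "sobolev_vfun s (\<lambda>\<xi>. a *\<^sub>R g \<xi> + b *\<^sub>R h \<xi>)"
  unfolding sobolev_vfun_iff
proof (intro conjI)
  note [measurable] = sobolev_vfun_measurable[OF g] sobolev_vfun_measurable[OF h]
  show "(\<lambda>\<xi>. a *\<^sub>R g \<xi> + b *\<^sub>R h \<xi>) \<in> borel_measurable borel" by measurable
  show "integrable lborel (\<lambda>\<xi>. (wgt s \<xi> * norm (a *\<^sub>R g \<xi> + b *\<^sub>R h \<xi>))\<^sup>2)"
  proof (rule Bochner_Integration.integrable_bound)
    show "integrable lborel (\<lambda>\<xi>. 2 * (a\<^sup>2 * (wgt s \<xi> * norm (g \<xi>))\<^sup>2) + 2 * (b\<^sup>2 * (wgt s \<xi> * norm (h \<xi>))\<^sup>2))"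
      using g h unfolding sobolev_vfun_iff by (intro Bochner_Integration.integrable_add integrable_mult_right) blast+
    show "AE \<xi> in lborel. norm ((wgt s \<xi> * norm (a *\<^sub>R g \<xi> + b *\<^sub>R h \<xi>))\<^sup>2) \<le>
       norm (2 * (a\<^sup>2 * (wgt s \<xi> * norm (g \<xi>))\<^sup>2) + 2 * (b\<^sup>2 * (wgt s \<xi> * norm (h \<xi>))\<^sup>2))"
    proof (intro AE_I2)
      fix \<xi>
      have "norm (a *\<^sub>R g \<xi> + b *\<^sub>R h \<xi>) \<le> \<bar>a\<bar> * norm (g \<xi>) + \<bar>b\<bar> * norm (h \<xi>)"
        by (rule order_trans[OF norm_triangle_ineq]) simp
      then have "(wgt s \<xi> * norm (a *\<^sub>R g \<xi> + b *\<^sub>R h \<xi>))\<^sup>2 \<le> (wgt s \<xi> * (\<bar>a\<bar> * norm (g \<xi>) + \<bar>b\<bar> * norm (h \<xi>)))\<^sup>2"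
        by (intro power_mono mult_left_mono) auto
      also have "\<dots> = (\<bar>a\<bar> * (wgt s \<xi> * norm (g \<xi>)) + \<bar>b\<bar> * (wgt s \<xi> * norm (h \<xi>)))\<^sup>2"
        by (simp add: algebra_simps)
      also have "\<dots> \<le> 2 * (\<bar>a\<bar> * (wgt s \<xi> * norm (g \<xi>)))\<^sup>2 + 2 * (\<bar>b\<bar> * (wgt s \<xi> * norm (h \<xi>)))\<^sup>2"
        using zero_le_power2[of "\<bar>a\<bar> * (wgt s \<xi> * norm (g \<xi>)) - \<bar>b\<bar> * (wgt s \<xi> * norm (h \<xi>))"]
        unfolding power2_diff power2_sum by linarith
      finally show "norm ((wgt s \<xi> * norm (a *\<^sub>R g \<xi> + b *\<^sub>R h \<xi>))\<^sup>2) \<le>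
       norm (2 * (a\<^sup>2 * (wgt s \<xi> * norm (g \<xi>))\<^sup>2) + 2 * (b\<^sup>2 * (wgt s \<xi> * norm (h \<xi>))\<^sup>2))"
        by (simp add: power_mult_distrib)
    qed
  qed measurable
  show "AE \<xi> in lborel. \<forall>i. (a *\<^sub>R g (- \<xi>) + b *\<^sub>R h (- \<xi>)) $ i = cnj ((a *\<^sub>R g \<xi> + b *\<^sub>R h \<xi>) $ i)"
  proof -
    have "AE \<xi> in lborel. \<forall>i. g (- \<xi>) $ i = cnj (g \<xi> $ i)" "AE \<xi> in lborel. \<forall>i. h (- \<xi>) $ i = cnj (h \<xi> $ i)"
      using g h unfolding sobolev_vfun_iff by blast+
    then show ?thesis by eventually_elim simp
  qed
qed

lemma sobolev_vfun_diff: "sobolev_vfun s g \<Longrightarrow> sobolev_vfun s h \<Longrightarrow> sobolev_vfun s (\<lambda>\<xi>. g \<xi> - h \<xi>)"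
  using sobolev_vfun_lincomb[of s g h 1 "-1"] by simp

lemma sobolev_vfun_add: "sobolev_vfun s g \<Longrightarrow> sobolev_vfun s h \<Longrightarrow> sobolev_vfun s (\<lambda>\<xi>. g \<xi> + h \<xi>)"
  using sobolev_vfun_lincomb[of s g h 1 1] by simp

lemma sobolev_vfun_zero: "sobolev_vfun s (\<lambda>\<xi>. 0)"
  by (simp add: sobolev_vfun_iff)

lemma sobolev_vfun_sum:
  "finite F \<Longrightarrow> (\<And>k. k \<in> F \<Longrightarrow> sobolev_vfun s (g k)) \<Longrightarrow> sobolev_vfun s (\<lambda>\<xi>. \<Sum>k\<in>F. g k \<xi>)"
  by (induction F rule: finite_induct) (auto intro: sobolev_vfun_zero sobolev_vfun_add)

lemma has_fourier_vec_diff: "has_fourier_vec u g \<Longrightarrow> has_fourier_vec v h \<Longrightarrow> has_fourier_vec (u - v) (\<lambda>\<xi>. g \<xi> - h \<xi>)"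
  by (simp add: has_fourier_vec_def has_fourier_diff)

lemma has_fourier_vec_sum:
  "finite F \<Longrightarrow> (\<And>k. k \<in> F \<Longrightarrow> has_fourier_vec (u k) (g k)) \<Longrightarrow> has_fourier_vec (\<Sum>k\<in>F. u k) (\<lambda>\<xi>. \<Sum>k\<in>F. g k \<xi>)"
  by (simp add: has_fourier_vec_def has_fourier_sum)

lemma sobolev_mass_add_le:
  assumes g: "sobolev_vfun s g" and h: "sobolev_vfun s h"
  shows "sobolev_mass s (\<lambda>\<xi>. g \<xi> + h \<xi>) \<le> 2 * sobolev_mass s g + 2 * sobolev_mass s h"
proof -
  have i: "integrable lborel (\<lambda>\<xi>. (wgt s \<xi> * norm (g \<xi>))\<^sup>2)" "integrable lborel (\<lambda>\<xi>. (wgt s \<xi> * norm (h \<xi>))\<^sup>2)"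
    "integrable lborel (\<lambda>\<xi>. (wgt s \<xi> * norm (g \<xi> + h \<xi>))\<^sup>2)"
    using g h sobolev_vfun_add[OF g h] unfolding sobolev_vfun_iff by blast+
  have "sobolev_mass s (\<lambda>\<xi>. g \<xi> + h \<xi>) \<le> (LINT \<xi>|lborel. 2 * (wgt s \<xi> * norm (g \<xi>))\<^sup>2 + 2 * (wgt s \<xi> * norm (h \<xi>))\<^sup>2)"
    unfolding sobolev_mass_def
  proof (rule integral_mono)
    show "integrable lborel (\<lambda>\<xi>. 2 * (wgt s \<xi> * norm (g \<xi>))\<^sup>2 + 2 * (wgt s \<xi> * norm (h \<xi>))\<^sup>2)"
      using i by auto
    fix \<xi>
    have "(wgt s \<xi> * norm (g \<xi> + h \<xi>))\<^sup>2 \<le> (wgt s \<xi> * (norm (g \<xi>) + norm (h \<xi>)))\<^sup>2"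
      by (intro power_mono mult_left_mono norm_triangle_ineq) auto
    also have "\<dots> = (wgt s \<xi> * norm (g \<xi>) + wgt s \<xi> * norm (h \<xi>))\<^sup>2" by (simp add: distrib_left)
    also have "\<dots> \<le> 2 * (wgt s \<xi> * norm (g \<xi>))\<^sup>2 + 2 * (wgt s \<xi> * norm (h \<xi>))\<^sup>2"
      using zero_le_power2[of "wgt s \<xi> * norm (g \<xi>) - wgt s \<xi> * norm (h \<xi>)"]
      unfolding power2_diff power2_sum by linarith
    finally show "(wgt s \<xi> * norm (g \<xi> + h \<xi>))\<^sup>2 \<le> 2 * (wgt s \<xi> * norm (g \<xi>))\<^sup>2 + 2 * (wgt s \<xi> * norm (h \<xi>))\<^sup>2" .
  qed (rule i)
  also have "\<dots> = 2 * sobolev_mass s g + 2 * sobolev_mass s h"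
    unfolding sobolev_mass_def using i by simp
  finally show ?thesis .
qed

lemma sobolev_has_sumI:
  assumes f: "\<And>k. k \<in> I \<Longrightarrow> has_fourier_vec (f k) (g k)" "\<And>k. k \<in> I \<Longrightarrow> sobolev_vfun s (g k)"
    and w: "has_fourier_vec w W" "sobolev_vfun s W"
    and lim: "((\<lambda>F. sobolev_mass s (\<lambda>\<xi>. W \<xi> - (\<Sum>k\<in>F. g k \<xi>))) \<longlongrightarrow> 0) (finite_subsets_at_top I)"
  shows "sobolev_has_sum s f I w"
  unfolding sobolev_has_sum_def
proof (intro conjI ballI)
  show "f k \<in> sobolev_vec s" if "k \<in> I" for k using f that sobolev_vec_memI by blast
  show "w \<in> sobolev_vec s" using w by (rule sobolev_vec_memI)
  have "((\<lambda>F. sqrt (sobolev_mass s (\<lambda>\<xi>. W \<xi> - (\<Sum>k\<in>F. g k \<xi>)))) \<longlongrightarrow> sqrt 0) (finite_subsets_at_top I)"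
    by (intro tendsto_real_sqrt lim)
  moreover have "\<forall>\<^sub>F F in finite_subsets_at_top I. sqrt (sobolev_mass s (\<lambda>\<xi>. W \<xi> - (\<Sum>k\<in>F. g k \<xi>))) = sobolev_vec_norm s (w - sum f F)"
  proof (rule eventually_finite_subsets_at_top_weakI)
    fix F assume F: "finite F" "F \<subseteq> I"
    then show "sqrt (sobolev_mass s (\<lambda>\<xi>. W \<xi> - (\<Sum>k\<in>F. g k \<xi>))) = sobolev_vec_norm s (w - sum f F)"
      by (intro sobolev_vec_norm_eq[symmetric] has_fourier_vec_diff w has_fourier_vec_sum sobolev_vfun_diff sobolev_vfun_sum)
        (use f in auto)
  qed
  ultimately show "((\<lambda>F. sobolev_vec_norm s (w - sum f F)) \<longlongrightarrow> 0) (finite_subsets_at_top I)"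
    by (simp add: Lim_transform_eventually)
qed

text \<open>Two candidates are compared through a common partial sum, with the triangle inequality
  for squares. Uniqueness gives the definite description in \<open>packet_proj\<close> its
  value.\<close>

lemma sobolev_has_sum_unique:
  assumes w: "sobolev_has_sum s f I w" and w': "sobolev_has_sum s f I w'"
  shows "w = w'"
proof -
  have f: "\<And>k. k \<in> I \<Longrightarrow> f k \<in> sobolev_vec s" and ws: "w \<in> sobolev_vec s" "w' \<in> sobolev_vec s"
    using w w' by (auto simp: sobolev_has_sum_def)
  let ?d = "\<lambda>\<xi>. ft_vec w \<xi> - ft_vec w' \<xi>"
  let ?S = "\<lambda>F \<xi>. \<Sum>k\<in>F. ft_vec (f k) \<xi>"
  have d: "sobolev_vfun s ?d" by (intro sobolev_vfun_diff sobolev_vec_ft ws)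
  have "sobolev_mass s ?d \<le> 2 * (sobolev_vec_norm s (w - sum f F))\<^sup>2 + 2 * (sobolev_vec_norm s (w' - sum f F))\<^sup>2"
    if F: "finite F" "F \<subseteq> I" for F
  proof -
    have S: "sobolev_vfun s (?S F)" "has_fourier_vec (sum f F) (?S F)"
      using F f by (auto intro!: sobolev_vfun_sum has_fourier_vec_sum sobolev_vec_ft)
    have norm: "(sobolev_vec_norm s (u - sum f F))\<^sup>2 = sobolev_mass s (\<lambda>\<xi>. ft_vec u \<xi> - ?S F \<xi>)"
      if "u \<in> sobolev_vec s" for u
      using sobolev_vec_norm_eq[OF has_fourier_vec_diff[OF sobolev_vec_ft(1)[OF that] S(2)]
        sobolev_vfun_diff[OF sobolev_vec_ft(2)[OF that] S(1)]] by (simp add: sobolev_mass_nonneg)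
    have swap: "sobolev_mass s (\<lambda>\<xi>. ?S F \<xi> - ft_vec w' \<xi>) = sobolev_mass s (\<lambda>\<xi>. ft_vec w' \<xi> - ?S F \<xi>)"
      by (simp add: sobolev_mass_def norm_minus_commute)
    have "sobolev_mass s (\<lambda>\<xi>. (ft_vec w \<xi> - ?S F \<xi>) + (?S F \<xi> - ft_vec w' \<xi>)) \<le>
      2 * sobolev_mass s (\<lambda>\<xi>. ft_vec w \<xi> - ?S F \<xi>) + 2 * sobolev_mass s (\<lambda>\<xi>. ?S F \<xi> - ft_vec w' \<xi>)"
      by (intro sobolev_mass_add_le sobolev_vfun_diff S sobolev_vec_ft ws)
    then show ?thesis unfolding norm[OF ws(1)] norm[OF ws(2)] swap by simp
  qed
  then have "\<forall>\<^sub>F F in finite_subsets_at_top I. sobolev_mass s ?d \<le>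
      2 * (sobolev_vec_norm s (w - sum f F))\<^sup>2 + 2 * (sobolev_vec_norm s (w' - sum f F))\<^sup>2"
    by (intro eventually_finite_subsets_at_top_weakI)
  moreover have "((\<lambda>F. 2 * (sobolev_vec_norm s (w - sum f F))\<^sup>2 + 2 * (sobolev_vec_norm s (w' - sum f F))\<^sup>2) \<longlongrightarrow> 2 * 0\<^sup>2 + 2 * 0\<^sup>2) (finite_subsets_at_top I)"
    using w w' unfolding sobolev_has_sum_def by (intro tendsto_intros) blast+
  ultimately have "sobolev_mass s ?d \<le> 2 * 0\<^sup>2 + 2 * 0\<^sup>2"
    by (intro tendsto_lowerbound[of _ _ "finite_subsets_at_top I"]) auto
  then have "sobolev_mass s ?d = 0"
    using sobolev_mass_nonneg[of s ?d] by simp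
  then have "(LINT \<xi>|lborel. (wgt s \<xi> * norm (?d \<xi>))\<^sup>2) = 0"
    by (simp only: sobolev_mass_def)
  then have "AE \<xi> in lborel. (wgt s \<xi> * norm (?d \<xi>))\<^sup>2 = 0"
    using d unfolding sobolev_vfun_iff by (subst (asm) integral_nonneg_eq_0_iff_AE) auto
  then have "AE \<xi> in lborel. ft_vec w \<xi> = ft_vec w' \<xi>"
  proof (rule AE_mp, intro AE_I2 impI)
    fix \<xi> :: "real^'b" assume "(wgt s \<xi> * norm (?d \<xi>))\<^sup>2 = 0"
    then show "ft_vec w \<xi> = ft_vec w' \<xi>" using wgt_pos[of \<xi> s] by simp
  qed
  then show ?thesis using has_fourier_vec_inject sobolev_vec_ft(1) ws by blast
qed

section \<open>Shannon wavelet packets\<close>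

lemma wrap_eq:
  assumes "- pi / 2 \<le> \<eta> - 2 * pi * of_int n" "\<eta> - 2 * pi * of_int n < 3 * pi / 2"
  shows "wrap \<eta> = \<eta> - 2 * pi * of_int n"
proof -
  have "of_int n \<le> (\<eta> + pi / 2) / (2 * pi)" "(\<eta> + pi / 2) / (2 * pi) < of_int n + 1"
    using assms by (simp_all add: pos_le_divide_eq pos_divide_less_eq algebra_simps)
  then have "\<lfloor>(\<eta> + pi / 2) / (2 * pi)\<rfloor> = n" by (simp add: floor_eq_iff)
  then show ?thesis by (simp add: wrap_def)
qed

lemma cis_shift: "cis (- (\<eta> - 2 * pi * of_int n)) = cis (- \<eta>)"
proof -
  have "cis (- (\<eta> - 2 * pi * of_int n)) = cis (- \<eta> + 2 * pi * of_int n)" by simp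
  also have "\<dots> = cis (- \<eta>) * cis (2 * pi * of_int n)" by (simp only: cis_mult)
  finally have "cis (- (\<eta> - 2 * pi * of_int n)) = cis (- \<eta>) * cis (2 * pi * of_int n)" .
  then show ?thesis by simp
qed

lemma filter_inner:
  assumes "- pi / 2 < \<eta> - 2 * pi * of_int n" "\<eta> - 2 * pi * of_int n < pi / 2"
  shows "lowpass \<eta> = 1" "highpass \<eta> = 0"
proof -
  have w: "wrap \<eta> = \<eta> - 2 * pi * of_int n" using assms pi_gt_zero by (intro wrap_eq) linarith+
  show "lowpass \<eta> = 1" "highpass \<eta> = 0" unfolding lowpass_def highpass_def w using assms by auto
qed

lemma filter_outer:
  assumes "pi / 2 < \<eta> - 2 * pi * of_int n" "\<eta> - 2 * pi * of_int n < 3 * pi / 2"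
  shows "lowpass \<eta> = 0" "highpass \<eta> = - cis (- \<eta>)"
proof -
  have w: "wrap \<eta> = \<eta> - 2 * pi * of_int n" using assms pi_gt_zero by (intro wrap_eq) linarith+
  show "lowpass \<eta> = 0" "highpass \<eta> = - cis (- \<eta>)"
    unfolding lowpass_def highpass_def w using assms by (auto simp: cis_shift simp del: minus_diff_eq)
qed

text \<open>The midpoint of the band of index \<open>q\<close> is an odd multiple of pi / 2, and
  only at such points do the filters switch. \<open>lowpass\<close> keeps the half adjacent to an
  even multiple of pi, which is the lower half exactly for even \<open>q\<close>.\<close>

lemma filter_half:
  assumes "real q * pi \<le> \<bar>\<eta>\<bar>" "\<bar>\<eta>\<bar> \<le> (real q + 1) * pi"
  shows "\<bar>\<eta>\<bar> < (real q + 1 / 2) * pi \<longleftrightarrow> even q \<Longrightarrow> \<bar>\<eta>\<bar> \<noteq> (real q + 1 / 2) * pi \<Longrightarrow> lowpass \<eta> = 1 \<and> highpass \<eta> = 0"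
    and "\<bar>\<eta>\<bar> < (real q + 1 / 2) * pi \<longleftrightarrow> odd q \<Longrightarrow> \<bar>\<eta>\<bar> \<noteq> (real q + 1 / 2) * pi \<Longrightarrow> lowpass \<eta> = 0 \<and> highpass \<eta> = - cis (- \<eta>)"
proof -
  define h where "h = pi / 2"
  have h: "0 < h" "pi = 2 * h" by (simp_all add: h_def)
  show "lowpass \<eta> = 1 \<and> highpass \<eta> = 0"
    if "\<bar>\<eta>\<bar> < (real q + 1 / 2) * pi \<longleftrightarrow> even q" "\<bar>\<eta>\<bar> \<noteq> (real q + 1 / 2) * pi"
  proof (cases "even q")
    case True
    then obtain j where j: "q = 2 * j" by blast
    have "\<bar>\<eta>\<bar> < (real q + 1 / 2) * pi" using that True by blast
    then consider "- pi / 2 < \<eta> - 2 * pi * of_int (int j)" "\<eta> - 2 * pi * of_int (int j) < pi / 2" |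
      "- pi / 2 < \<eta> - 2 * pi * of_int (- int j)" "\<eta> - 2 * pi * of_int (- int j) < pi / 2"
      using assms by (cases "0 \<le> \<eta>") (auto simp: j h(2) algebra_simps abs_if h(1) split: if_splits)
    then show ?thesis using filter_inner by cases blast+
  next
    case False
    then obtain j where j: "q = 2 * j + 1" by (blast elim: oddE)
    have "\<bar>\<eta>\<bar> > (real q + 1 / 2) * pi" using that False by linarith
    then consider "- pi / 2 < \<eta> - 2 * pi * of_int (int j + 1)" "\<eta> - 2 * pi * of_int (int j + 1) < pi / 2" |
      "- pi / 2 < \<eta> - 2 * pi * of_int (- int j - 1)" "\<eta> - 2 * pi * of_int (- int j - 1) < pi / 2"
      using assms h(1) by (cases "0 \<le> \<eta>") (auto simp: j h(2) algebra_simps abs_if split: if_splits)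
    then show ?thesis using filter_inner by cases blast+
  qed
  show "lowpass \<eta> = 0 \<and> highpass \<eta> = - cis (- \<eta>)"
    if "\<bar>\<eta>\<bar> < (real q + 1 / 2) * pi \<longleftrightarrow> odd q" "\<bar>\<eta>\<bar> \<noteq> (real q + 1 / 2) * pi"
  proof (cases "even q")
    case True
    then obtain j where j: "q = 2 * j" by blast
    have "\<bar>\<eta>\<bar> > (real q + 1 / 2) * pi" using that True by linarith
    then consider "pi / 2 < \<eta> - 2 * pi * of_int (int j)" "\<eta> - 2 * pi * of_int (int j) < 3 * pi / 2" |
      "pi / 2 < \<eta> - 2 * pi * of_int (- int j - 1)" "\<eta> - 2 * pi * of_int (- int j - 1) < 3 * pi / 2"
      using assms h(1) by (cases "0 \<le> \<eta>") (auto simp: j h(2) algebra_simps abs_if split: if_splits)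
    then show ?thesis using filter_outer by cases blast+
  next
    case False
    then obtain j where j: "q = 2 * j + 1" by (blast elim: oddE)
    have "\<bar>\<eta>\<bar> < (real q + 1 / 2) * pi" using that False by blast
    then consider "pi / 2 < \<eta> - 2 * pi * of_int (int j)" "\<eta> - 2 * pi * of_int (int j) < 3 * pi / 2" |
      "pi / 2 < \<eta> - 2 * pi * of_int (- int j - 1)" "\<eta> - 2 * pi * of_int (- int j - 1) < 3 * pi / 2"
      using assms h(1) by (cases "0 \<le> \<eta>") (auto simp: j h(2) algebra_simps abs_if split: if_splits)
    then show ?thesis using filter_outer by cases blast+
  qed
qed

lemma filter_value:
  assumes "real q * pi \<le> \<bar>\<eta>\<bar>" "\<bar>\<eta>\<bar> \<le> (real q + 1) * pi"
    and "b = odd q \<Longrightarrow> \<bar>\<eta>\<bar> < (real q + 1 / 2) * pi" "b \<noteq> odd q \<Longrightarrow> \<bar>\<eta>\<bar> > (real q + 1 / 2) * pi"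
  shows "(if b then highpass \<eta> else lowpass \<eta>) = (if b then - cis (- \<eta>) else 1)"
proof (cases b)
  case True
  have "\<bar>\<eta>\<bar> < (real q + 1 / 2) * pi \<longleftrightarrow> odd q" "\<bar>\<eta>\<bar> \<noteq> (real q + 1 / 2) * pi"
    using assms(3,4) True by (metis order_less_asym order_less_irrefl)+
  from filter_half(2)[OF assms(1,2) this] True show ?thesis by simp
next
  case False
  have "\<bar>\<eta>\<bar> < (real q + 1 / 2) * pi \<longleftrightarrow> even q" "\<bar>\<eta>\<bar> \<noteq> (real q + 1 / 2) * pi"
    using assms(3,4) False by (metis order_less_asym order_less_irrefl)+
  from filter_half(1)[OF assms(1,2) this] False show ?thesis by simp
qed

lemma filter_zero:
  assumes "real q * pi \<le> \<bar>\<eta>\<bar>" "\<bar>\<eta>\<bar> \<le> (real q + 1) * pi"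
    and "b = odd q \<Longrightarrow> \<bar>\<eta>\<bar> > (real q + 1 / 2) * pi" "b \<noteq> odd q \<Longrightarrow> \<bar>\<eta>\<bar> < (real q + 1 / 2) * pi"
  shows "(if b then highpass \<eta> else lowpass \<eta>) = 0"
proof (cases b)
  case True
  have "\<bar>\<eta>\<bar> < (real q + 1 / 2) * pi \<longleftrightarrow> even q" "\<bar>\<eta>\<bar> \<noteq> (real q + 1 / 2) * pi"
    using assms(3,4) True by (metis order_less_asym order_less_irrefl)+
  from filter_half(1)[OF assms(1,2) this] True show ?thesis by simp
next
  case False
  have "\<bar>\<eta>\<bar> < (real q + 1 / 2) * pi \<longleftrightarrow> odd q" "\<bar>\<eta>\<bar> \<noteq> (real q + 1 / 2) * pi"
    using assms(3,4) False by (metis order_less_asym order_less_irrefl)+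
  from filter_half(2)[OF assms(1,2) this] False show ?thesis by simp
qed

text \<open>The frequency index \<open>q\<close> of a packet with Fourier support \<open>q \<pi> \<le> \<bar>\<xi>\<bar> \<le> (q + 1) \<pi>\<close>. The high-pass
  filter picks the lower half of the support of its argument whenever \<open>q\<close> is odd (Gray code ordering).\<close>

fun freq :: "bool list \<Rightarrow> nat" where
  "freq [] = 1"
| "freq (b # w) = 2 * freq w + (if b = odd (freq w) then 0 else 1)"

text \<open>Each filter keeps one half of the band of its argument, and doubling the argument
  doubles the band index; \<open>freq\<close> records which half remains. At a midpoint both filters
  may be nonzero, so the bands are closed.\<close>

lemma packet_hat1_support:
  "packet_hat1 w \<xi> \<noteq> 0 \<Longrightarrow> real (freq w) * pi \<le> \<bar>\<xi>\<bar> \<and> \<bar>\<xi>\<bar> \<le> (real (freq w) + 1) * pi"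
proof (induction w arbitrary: \<xi>)
  case Nil
  then show ?case by (auto simp: shannon_hat_def indicator_def abs_if split: if_splits)
next
  case (Cons b w)
  let ?q = "freq w" and ?\<eta> = "\<xi> / 2"
  have nz: "packet_hat1 w ?\<eta> \<noteq> 0" "(if b then highpass ?\<eta> else lowpass ?\<eta>) \<noteq> 0"
    using Cons.prems by auto
  have q: "real ?q * pi \<le> \<bar>?\<eta>\<bar>" "\<bar>?\<eta>\<bar> \<le> (real ?q + 1) * pi" using Cons.IH[OF nz(1)] by auto
  have "(b = odd ?q \<longrightarrow> \<bar>?\<eta>\<bar> \<le> (real ?q + 1 / 2) * pi) \<and> (b \<noteq> odd ?q \<longrightarrow> (real ?q + 1 / 2) * pi \<le> \<bar>?\<eta>\<bar>)"
    using filter_zero[OF q, of b] nz(2) by (metis not_le)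
  then show ?case using q by (auto simp: algebra_simps)
qed

text \<open>In the open band every filter is evaluated away from its switching points, so each
  factor is 1 or a unimodular exponential that reflection conjugates. This makes packets real-valued
  and lets their phases cancel in expansions.\<close>

lemma packet_hat1_interior:
  "real (freq w) * pi < \<bar>\<xi>\<bar> \<Longrightarrow> \<bar>\<xi>\<bar> < (real (freq w) + 1) * pi \<Longrightarrow>
    norm (packet_hat1 w \<xi>) = 1 \<and> packet_hat1 w (- \<xi>) = cnj (packet_hat1 w \<xi>)"
proof (induction w arbitrary: \<xi>)
  case Nil
  then have "\<xi> \<in> {- 2 * pi..- pi} \<union> {pi..2 * pi}" "- \<xi> \<in> {- 2 * pi..- pi} \<union> {pi..2 * pi}"
    by (auto simp: abs_if split: if_splits)
  then show ?case by (simp add: shannon_hat_def cis_cnj)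
next
  case (Cons b w)
  let ?q = "freq w" and ?\<eta> = "\<xi> / 2"
  have q: "real ?q * pi < \<bar>?\<eta>\<bar>" "\<bar>?\<eta>\<bar> < (real ?q + 1) * pi"
    and half: "b = odd ?q \<Longrightarrow> \<bar>?\<eta>\<bar> < (real ?q + 1 / 2) * pi" "b \<noteq> odd ?q \<Longrightarrow> \<bar>?\<eta>\<bar> > (real ?q + 1 / 2) * pi"
    using Cons.prems by (auto simp: algebra_simps split: if_splits)
  have q': "real ?q * pi \<le> \<bar>- ?\<eta>\<bar>" "\<bar>- ?\<eta>\<bar> \<le> (real ?q + 1) * pi" using q by auto
  have "norm (if b then highpass ?\<eta> else lowpass ?\<eta>) = 1 \<and>
    (if b then highpass (- ?\<eta>) else lowpass (- ?\<eta>)) = cnj (if b then highpass ?\<eta> else lowpass ?\<eta>)"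
  proof -
    have "(if b then highpass ?\<eta> else lowpass ?\<eta>) = (if b then - cis (- ?\<eta>) else 1)"
      by (rule filter_value[of ?q]) (use q half in auto)
    moreover have "(if b then highpass (- ?\<eta>) else lowpass (- ?\<eta>)) = (if b then - cis (- (- ?\<eta>)) else 1)"
      by (rule filter_value[OF q']) (use half in auto)
    ultimately show ?thesis by (simp add: cis_cnj)
  qed
  then show ?case using Cons.IH[OF q] by (cases b) (simp_all add: norm_mult)
qed

lemma norm_packet_hat1_le: "norm (packet_hat1 w \<xi>) \<le> 1"
proof (induction w arbitrary: \<xi>)
  case Nil
  then show ?case by (simp add: shannon_hat_def norm_mult indicator_def)
next
  case (Cons b w)
  have "norm (if b then highpass (\<xi> / 2) else lowpass (\<xi> / 2)) \<le> 1"
    by (simp add: highpass_def lowpass_def norm_mult indicator_def)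
  then show ?case using Cons.IH[of "\<xi> / 2"] by (simp add: norm_mult mult_le_one)
qed

lemma measurable_packet_hat1 [measurable]: "packet_hat1 w \<in> borel_measurable borel"
proof (induction w)
  case Nil
  have "packet_hat1 [] = shannon_hat" by auto
  moreover have "shannon_hat \<in> borel_measurable borel" unfolding shannon_hat_def[abs_def] by measurable
  ultimately show ?case by simp
next
  case (Cons b w)
  note [measurable] = Cons.IH
  have [measurable]: "wrap \<in> borel_measurable borel" unfolding wrap_def[abs_def] by measurable
  have [measurable]: "lowpass \<in> borel_measurable borel" unfolding lowpass_def[abs_def] by measurable
  have [measurable]: "highpass \<in> borel_measurable borel" unfolding highpass_def[abs_def] by measurable
  have "packet_hat1 (b # w) = (\<lambda>\<xi>. (if b then highpass (\<xi> / 2) else lowpass (\<xi> / 2)) * packet_hat1 w (\<xi> / 2))"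
    by auto
  then show ?case by simp
qed

section \<open>A packet as normalisation times character times phase\<close>

definition lev_scale :: "'d::finite level \<Rightarrow> real^'d" where
  "lev_scale l = (\<chi> i. 2 powi (- fst (l $ i)))"

definition lev_freq :: "'d::finite level \<Rightarrow> 'd \<Rightarrow> nat" where
  "lev_freq l i = freq (snd (l $ i))"

abbreviation lev_shell :: "'d::finite level \<Rightarrow> (real^'d) set" where
  "lev_shell l \<equiv> shell (lev_scale l) (lev_freq l)"

abbreviation lev_open_shell :: "'d::finite level \<Rightarrow> (real^'d) set" where
  "lev_open_shell l \<equiv> open_shell (lev_scale l) (lev_freq l)"

definition lev_phase :: "'d::finite level \<Rightarrow> real^'d \<Rightarrow> complex" where
  "lev_phase l \<xi> = (\<Prod>i\<in>UNIV. packet_hat1 (snd (l $ i)) (lev_scale l $ i * \<xi> $ i))"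

definition lev_norm :: "'d::finite level \<Rightarrow> real" where
  "lev_norm l = (\<Prod>i\<in>UNIV. 2 powr (- of_int (fst (l $ i)) / 2))"

lemma lev_scale_pos: "0 < lev_scale l $ i"
  by (simp add: lev_scale_def)

lemma lev_norm_pos: "0 < lev_norm l"
  by (simp add: lev_norm_def prod_pos)

lemma lev_norm_power2: "(lev_norm l)\<^sup>2 = (\<Prod>i\<in>UNIV. lev_scale l $ i)"
proof -
  have "(2 powr (- of_int j / 2))\<^sup>2 = (2::real) powi (- j)" for j :: int
  proof -
    have "(2 powr (- of_int j / 2))\<^sup>2 = (2::real) powr (- of_int j / 2 + - of_int j / 2)"
      by (simp only: powr_add power2_eq_square)
    also have "\<dots> = 2 powr (of_int (- j))" by simp
    finally show ?thesis by (subst (asm) powr_real_of_int') auto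
  qed
  then show ?thesis unfolding lev_norm_def prod_power_distrib lev_scale_def by simp
qed

text \<open>Only the character depends on the translation \<open>k\<close>. As the phase is
  unimodular inside the shell, orthogonality and completeness of packets reduce to those of the
  exponentials.\<close>

lemma packet_hat_eq: "packet_hat l k \<xi> = of_real (lev_norm l) * torus_char (lev_scale l) k \<xi> * lev_phase l \<xi>"
proof -
  have "torus_char (lev_scale l) k \<xi> = (\<Prod>i\<in>UNIV. cis (- of_int (k $ i) * (lev_scale l $ i * \<xi> $ i)))"
    unfolding torus_char_def by (simp add: cis_conv_exp exp_sum[symmetric] sum_distrib_left sum_negf)
  then show ?thesis
    unfolding packet_hat_def lev_norm_def lev_phase_def lev_scale_def
    by (simp add: prod.distrib[symmetric] case_prod_unfold)
qed

lemma lev_phase_support: "lev_phase l \<xi> \<noteq> 0 \<Longrightarrow> \<xi> \<in> lev_shell l"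
  using packet_hat1_support unfolding lev_phase_def shell_def lev_freq_def by fastforce

lemma lev_phase_interior:
  assumes "\<xi> \<in> lev_open_shell l"
  shows "norm (lev_phase l \<xi>) = 1" "lev_phase l (- \<xi>) = cnj (lev_phase l \<xi>)"
proof -
  have *: "norm (packet_hat1 (snd (l $ i)) (lev_scale l $ i * \<xi> $ i)) = 1 \<and>
     packet_hat1 (snd (l $ i)) (- (lev_scale l $ i * \<xi> $ i)) = cnj (packet_hat1 (snd (l $ i)) (lev_scale l $ i * \<xi> $ i))" for i
    using assms by (intro packet_hat1_interior) (auto simp: open_shell_def lev_freq_def)
  show "norm (lev_phase l \<xi>) = 1" using * by (simp add: lev_phase_def prod_norm[symmetric])
  show "lev_phase l (- \<xi>) = cnj (lev_phase l \<xi>)" using * by (simp add: lev_phase_def)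
qed

lemma norm_lev_phase_le: "norm (lev_phase l \<xi>) \<le> 1"
  unfolding lev_phase_def prod_norm[symmetric] by (intro prod_le_1) (simp add: norm_packet_hat1_le)

lemma measurable_lev_phase [measurable]: "lev_phase l \<in> borel_measurable borel"
  unfolding lev_phase_def[abs_def] by measurable

lemma measurable_packet_hat [measurable]: "packet_hat l k \<in> borel_measurable borel"
  unfolding packet_hat_eq[abs_def] by measurable

lemma fourier_support_subset: "fourier_support l \<subseteq> lev_shell l"
  unfolding fourier_support_def
  by (rule closure_minimal[OF _ closed_shell]) (auto simp: packet_hat_eq intro: lev_phase_support)

lemma fourier_support_superset: "lev_open_shell l \<subseteq> fourier_support l"
proof
  fix \<xi> assume "\<xi> \<in> lev_open_shell l"
  from lev_phase_interior(1)[OF this] have "lev_phase l \<xi> \<noteq> 0" by auto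
  then have "packet_hat l 0 \<xi> \<noteq> 0" using lev_norm_pos[of l] by (simp add: packet_hat_eq)
  then show "\<xi> \<in> fourier_support l"
    unfolding fourier_support_def by (intro closure_subset[THEN subsetD]) simp
qed

subsection \<open>Orthogonality\<close>

lemma integral_cart_prod:
  fixes f :: "'d::finite \<Rightarrow> real \<Rightarrow> complex"
  assumes f: "\<And>i. integrable lborel (f i)"
  shows "(LINT x|lborel. (\<Prod>i\<in>UNIV. f i (x $ i))) = (\<Prod>i\<in>UNIV. LINT t|lborel. f i t)"
proof -
  have [measurable]: "f i \<in> borel_measurable borel" for i using f[of i] by auto
  define c where "c b = (THE i. b = axis i 1)" for b :: "real^'d"
  have c: "c (axis i 1) = i" for i unfolding c_def by (auto simp: axis_eq_axis)
  interpret product_sigma_finite "\<lambda>_::real^'d. lborel :: real measure"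
    by standard
  have "(LINT x|lborel. (\<Prod>i\<in>UNIV. f i (x $ i))) = (LINT x|lborel. (\<Prod>b\<in>(Basis :: (real^'d) set). f (c b) (x \<bullet> b)))"
    by (simp add: prod_Basis_cart c inner_axis)
  also have "\<dots> = (LINT y|(\<Pi>\<^sub>M b\<in>Basis. lborel). (\<Prod>b\<in>(Basis :: (real^'d) set). f (c b) ((\<Sum>b\<in>Basis. y b *\<^sub>R b) \<bullet> b)))"
    by (subst lborel_eq, subst integral_distr) measurable
  also have "\<dots> = (LINT y|(\<Pi>\<^sub>M b\<in>Basis. lborel). (\<Prod>b\<in>(Basis :: (real^'d) set). f (c b) (y b)))"
    by simp
  also have "\<dots> = (\<Prod>b\<in>(Basis :: (real^'d) set). LINT t|lborel. f (c b) t)"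
    by (rule product_integral_prod) (auto intro: f)
  also have "\<dots> = (\<Prod>i\<in>UNIV. LINT t|lborel. f i t)"
    by (simp add: prod_Basis_cart c)
  finally show ?thesis .
qed

text \<open>For \<open>n \<noteq> 0\<close> an antiderivative takes equal values at opposite
  multiples of pi, so the two intervals contribute opposite amounts. A single interval is only half
  a period, and its integral need not vanish.\<close>

lemma band_cis_integral:
  fixes n :: int
  shows "integrable lborel (\<lambda>t. indicator {t. real m * pi \<le> \<bar>t\<bar> \<and> \<bar>t\<bar> \<le> (real m + 1) * pi} t *\<^sub>R cis (of_int n * t))" (is "integrable lborel ?f")
    and "(LINT t|lborel. indicator {t. real m * pi \<le> \<bar>t\<bar> \<and> \<bar>t\<bar> \<le> (real m + 1) * pi} t *\<^sub>R cis (of_int n * t)) = (if n = 0 then 2 * pi else 0)"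
proof -
  let ?A = "{real m * pi..(real m + 1) * pi}" and ?B = "{- (real m + 1) * pi..- (real m * pi)}"
  let ?g = "\<lambda>t. indicator ?A t *\<^sub>R cis (of_int n * t) + indicator ?B t *\<^sub>R cis (of_int n * t)"
  have le: "real m * pi \<le> (real m + 1) * pi" "- (real m + 1) * pi \<le> - (real m * pi)"
    by (auto simp: algebra_simps)
  have cont: "continuous_on S (\<lambda>t. cis (of_int n * t))" for S by (intro continuous_intros)
  have i: "integrable lborel (\<lambda>t. indicator ?A t *\<^sub>R cis (of_int n * t))" "integrable lborel (\<lambda>t. indicator ?B t *\<^sub>R cis (of_int n * t))"
    using borel_integrable_atLeastAtMost'[OF cont] by (auto simp: set_integrable_def)
  \<comment> \<open>The two closed intervals can only meet at 0, which happens for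
    \<open>m = 0\<close>.\<close>
  have ae: "AE t in lborel. ?f t = ?g t"
    using AE_lborel_singleton[of 0]
  proof eventually_elim
    fix t :: real assume "t \<noteq> 0"
    define M where "M = real m * pi"
    have M: "0 \<le> M" "(real m + 1) * pi = M + pi" "- (real m + 1) * pi = - M - pi"
      by (simp_all add: M_def algebra_simps)
    show "?f t = ?g t"
      unfolding M(2,3) M_def[symmetric]
      using \<open>t \<noteq> 0\<close> M(1) pi_gt_zero by (cases "0 \<le> t") (auto simp: indicator_def)
  qed
  have gi: "integrable lborel ?g" using i by (rule Bochner_Integration.integrable_add)
  show "integrable lborel ?f"
    by (rule integrable_cong_AE_imp[OF gi]) (use ae in auto)
  have "(LINT t|lborel. ?f t) = (LINT t|lborel. ?g t)"
    by (rule integral_cong_AE) (use ae in auto)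
  also have "\<dots> = (LINT t|lborel. indicator ?A t *\<^sub>R cis (of_int n * t)) + (LINT t|lborel. indicator ?B t *\<^sub>R cis (of_int n * t))"
    using i by simp
  also have "\<dots> = (if n = 0 then 2 * pi else 0)"
  proof (cases "n = 0")
    case True
    then show ?thesis using le by (simp add: algebra_simps scaleR_conv_of_real)
  next
    case False
    define F where "F t = - \<i> / of_int n * cis (of_int n * t)" for t :: real
    have dF: "(F has_vector_derivative cis (of_int n * t)) (at t within S)" for t S
    proof -
      have "((\<lambda>t. cis (of_int n * t)) has_derivative (\<lambda>h. (of_int n * h) *\<^sub>R (\<i> * cis (of_int n * t)))) (at t within S)"
        by (auto intro!: derivative_eq_intros)
      then have "(F has_derivative (\<lambda>h. - \<i> / of_int n * ((of_int n * h) *\<^sub>R (\<i> * cis (of_int n * t))))) (at t within S)"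
        unfolding F_def by (rule has_derivative_mult_right)
      moreover have "(\<lambda>h. - \<i> / of_int n * ((of_int n * h) *\<^sub>R (\<i> * cis (of_int n * t)))) = (\<lambda>h. h *\<^sub>R cis (of_int n * t))"
        using False by (auto simp: fun_eq_iff scaleR_conv_of_real field_simps)
      ultimately show ?thesis unfolding has_vector_derivative_def by simp
    qed
    have "(LINT t|lborel. indicator ?A t *\<^sub>R cis (of_int n * t)) = F ((real m + 1) * pi) - F (real m * pi)"
      "(LINT t|lborel. indicator ?B t *\<^sub>R cis (of_int n * t)) = F (- (real m * pi)) - F (- (real m + 1) * pi)"
      by (intro integral_FTC_atLeastAtMost le dF cont)+
    moreover have sym: "F (- x) = F x" if "sin (of_int n * x) = 0" for x
      using that False by (simp add: F_def complex_eq_iff)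
    moreover have "sin (of_int n * ((real m + 1) * pi)) = 0" "sin (of_int n * (real m * pi)) = 0"
      unfolding sin_zero_iff_int2
      by (rule exI[of _ "n * (int m + 1)"], simp) (rule exI[of _ "n * int m"], simp)
    from sym[OF this(1)] sym[OF this(2)] have "F (- (real m + 1) * pi) = F ((real m + 1) * pi)" "F (- (real m * pi)) = F (real m * pi)"
      by (simp_all only: mult_minus_left)
    ultimately show ?thesis
      using False by simp
  qed
  finally show "(LINT t|lborel. ?f t) = (if n = 0 then 2 * pi else 0)" .
qed

text \<open>Shell and character both factor over the coordinates, and one coordinate with
  \<open>k $ i \<noteq> 0\<close> annihilates the product. Rescaling each coordinate produces the
  factors \<open>1 / a $ i\<close>.\<close>

lemma shell_char_integral:
  fixes a :: "real^'d::finite"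
  assumes a: "\<And>i. 0 < a $ i"
  shows "(LINT x|lborel. indicator (shell a m) x *\<^sub>R torus_char a k x) =
    (if k = 0 then of_real ((2 * pi) ^ CARD('d) / (\<Prod>i\<in>UNIV. a $ i)) else 0)"
proof -
  define g where "g i t = indicator {t. real (m i) * pi \<le> \<bar>t\<bar> \<and> \<bar>t\<bar> \<le> (real (m i) + 1) * pi} t *\<^sub>R cis (of_int (- (k $ i)) * t)"
    for i t
  have g: "integrable lborel (g i)" "(LINT t|lborel. g i t) = (if k $ i = 0 then 2 * pi else 0)" for i
    unfolding g_def using band_cis_integral[of "m i" "- (k $ i)"] by simp_all
  have gi: "integrable lborel (\<lambda>t. g i (a $ i * t))" for i
    using lborel_integrable_real_affine[OF g(1), of "a $ i" i 0] a[of i] by simp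
  have "(LINT t|lborel. g i t) = \<bar>a $ i\<bar> *\<^sub>R (LINT t|lborel. g i (0 + a $ i * t))" for i
    by (rule lborel_integral_real_affine) (use a[of i] in simp)
  then have sc: "\<bar>a $ i\<bar> *\<^sub>R (LINT t|lborel. g i (0 + a $ i * t)) = (if k $ i = 0 then 2 * pi else 0)" for i
    using g(2) by metis
  have gl: "(LINT t|lborel. g i (a $ i * t)) = (if k $ i = 0 then of_real (2 * pi / a $ i) else 0)" for i
    using a[of i] sc[of i] by (cases "k $ i = 0") (simp_all add: scaleR_conv_of_real nonzero_eq_divide_eq mult.commute)
  have "indicator (shell a m) x *\<^sub>R torus_char a k x = (\<Prod>i\<in>UNIV. g i (a $ i * x $ i))" for x
  proof (cases "x \<in> shell a m")
    case True
    then have "g i (a $ i * x $ i) = cis (- (of_int (k $ i) * (a $ i * x $ i)))" for i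
      by (simp add: g_def shell_def)
    then show ?thesis
      using True by (simp add: torus_char_def cis_conv_exp exp_sum[symmetric] sum_distrib_left sum_negf)
  next
    case False
    then obtain i where "\<not> (real (m i) * pi \<le> \<bar>a $ i * x $ i\<bar> \<and> \<bar>a $ i * x $ i\<bar> \<le> (real (m i) + 1) * pi)"
      by (auto simp: shell_def)
    then have "g i (a $ i * x $ i) = 0" by (simp add: g_def)
    then have "(\<Prod>i\<in>UNIV. g i (a $ i * x $ i)) = 0" by (intro prod_zero) auto
    then show ?thesis using False by simp
  qed
  then have "(LINT x|lborel. indicator (shell a m) x *\<^sub>R torus_char a k x) = (\<Prod>i\<in>UNIV. if k $ i = 0 then of_real (2 * pi / a $ i) else 0)"
    using integral_cart_prod[of "\<lambda>i t. g i (a $ i * t)", OF gi] gl by simp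
  also have "\<dots> = (if k = 0 then of_real ((2 * pi) ^ CARD('d) / (\<Prod>i\<in>UNIV. a $ i)) else 0)"
  proof (cases "k = 0")
    case True
    then show ?thesis by (simp add: prod_dividef)
  next
    case False
    then obtain i where "k $ i \<noteq> 0" by (auto simp: vec_eq_iff)
    then have "(\<Prod>i\<in>UNIV. if k $ i = 0 then complex_of_real (2 * pi / a $ i) else 0) = 0"
      by (intro prod_zero) auto
    then show ?thesis using False by simp
  qed
  finally show ?thesis .
qed

subsection \<open>Expansion in an orthogonal family\<close>

lemma cmod_add_power2: "(cmod (r + s))\<^sup>2 = (cmod r)\<^sup>2 + (cmod s)\<^sup>2 + 2 * Re (r * cnj s)"
  by (simp only: cmod_power2) (simp add: power2_eq_square algebra_simps)

lemma norm_diff_power2_le: "(norm (x - y))\<^sup>2 \<le> 2 * (norm x)\<^sup>2 + 2 * (norm y)\<^sup>2"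
proof -
  have "(norm (x - y))\<^sup>2 \<le> (norm x + norm y)\<^sup>2" by (intro power_mono norm_triangle_ineq4) auto
  also have "\<dots> \<le> 2 * (norm x)\<^sup>2 + 2 * (norm y)\<^sup>2"
    using zero_le_power2[of "norm x - norm y"] unfolding power2_diff power2_sum by linarith
  finally show ?thesis .
qed

lemma (in finite_measure) square_integrable_imp_integrable:
  fixes f :: "'a \<Rightarrow> complex"
  assumes [measurable]: "f \<in> borel_measurable M" and f: "integrable M (\<lambda>x. (norm (f x))\<^sup>2)"
  shows "integrable M f"
proof (rule Bochner_Integration.integrable_bound)
  show "integrable M (\<lambda>x. 1 + (norm (f x))\<^sup>2)" using f by simp
  have "norm (f x) \<le> 1 + (norm (f x))\<^sup>2" for x
    using mult_le_add_squares[of 1 "norm (f x)"] by simp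
  then show "AE x in M. norm (f x) \<le> norm (1 + (norm (f x))\<^sup>2)" by (intro AE_I2) (simp add: add_nonneg_nonneg)
qed measurable

lemma (in finite_measure) square_integrable_diff_bounded:
  fixes f g :: "'a \<Rightarrow> complex"
  assumes [measurable]: "f \<in> borel_measurable M" "g \<in> borel_measurable M"
    and f: "integrable M (\<lambda>x. (norm (f x))\<^sup>2)" and B: "\<And>x. norm (g x) \<le> B"
  shows "integrable M (\<lambda>x. (norm (f x - g x))\<^sup>2)"
proof (rule Bochner_Integration.integrable_bound)
  show "integrable M (\<lambda>x. 2 * (norm (f x))\<^sup>2 + 2 * B\<^sup>2)" using f by simp
  have "(norm (f x - g x))\<^sup>2 \<le> 2 * (norm (f x))\<^sup>2 + 2 * B\<^sup>2" for x
    by (rule order_trans[OF norm_diff_power2_le]) (use B in \<open>auto intro!: power_mono\<close>)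
  then show "AE x in M. norm ((norm (f x - g x))\<^sup>2) \<le> norm (2 * (norm (f x))\<^sup>2 + 2 * B\<^sup>2)"
    by (intro AE_I2) (simp add: add_nonneg_nonneg)
qed measurable

text \<open>The residual \<open>r\<close> is orthogonal to the chosen members of the family. Other
  coefficients change it by an element \<open>s\<close> of their span, which merely adds its own
  squared norm.\<close>

lemma (in finite_measure) orthogonal_best_approximation:
  fixes E :: "'k \<Rightarrow> 'a \<Rightarrow> complex" and f :: "'a \<Rightarrow> complex"
  assumes E[measurable]: "\<And>k. E k \<in> borel_measurable M" and E1: "\<And>k x. norm (E k x) \<le> 1"
    and orth: "\<And>k m. (LINT x|M. E k x * cnj (E m x)) = (if k = m then V else 0)" and V: "V \<noteq> 0"
    and f[measurable]: "f \<in> borel_measurable M" and f2: "integrable M (\<lambda>x. (norm (f x))\<^sup>2)"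
    and b: "\<And>k. b k = (LINT x|M. f x * cnj (E k x)) / V" and F: "finite F"
  shows "(LINT x|M. (norm (f x - (\<Sum>k\<in>F. b k * E k x)))\<^sup>2) \<le> (LINT x|M. (norm (f x - (\<Sum>k\<in>F. a k * E k x)))\<^sup>2)"
proof -
  define r where "r x = f x - (\<Sum>k\<in>F. b k * E k x)" for x
  define s where "s x = (\<Sum>k\<in>F. (b k - a k) * E k x)" for x
  have [measurable]: "r \<in> borel_measurable M" "s \<in> borel_measurable M"
    unfolding r_def s_def by measurable
  have bound: "norm (\<Sum>k\<in>F. c k * E k x) \<le> (\<Sum>k\<in>F. norm (c k))" for c x
    by (rule sum_norm_le) (use E1 in \<open>auto simp: norm_mult intro: mult_left_le\<close>)
  have ri2: "integrable M (\<lambda>x. (norm (r x))\<^sup>2)"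
    unfolding r_def by (rule square_integrable_diff_bounded[OF f _ f2 bound]) measurable
  have ri: "integrable M r" by (rule square_integrable_imp_integrable[OF _ ri2]) measurable
  have fi: "integrable M f" by (rule square_integrable_imp_integrable[OF _ f2]) measurable
  have iE: "integrable M (\<lambda>x. h x * cnj (E m x))" if "integrable M h" for h m
    using integrable_bounded_mult[OF that, of "\<lambda>x. cnj (E m x)" 1] E1 by (simp add: mult.commute)
  have Ei: "integrable M (E k)" for k
    by (rule integrable_const_bound[of _ 1]) (use E1 in auto)
  have perp: "(LINT x|M. r x * cnj (E m x)) = 0" if m: "m \<in> F" for m
  proof -
    have "(LINT x|M. r x * cnj (E m x)) = (LINT x|M. f x * cnj (E m x) - (\<Sum>k\<in>F. b k * (E k x * cnj (E m x))))"
      unfolding r_def by (simp add: left_diff_distrib sum_distrib_right mult.assoc)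
    also have "\<dots> = (LINT x|M. f x * cnj (E m x)) - (\<Sum>k\<in>F. b k * (LINT x|M. E k x * cnj (E m x)))"
      using iE[OF fi] iE[OF Ei] by (simp add: Bochner_Integration.integral_diff Bochner_Integration.integral_sum)
    also have "(\<Sum>k\<in>F. b k * (LINT x|M. E k x * cnj (E m x))) = (\<Sum>k\<in>F. if k = m then b m * V else 0)"
      unfolding orth by (intro sum.cong) auto
    also have "\<dots> = b m * V" using F m by simp
    finally show ?thesis using V by (simp add: b)
  qed
  have "r x * cnj (s x) = (\<Sum>k\<in>F. cnj (b k - a k) * (r x * cnj (E k x)))" for x
    by (simp add: s_def sum_distrib_left mult_ac)
  then have rs: "(LINT x|M. r x * cnj (s x)) = 0" and rsi: "integrable M (\<lambda>x. r x * cnj (s x))"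
    using iE[OF ri] perp by (simp_all add: Bochner_Integration.integral_sum)
  have si: "integrable M (\<lambda>x. (norm (s x))\<^sup>2)"
    unfolding s_def using bound
    by (intro integrable_const_bound[of _ "(\<Sum>k\<in>F. norm (b k - a k))\<^sup>2"]) (auto intro!: power_mono)
  have "(LINT x|M. (norm (f x - (\<Sum>k\<in>F. a k * E k x)))\<^sup>2) = (LINT x|M. (norm (r x))\<^sup>2 + (norm (s x))\<^sup>2 + 2 * Re (r x * cnj (s x)))"
    unfolding cmod_add_power2[symmetric] r_def s_def by (simp add: left_diff_distrib sum_subtractf)
  also have "\<dots> = (LINT x|M. (norm (r x))\<^sup>2) + (LINT x|M. (norm (s x))\<^sup>2) + 2 * Re (LINT x|M. r x * cnj (s x))"
    using ri2 si rsi integral_Re[OF rsi] integrable_Re[OF rsi] by (simp del: times_complex.sel)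
  also have "\<dots> \<ge> (LINT x|M. (norm (r x))\<^sup>2)"
    unfolding rs by (simp add: Bochner_Integration.integral_nonneg)
  finally show ?thesis unfolding r_def .
qed

text \<open>Density yields one good finite combination, and by best approximation the Fourier
  coefficients do at least as well on every larger finite set. This is convergence along the net of
  finite sets, that is, unconditional convergence.\<close>

lemma (in finite_measure) orthogonal_expansion:
  fixes E :: "'k \<Rightarrow> 'a \<Rightarrow> complex" and f :: "'a \<Rightarrow> complex"
  assumes E: "\<And>k. E k \<in> borel_measurable M" "\<And>k x. norm (E k x) \<le> 1"
    and orth: "\<And>k m. (LINT x|M. E k x * cnj (E m x)) = (if k = m then V else 0)" "V \<noteq> 0"
    and f: "f \<in> borel_measurable M" "integrable M (\<lambda>x. (norm (f x))\<^sup>2)"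
    and b: "\<And>k. b k = (LINT x|M. f x * cnj (E k x)) / V"
    and dense: "\<And>e. 0 < e \<Longrightarrow> \<exists>F c. finite F \<and> (LINT x|M. (norm (f x - (\<Sum>k\<in>F. c k * E k x)))\<^sup>2) < e"
  shows "((\<lambda>F. LINT x|M. (norm (f x - (\<Sum>k\<in>F. b k * E k x)))\<^sup>2) \<longlongrightarrow> 0) (finite_subsets_at_top UNIV)"
proof (rule tendstoI)
  fix e :: real assume "0 < e"
  then obtain F0 c where F0: "finite F0" and c: "(LINT x|M. (norm (f x - (\<Sum>k\<in>F0. c k * E k x)))\<^sup>2) < e"
    using dense by blast
  have "dist (LINT x|M. (norm (f x - (\<Sum>k\<in>F. b k * E k x)))\<^sup>2) 0 < e" if F: "finite F" "F0 \<subseteq> F" for F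
  proof -
    have "(\<Sum>k\<in>F. (if k \<in> F0 then c k else 0) * E k x) = (\<Sum>k\<in>F0. c k * E k x)" for x
      using F by (intro sum.mono_neutral_cong_right) auto
    with orthogonal_best_approximation[OF E orth f b F(1), of "\<lambda>k. if k \<in> F0 then c k else 0"] c
    have "(LINT x|M. (norm (f x - (\<Sum>k\<in>F. b k * E k x)))\<^sup>2) < e" by simp
    then show ?thesis by (simp add: Bochner_Integration.integral_nonneg)
  qed
  then show "\<forall>\<^sub>F F in finite_subsets_at_top UNIV. dist (LINT x|M. (norm (f x - (\<Sum>k\<in>F. b k * E k x)))\<^sup>2) 0 < e"
    using F0 by (auto simp: eventually_finite_subsets_at_top)
qed

lemma (in finite_measure) square_integral_triangle:
  fixes f g h :: "'a \<Rightarrow> complex"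
  assumes [measurable]: "f \<in> borel_measurable M" "g \<in> borel_measurable M" "h \<in> borel_measurable M"
    and fg: "integrable M (\<lambda>x. (norm (f x - g x))\<^sup>2)" and gh: "integrable M (\<lambda>x. (norm (g x - h x))\<^sup>2)"
  shows "(LINT x|M. (norm (f x - h x))\<^sup>2) \<le> 2 * (LINT x|M. (norm (f x - g x))\<^sup>2) + 2 * (LINT x|M. (norm (g x - h x))\<^sup>2)"
proof -
  have "(norm (f x - h x))\<^sup>2 \<le> 2 * (norm (f x - g x))\<^sup>2 + 2 * (norm (g x - h x))\<^sup>2" for x
    using norm_diff_power2_le[of "f x - g x" "h x - g x"] by (simp add: norm_minus_commute)
  then have "(LINT x|M. (norm (f x - h x))\<^sup>2) \<le> (LINT x|M. 2 * (norm (f x - g x))\<^sup>2 + 2 * (norm (g x - h x))\<^sup>2)"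
    by (intro integral_mono') (use fg gh in auto)
  then show ?thesis using fg gh by simp
qed

lemma (in finite_measure) square_integral_dominated_limit:
  fixes f :: "'a \<Rightarrow> complex" and g :: "nat \<Rightarrow> 'a \<Rightarrow> complex"
  assumes "f \<in> borel_measurable M" "\<And>n. g n \<in> borel_measurable M"
    and w: "integrable M w" "\<And>n. AE x in M. (norm (f x - g n x))\<^sup>2 \<le> w x"
    and lim: "AE x in M. (\<lambda>n. g n x) \<longlonglongrightarrow> f x" and e: "0 < e"
  shows "\<exists>n. (LINT x|M. (norm (f x - g n x))\<^sup>2) < e"
proof -
  note [measurable] = assms(1,2)
  have "(\<lambda>n. LINT x|M. (norm (f x - g n x))\<^sup>2) \<longlonglongrightarrow> (LINT x|M. 0)"
  proof (rule integral_dominated_convergence[OF _ _ w(1)])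
    show "AE x in M. (\<lambda>n. (norm (f x - g n x))\<^sup>2) \<longlonglongrightarrow> 0"
      using lim
    proof eventually_elim
      case (elim x)
      then have "(\<lambda>n. (norm (f x - g n x))\<^sup>2) \<longlonglongrightarrow> (norm (f x - f x))\<^sup>2" by (intro tendsto_intros)
      then show ?case by simp
    qed
    show "AE x in M. norm ((norm (f x - g n x))\<^sup>2) \<le> w x" for n using w(2)[of n] by simp
  qed measurable
  then have "(\<lambda>n. LINT x|M. (norm (f x - g n x))\<^sup>2) \<longlonglongrightarrow> 0" by simp
  from order_tendstoD(2)[OF this e] show ?thesis
    by (auto simp: eventually_sequentially)
qed

subsection \<open>Completeness of the exponentials on a shell\<close>

abbreviation shell_measure :: "real^'d::finite \<Rightarrow> ('d \<Rightarrow> nat) \<Rightarrow> (real^'d) measure" where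
  "shell_measure a m \<equiv> restrict_space lborel (shell a m)"

lemma finite_measure_shell: "(\<And>i. 0 < a $ i) \<Longrightarrow> finite_measure (shell_measure a m)"
proof (rule finite_measureI)
  assume "\<And>i. 0 < a $ i"
  then show "emeasure (shell_measure a m) (space (shell_measure a m)) \<noteq> \<infinity>"
    using emeasure_shell_finite[of a m] by (simp add: space_restrict_space emeasure_restrict_space)
qed

lemma AE_shell_measure: "(AE x in shell_measure a m. P x) \<longleftrightarrow> (AE x in lborel. x \<in> shell a m \<longrightarrow> P x)"
  by (rule AE_restrict_space_iff) simp

lemma integral_shell_measure:
  fixes f :: "real^'d::finite \<Rightarrow> 'b::{banach,second_countable_topology}"
  shows "(LINT x|shell_measure a m. f x) = (LINT x|lborel. indicator (shell a m) x *\<^sub>R f x)"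
  by (rule integral_restrict_space) simp

lemma integrable_shell_measure:
  fixes f :: "real^'d::finite \<Rightarrow> 'b::{banach,second_countable_topology}"
  shows "integrable (shell_measure a m) f \<longleftrightarrow> integrable lborel (\<lambda>x. indicator (shell a m) x *\<^sub>R f x)"
  by (rule integrable_restrict_space) simp

text \<open>Three approximations in turn: truncation of large values, a continuous function with
  compact support in the open shell, and a trigonometric polynomial uniformly close on the
  shell.\<close>

lemma trig_poly_dense:
  fixes a :: "real^'d::finite"
  assumes a: "\<And>i. 0 < a $ i" and f[measurable]: "f \<in> borel_measurable borel"
    and f2: "integrable (shell_measure a m) (\<lambda>x. (norm (f x))\<^sup>2)" and e: "0 < e"
  shows "\<exists>q. trig_poly a q \<and> (LINT x|shell_measure a m. (norm (f x - q x))\<^sup>2) < e"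
proof -
  let ?M = "shell_measure a m"
  interpret finite_measure ?M by (rule finite_measure_shell[OF a])
  have rm: "g \<in> borel_measurable ?M" if "g \<in> borel_measurable borel" for g :: "real^'d \<Rightarrow> complex"
    using that by (intro measurable_restrict_space1) simp
  define g where "g n x = (if norm (f x) \<le> real n then f x else 0)" for n x
  have [measurable]: "g n \<in> borel_measurable borel" for n unfolding g_def by measurable
  have gB: "norm (g n x) \<le> real n" for n x by (simp add: g_def)
  \<comment> \<open>Two uses of the triangle inequality for squares sum the three errors to 2/16 +
    4/16 + 4/16 of \<open>e\<close>.\<close>
  have e8: "0 < e / 16" using e by simp
  have "\<exists>n. (LINT x|?M. (norm (f x - g n x))\<^sup>2) < e / 16"
  proof (rule square_integral_dominated_limit[OF rm[OF f] rm f2 _ _ e8])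
    show "AE x in ?M. (norm (f x - g n x))\<^sup>2 \<le> (norm (f x))\<^sup>2" for n by (simp add: g_def)
    have "(\<lambda>n. g n x) \<longlonglongrightarrow> f x" for x
    proof (rule tendsto_eventually)
      obtain N :: nat where "norm (f x) \<le> real N" using real_arch_simple by blast
      then show "\<forall>\<^sub>F n in sequentially. g n x = f x"
        unfolding eventually_sequentially by (intro exI[of _ N]) (auto simp: g_def)
    qed
    then show "AE x in ?M. (\<lambda>n. g n x) \<longlonglongrightarrow> f x" by simp
  qed measurable
  then obtain n where n: "(LINT x|?M. (norm (f x - g n x))\<^sup>2) < e / 16" by blast
  obtain \<phi> K where \<phi>: "\<And>k::nat. continuous_on UNIV (\<phi> k)" "\<And>k. compact (K k)" "\<And>k. K k \<subseteq> open_shell a m"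
    "\<And>k x. x \<notin> K k \<Longrightarrow> \<phi> k x = 0" "\<And>k x. norm (\<phi> k x) \<le> real n"
    "AE x in lborel. x \<in> open_shell a m \<longrightarrow> (\<lambda>k. \<phi> k x) \<longlonglongrightarrow> g n x"
    by (rule compact_support_approximation[OF \<open>g n \<in> borel_measurable borel\<close> gB open_open_shell open_shell_neq_UNIV])
      (rule that; assumption)
  have [measurable]: "\<phi> k \<in> borel_measurable borel" for k
    using \<phi>(1) by (rule borel_measurable_continuous_onI)
  have "\<exists>k. (LINT x|?M. (norm (g n x - \<phi> k x))\<^sup>2) < e / 16"
  proof (rule square_integral_dominated_limit[OF rm rm _ _ _ e8])
    show "integrable ?M (\<lambda>x. (2 * real n)\<^sup>2)" by simp
    have "norm (g n x - \<phi> k x) \<le> 2 * real n" for k x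
      using norm_triangle_ineq4[of "g n x" "\<phi> k x"] gB[of n x] \<phi>(5)[of k x] by linarith
    then show "AE x in ?M. (norm (g n x - \<phi> k x))\<^sup>2 \<le> (2 * real n)\<^sup>2" for k
      by (intro AE_I2 power_mono) auto
    show "AE x in ?M. (\<lambda>k. \<phi> k x) \<longlonglongrightarrow> g n x"
      unfolding AE_shell_measure using AE_shell_open_shell[OF a, of m] \<phi>(6) by eventually_elim blast
  qed measurable
  then obtain k where k: "(LINT x|?M. (norm (g n x - \<phi> k x))\<^sup>2) < e / 16" by blast
  define V where "V = measure ?M (space ?M)"
  \<comment> \<open>A uniform error \<eta> costs at most V \<eta>^2 on the shell;
    \<open>V + 1\<close> keeps the denominator positive without information on the volume.\<close>
  define \<eta> where "\<eta> = sqrt (e / (16 * (V + 1)))"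
  have V: "0 \<le> V" by (simp add: V_def)
  then have \<eta>: "0 < \<eta>" using e by (simp add: \<eta>_def)
  obtain q where q: "trig_poly a q" "\<And>x. x \<in> shell a m \<Longrightarrow> norm (\<phi> k x - q x) < \<eta>" "\<And>x. norm (q x) \<le> real n + \<eta>"
    by (rule trig_poly_approximation[OF a \<phi>(1)[where k = k] \<phi>(2)[where k = k] \<phi>(3)[where k = k] \<phi>(4)[where k = k] \<phi>(5)[where k = k] \<eta>]) (assumption, (rule that; assumption))
  note [measurable] = trig_poly_measurable[OF q(1)]
  have "(LINT x|?M. (norm (\<phi> k x - q x))\<^sup>2) \<le> (LINT x|?M. \<eta>\<^sup>2)"
  proof (rule integral_mono')
    fix x assume "x \<in> space ?M"
    then have "x \<in> shell a m" by (simp add: space_restrict_space)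
    from q(2)[OF this] show "(norm (\<phi> k x - q x))\<^sup>2 \<le> \<eta>\<^sup>2" by (intro power_mono) auto
  qed auto
  also have "\<dots> = V * (e / (16 * (V + 1)))" using V e by (simp add: V_def \<eta>_def)
  also have "\<dots> \<le> e / 16"
  proof -
    have "V / (V + 1) \<le> 1" using V by simp
    then have "V / (V + 1) * (e / 16) \<le> 1 * (e / 16)" using e by (intro mult_right_mono) auto
    then show ?thesis by (simp add: field_simps)
  qed
  finally have pq: "(LINT x|?M. (norm (\<phi> k x - q x))\<^sup>2) \<le> e / 16" .
  have i1: "integrable ?M (\<lambda>x. (norm (f x - h x))\<^sup>2)" if "h \<in> borel_measurable borel" "\<And>x. norm (h x) \<le> B" for h B
    by (rule square_integrable_diff_bounded[OF rm[OF f] rm[OF that(1)] f2 that(2)])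
  have i2: "integrable ?M (\<lambda>x. (norm (g n x - h x))\<^sup>2)" if "h \<in> borel_measurable borel" "\<And>x. norm (h x) \<le> B" for h B
  proof (rule square_integrable_diff_bounded[OF rm rm[OF that(1)] _ that(2)])
    show "integrable ?M (\<lambda>x. (norm (g n x))\<^sup>2)"
    proof (rule integrable_const_bound[of _ "(real n)\<^sup>2"])
      show "AE x in ?M. norm ((norm (g n x))\<^sup>2) \<le> (real n)\<^sup>2"
        using gB by (intro AE_I2) (auto intro!: power_mono)
      show "(\<lambda>x. (norm (g n x))\<^sup>2) \<in> borel_measurable ?M"
        by (intro measurable_restrict_space1) simp
    qed
  qed measurable
  have i3: "integrable ?M (\<lambda>x. (norm (\<phi> k x - q x))\<^sup>2)"
  proof (rule square_integrable_diff_bounded[OF rm rm _ q(3)])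
    show "integrable ?M (\<lambda>x. (norm (\<phi> k x))\<^sup>2)"
    proof (rule integrable_const_bound[of _ "(real n)\<^sup>2"])
      show "AE x in ?M. norm ((norm (\<phi> k x))\<^sup>2) \<le> (real n)\<^sup>2"
        using \<phi>(5) by (intro AE_I2) (auto intro!: power_mono)
      show "(\<lambda>x. (norm (\<phi> k x))\<^sup>2) \<in> borel_measurable ?M"
        by (intro measurable_restrict_space1) simp
    qed
  qed measurable
  have "(LINT x|?M. (norm (f x - q x))\<^sup>2) \<le> 2 * (LINT x|?M. (norm (f x - g n x))\<^sup>2) + 2 * (LINT x|?M. (norm (g n x - q x))\<^sup>2)"
    by (rule square_integral_triangle[OF rm rm rm i1[OF _ gB] i2[OF _ q(3)]]) measurable
  moreover have "(LINT x|?M. (norm (g n x - q x))\<^sup>2) \<le> 2 * (LINT x|?M. (norm (g n x - \<phi> k x))\<^sup>2) + 2 * (LINT x|?M. (norm (\<phi> k x - q x))\<^sup>2)"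
    by (rule square_integral_triangle[OF rm rm rm i2[OF _ \<phi>(5)] i3]) measurable
  ultimately have "(LINT x|?M. (norm (f x - q x))\<^sup>2) < e"
    using n k pq e by linarith
  then show ?thesis using q(1) by blast
qed

lemma torus_char_uminus: "torus_char a (- k) \<xi> = cnj (torus_char a k \<xi>)"
  by (simp add: torus_char_def sum_negf cis_cnj)

lemma torus_char_expansion:
  fixes a :: "real^'d::finite"
  assumes a: "\<And>i. 0 < a $ i" and f[measurable]: "f \<in> borel_measurable borel"
    and f2: "integrable (shell_measure a m) (\<lambda>x. (norm (f x))\<^sup>2)"
    and b: "\<And>k. b k = (LINT x|shell_measure a m. f x * cnj (torus_char a k x)) / of_real ((2 * pi) ^ CARD('d) / (\<Prod>i\<in>UNIV. a $ i))"
  shows "((\<lambda>F. LINT x|shell_measure a m. (norm (f x - (\<Sum>k\<in>F. b k * torus_char a k x)))\<^sup>2) \<longlongrightarrow> 0) (finite_subsets_at_top UNIV)"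
proof -
  interpret finite_measure "shell_measure a m" by (rule finite_measure_shell[OF a])
  show ?thesis
  proof (rule orthogonal_expansion[OF _ _ _ _ _ f2 b])
    show "torus_char a k \<in> borel_measurable (shell_measure a m)" for k
      by (intro measurable_restrict_space1) simp
    show "f \<in> borel_measurable (shell_measure a m)"
      by (intro measurable_restrict_space1) simp
    show "norm (torus_char a k x) \<le> 1" for k x by simp
    have "torus_char a k x * cnj (torus_char a m x) = torus_char a (k - m) x" for k m x
      using torus_char_add[of a k "- m" x] by (simp add: torus_char_uminus)
    then show "(LINT x|shell_measure a m. torus_char a k x * cnj (torus_char a l x)) =
       (if k = l then of_real ((2 * pi) ^ CARD('d) / (\<Prod>i\<in>UNIV. a $ i)) else 0)" for k l
      using shell_char_integral[OF a, of m "k - l"] by (simp add: integral_shell_measure)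
    have "(\<Prod>i\<in>UNIV. a $ i) \<noteq> 0" using a by (simp add: less_imp_neq[symmetric])
    then show "complex_of_real ((2 * pi) ^ CARD('d) / (\<Prod>i\<in>UNIV. a $ i)) \<noteq> 0" by simp
    show "\<exists>F c. finite F \<and> (LINT x|shell_measure a m. (norm (f x - (\<Sum>k\<in>F. c k * torus_char a k x)))\<^sup>2) < e" if e: "0 < e" for e
    proof -
      obtain q where q: "trig_poly a q" "(LINT x|shell_measure a m. (norm (f x - q x))\<^sup>2) < e"
        using trig_poly_dense[OF a f f2 e] by blast
      then show ?thesis using trig_poly_expand[OF q(1)] by auto
    qed
  qed
qed

subsection \<open>The packet projections\<close>

text \<open>Shells are bounded, so on one level the weights of all orders are comparable to
  constants, and an L2 expansion there converges in every Sobolev norm.\<close>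

lemma shell_wgt_bound:
  fixes a :: "real^'d::finite"
  assumes a: "\<And>i. 0 < a $ i"
  shows "\<exists>W>0. \<forall>\<xi>\<in>shell a m. wgt s \<xi> \<le> W"
proof -
  obtain R where R: "\<And>\<xi>. \<xi> \<in> shell a m \<Longrightarrow> norm \<xi> \<le> R"
    using bounded_shell[OF a, of m] by (auto simp: bounded_iff)
  have "wgt s \<xi> \<le> (1 + R\<^sup>2) powr (\<bar>s\<bar> / 2)" if "\<xi> \<in> shell a m" for \<xi>
  proof -
    have "wgt s \<xi> \<le> (1 + (norm \<xi>)\<^sup>2) powr (\<bar>s\<bar> / 2)" by (intro powr_mono) auto
    also have "\<dots> \<le> (1 + R\<^sup>2) powr (\<bar>s\<bar> / 2)"
      using R[OF that] by (intro powr_mono2 add_left_mono power_mono) auto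
    finally show ?thesis .
  qed
  moreover have "0 < (1 + R\<^sup>2) powr (\<bar>s\<bar> / 2)"
    by (rule powr_gt_zero[THEN iffD2]) (smt (verit) zero_le_power2)
  ultimately show ?thesis by blast
qed

lemma norm_packet_hat_le: "norm (packet_hat l k \<xi>) \<le> lev_norm l"
  using norm_lev_phase_le[of l \<xi>] lev_norm_pos[of l] by (simp add: packet_hat_eq norm_mult mult_left_le)

lemma packet_hat_eq_0: "\<xi> \<notin> lev_shell l \<Longrightarrow> packet_hat l k \<xi> = 0"
  using lev_phase_support by (auto simp: packet_hat_eq)

lemma AE_lev_shell: "AE \<xi> in lborel. \<xi> \<in> lev_shell l \<longleftrightarrow> \<xi> \<in> lev_open_shell l"
  by (rule AE_shell_open_shell) (rule lev_scale_pos)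

lemma finite_measure_lev_shell: "finite_measure (shell_measure (lev_scale l) (lev_freq l))"
  by (rule finite_measure_shell) (rule lev_scale_pos)

lemma torus_char_reflect: "torus_char a k (- \<xi>) = cnj (torus_char a k \<xi>)"
  by (simp add: torus_char_def sum_negf cis_cnj)

lemma packet_hat_reflect: "AE \<xi> in lborel. packet_hat l k (- \<xi>) = cnj (packet_hat l k \<xi>)"
  using AE_lev_shell[of l]
proof eventually_elim
  fix \<xi> assume *: "\<xi> \<in> lev_shell l \<longleftrightarrow> \<xi> \<in> lev_open_shell l"
  show "packet_hat l k (- \<xi>) = cnj (packet_hat l k \<xi>)"
  proof (cases "\<xi> \<in> lev_shell l")
    case True
    then show ?thesis using * lev_phase_interior(2)[of \<xi> l] by (simp add: packet_hat_eq torus_char_reflect)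
  next
    case False
    then show ?thesis using packet_hat_eq_0[of \<xi> l k] packet_hat_eq_0[of "- \<xi>" l k] by (simp add: shell_uminus)
  qed
qed

lemma sobolev_fun_packet_hat: "sobolev_fun s (packet_hat l k)"
  unfolding sobolev_fun_def
proof (intro conjI packet_hat_reflect measurable_packet_hat)
  obtain W where W: "0 < W" "\<And>\<xi>. \<xi> \<in> lev_shell l \<Longrightarrow> wgt s \<xi> \<le> W"
    using shell_wgt_bound[of "lev_scale l" "lev_freq l" s] lev_scale_pos by blast
  interpret finite_measure "shell_measure (lev_scale l) (lev_freq l)" by (rule finite_measure_lev_shell)
  have "integrable (shell_measure (lev_scale l) (lev_freq l)) (\<lambda>_. (W * lev_norm l)\<^sup>2)" by simp
  then have i: "integrable lborel (\<lambda>\<xi>. indicator (lev_shell l) \<xi> *\<^sub>R (W * lev_norm l)\<^sup>2)"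
    by (simp only: integrable_shell_measure)
  show "integrable lborel (\<lambda>\<xi>. (wgt s \<xi> * cmod (packet_hat l k \<xi>))\<^sup>2)"
  proof (rule Bochner_Integration.integrable_bound[OF i])
    have "norm ((wgt s \<xi> * cmod (packet_hat l k \<xi>))\<^sup>2) \<le> norm (indicator (lev_shell l) \<xi> *\<^sub>R (W * lev_norm l)\<^sup>2)" for \<xi>
    proof (cases "\<xi> \<in> lev_shell l")
      case True
      then have "wgt s \<xi> * cmod (packet_hat l k \<xi>) \<le> W * lev_norm l"
        using W norm_packet_hat_le by (intro mult_mono) auto
      then show ?thesis using True by (simp add: power_mono)
    qed (simp add: packet_hat_eq_0)
    then show "AE \<xi> in lborel. norm ((wgt s \<xi> * cmod (packet_hat l k \<xi>))\<^sup>2) \<le> norm (indicator (lev_shell l) \<xi> *\<^sub>R (W * lev_norm l)\<^sup>2)"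
      by blast
  qed measurable
qed

lemma has_fourier_packet: "has_fourier (packet l k) (packet_hat l k)"
proof -
  obtain T where T: "has_fourier T (packet_hat l k)"
    using sobolev_fun_has_fourier[OF sobolev_fun_packet_hat] by blast
  show ?thesis
    unfolding packet_def
  proof (rule theI)
    fix S assume "has_fourier S (packet_hat l k)"
    then show "S = T" by (rule has_fourier_inject[OF _ T]) simp
  qed (rule T)
qed

lemma square_integrable_lev_shell:
  assumes [measurable]: "g \<in> borel_measurable borel"
    and g: "integrable lborel (\<lambda>\<xi>. (wgt s \<xi> * cmod (g \<xi>))\<^sup>2)"
  shows "integrable (shell_measure (lev_scale l) (lev_freq l)) (\<lambda>\<xi>. (cmod (g \<xi>))\<^sup>2)"
proof -
  obtain W where W: "0 < W" "\<And>\<xi>. \<xi> \<in> lev_shell l \<Longrightarrow> wgt (- s) \<xi> \<le> W"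
    using shell_wgt_bound[of "lev_scale l" "lev_freq l" "- s"] lev_scale_pos by blast
  have "norm (indicator (lev_shell l) \<xi> *\<^sub>R (cmod (g \<xi>))\<^sup>2) \<le> norm (W\<^sup>2 * (wgt s \<xi> * cmod (g \<xi>))\<^sup>2)" for \<xi>
  proof (cases "\<xi> \<in> lev_shell l")
    case True
    have "1 \<le> W * wgt s \<xi>"
      using W(2)[OF True] wgt_pos[of \<xi> s] unfolding wgt_minus by (simp add: pos_divide_le_eq)
    then have "1 * cmod (g \<xi>) \<le> W * wgt s \<xi> * cmod (g \<xi>)" by (intro mult_right_mono) auto
    then have "(cmod (g \<xi>))\<^sup>2 \<le> (W * wgt s \<xi> * cmod (g \<xi>))\<^sup>2" by (intro power_mono) auto
    then show ?thesis using True by (simp add: power_mult_distrib)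
  qed simp
  then show ?thesis
    unfolding integrable_shell_measure
    by (intro Bochner_Integration.integrable_bound[OF integrable_mult_right[OF g, of "W\<^sup>2"]] AE_I2) auto
qed

text \<open>\<open>ft v\<close> and the packet are both Hermitian, so reflection conjugates the
  integrand and the integral is real.\<close>

lemma packet_coeff_complex:
  fixes v :: "'d::finite tempered"
  assumes "v \<in> sobolev s"
  shows "of_real (packet_coeff l k v) = (LINT \<xi>|lborel. ft v \<xi> * cnj (packet_hat l k \<xi>)) / (2 * pi) ^ CARD('d)"
proof -
  let ?z = "LINT \<xi>|lborel. ft v \<xi> * cnj (packet_hat l k \<xi>)"
  have g: "sobolev_fun s (ft v)" by (rule sobolev_ft[OF assms])
  then have [measurable]: "ft v \<in> borel_measurable borel" and sym: "AE \<xi> in lborel. ft v (- \<xi>) = cnj (ft v \<xi>)"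
    by (auto simp: sobolev_fun_def)
  have "cnj ?z = (LINT \<xi>|lborel. cnj (ft v \<xi>) * packet_hat l k \<xi>)"
    by (subst Bochner_Integration.integral_cnj[symmetric]) simp
  also have "\<dots> = (LINT \<xi>|lborel. ft v (- \<xi>) * cnj (packet_hat l k (- \<xi>)))"
  proof (rule integral_cong_AE)
    show "AE \<xi> in lborel. cnj (ft v \<xi>) * packet_hat l k \<xi> = ft v (- \<xi>) * cnj (packet_hat l k (- \<xi>))"
      using sym packet_hat_reflect[of l k] by eventually_elim simp
  qed measurable
  also have "\<dots> = ?z"
    by (rule lborel_integral_reflect[where f = "\<lambda>\<xi>. ft v \<xi> * cnj (packet_hat l k \<xi>)"]) measurable
  finally have "cnj ?z = ?z" .
  then have z: "of_real (Re ?z) = ?z" by (metis Reals_cnj_iff of_real_Re)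
  have "packet_coeff l k v = Re ?z / (2 * pi) ^ CARD('d)"
    unfolding packet_coeff_def by (rule Re_divide_of_real)
  then have "complex_of_real (packet_coeff l k v) = complex_of_real (Re ?z) / complex_of_real ((2 * pi) ^ CARD('d))"
    by (simp only: of_real_divide)
  then show ?thesis unfolding z .
qed

text \<open>Dividing by the unimodular phase turns the claim into the exponential expansion of
  \<open>f\<close>. On the boundary of the shell the phase may fail to be unimodular, but that is a
  null set.\<close>

lemma packet_expansion:
  fixes v :: "'d::finite tempered"
  assumes v: "v \<in> sobolev s"
  shows "((\<lambda>F. LINT \<xi>|shell_measure (lev_scale l) (lev_freq l).
     (cmod (ft v \<xi> - (\<Sum>k\<in>F. of_real (packet_coeff l k v) * packet_hat l k \<xi>)))\<^sup>2) \<longlongrightarrow> 0) (finite_subsets_at_top UNIV)"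
proof -
  let ?M = "shell_measure (lev_scale l) (lev_freq l)"
  let ?a = "lev_scale l"
  have g: "sobolev_fun s (ft v)" by (rule sobolev_ft[OF v])
  then have gm[measurable]: "ft v \<in> borel_measurable borel" by (simp add: sobolev_fun_def)
  have g2: "integrable ?M (\<lambda>\<xi>. (cmod (ft v \<xi>))\<^sup>2)"
    by (rule square_integrable_lev_shell[OF gm, where s = s]) (use g in \<open>simp add: sobolev_fun_def\<close>)
  define f where "f \<xi> = ft v \<xi> * cnj (lev_phase l \<xi>)" for \<xi>
  have fm[measurable]: "f \<in> borel_measurable borel" unfolding f_def by measurable
  have rm: "h \<in> borel_measurable ?M" if "h \<in> borel_measurable borel" for h :: "real^'d \<Rightarrow> 'b::topological_space"
    using that by (intro measurable_restrict_space1) simp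
  have f2: "integrable ?M (\<lambda>\<xi>. (cmod (f \<xi>))\<^sup>2)"
  proof (rule Bochner_Integration.integrable_bound[OF g2])
    show "AE \<xi> in ?M. norm ((cmod (f \<xi>))\<^sup>2) \<le> norm ((cmod (ft v \<xi>))\<^sup>2)"
      by (intro AE_I2) (simp add: f_def norm_mult power_mono mult_left_le norm_lev_phase_le)
  qed (intro rm; measurable)
  define V where "V = complex_of_real ((2 * pi) ^ CARD('d) / (\<Prod>i\<in>UNIV. ?a $ i))"
  define b where "b k = (LINT \<xi>|?M. f \<xi> * cnj (torus_char ?a k \<xi>)) / V" for k
  have lim: "((\<lambda>F. LINT \<xi>|?M. (norm (f \<xi> - (\<Sum>k\<in>F. b k * torus_char ?a k \<xi>)))\<^sup>2) \<longlongrightarrow> 0) (finite_subsets_at_top UNIV)"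
    by (rule torus_char_expansion[OF lev_scale_pos fm f2]) (simp add: b_def V_def)
  \<comment> \<open>One factor \<open>lev_norm l\<close> sits in the coefficient and one in the
    packet; their product over (2 pi)^d is 1 / V by \<open>lev_norm_power2\<close>.\<close>
  have b: "b k = of_real (lev_norm l) * of_real (packet_coeff l k v)" for k
  proof -
    have "(LINT \<xi>|lborel. ft v \<xi> * cnj (packet_hat l k \<xi>)) = (LINT \<xi>|lborel. indicator (lev_shell l) \<xi> *\<^sub>R (of_real (lev_norm l) * (f \<xi> * cnj (torus_char ?a k \<xi>))))"
    proof (intro Bochner_Integration.integral_cong refl)
      fix \<xi>
      show "ft v \<xi> * cnj (packet_hat l k \<xi>) = indicator (lev_shell l) \<xi> *\<^sub>R (of_real (lev_norm l) * (f \<xi> * cnj (torus_char ?a k \<xi>)))"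
      proof (cases "\<xi> \<in> lev_shell l")
        case True
        then show ?thesis by (simp add: packet_hat_eq f_def)
      next
        case False
        then show ?thesis by (simp add: packet_hat_eq_0)
      qed
    qed
    also have "\<dots> = of_real (lev_norm l) * (LINT \<xi>|?M. f \<xi> * cnj (torus_char ?a k \<xi>))"
      unfolding integral_shell_measure[symmetric] by simp
    finally have "of_real (lev_norm l) * of_real (packet_coeff l k v) =
       of_real ((lev_norm l)\<^sup>2) * (LINT \<xi>|?M. f \<xi> * cnj (torus_char ?a k \<xi>)) / (2 * pi) ^ CARD('d)"
      unfolding packet_coeff_complex[OF v] by (simp add: power2_eq_square)
    then show ?thesis
      unfolding b_def V_def lev_norm_power2 by simp
  qed
  have "(LINT \<xi>|?M. (cmod (ft v \<xi> - (\<Sum>k\<in>F. of_real (packet_coeff l k v) * packet_hat l k \<xi>)))\<^sup>2) =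
     (LINT \<xi>|?M. (norm (f \<xi> - (\<Sum>k\<in>F. b k * torus_char ?a k \<xi>)))\<^sup>2)" for F
  proof (rule integral_cong_AE)
    show "AE \<xi> in ?M. (cmod (ft v \<xi> - (\<Sum>k\<in>F. of_real (packet_coeff l k v) * packet_hat l k \<xi>)))\<^sup>2 =
       (norm (f \<xi> - (\<Sum>k\<in>F. b k * torus_char ?a k \<xi>)))\<^sup>2"
      unfolding AE_shell_measure using AE_lev_shell[of l]
    proof eventually_elim
      fix \<xi> assume "\<xi> \<in> lev_shell l \<longleftrightarrow> \<xi> \<in> lev_open_shell l"
      moreover {
        assume "\<xi> \<in> lev_open_shell l"
        then have P: "norm (lev_phase l \<xi>) = 1" by (rule lev_phase_interior)
        then have "lev_phase l \<xi> * cnj (lev_phase l \<xi>) = 1" by (simp add: complex_norm_square[symmetric])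
        then have "ft v \<xi> = lev_phase l \<xi> * f \<xi>" by (simp add: f_def mult.left_commute)
        then have "ft v \<xi> - (\<Sum>k\<in>F. of_real (packet_coeff l k v) * packet_hat l k \<xi>) =
           lev_phase l \<xi> * (f \<xi> - (\<Sum>k\<in>F. b k * torus_char ?a k \<xi>))"
          by (simp add: packet_hat_eq b right_diff_distrib sum_distrib_left mult_ac)
        then have "cmod (ft v \<xi> - (\<Sum>k\<in>F. of_real (packet_coeff l k v) * packet_hat l k \<xi>)) =
           norm (f \<xi> - (\<Sum>k\<in>F. b k * torus_char ?a k \<xi>))"
          using P by (simp add: norm_mult)
      }
      ultimately show "\<xi> \<in> lev_shell l \<longrightarrow> (cmod (ft v \<xi> - (\<Sum>k\<in>F. of_real (packet_coeff l k v) * packet_hat l k \<xi>)))\<^sup>2 =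
       (norm (f \<xi> - (\<Sum>k\<in>F. b k * torus_char ?a k \<xi>)))\<^sup>2" by simp
    qed
  qed (intro rm; measurable)+
  with lim show ?thesis by simp
qed

text \<open>On a bounded shell the weights of two orders are comparable, which allows the change
  from \<open>s\<close> to \<open>s'\<close>. The shell is invariant under reflection, so Hermitian
  symmetry survives.\<close>

lemma sobolev_vfun_restrict_lev_shell:
  assumes g: "sobolev_vfun s g"
  shows "sobolev_vfun s' (\<lambda>\<xi>. indicator (lev_shell l) \<xi> *\<^sub>R g \<xi>)"
  unfolding sobolev_vfun_iff
proof (intro conjI)
  note [measurable] = sobolev_vfun_measurable[OF g]
  show "(\<lambda>\<xi>. indicator (lev_shell l) \<xi> *\<^sub>R g \<xi>) \<in> borel_measurable borel" by measurable
  obtain W where W: "0 < W" "\<And>\<xi>. \<xi> \<in> lev_shell l \<Longrightarrow> wgt (s' - s) \<xi> \<le> W"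
    using shell_wgt_bound[of "lev_scale l" "lev_freq l" "s' - s"] lev_scale_pos by blast
  have gi: "integrable lborel (\<lambda>\<xi>. (wgt s \<xi> * norm (g \<xi>))\<^sup>2)" using g by (simp add: sobolev_vfun_iff)
  show "integrable lborel (\<lambda>\<xi>. (wgt s' \<xi> * norm (indicator (lev_shell l) \<xi> *\<^sub>R g \<xi>))\<^sup>2)"
  proof (rule Bochner_Integration.integrable_bound[OF integrable_mult_right[OF gi, of "W\<^sup>2"]])
    have "norm ((wgt s' \<xi> * norm (indicator (lev_shell l) \<xi> *\<^sub>R g \<xi>))\<^sup>2) \<le> norm (W\<^sup>2 * (wgt s \<xi> * norm (g \<xi>))\<^sup>2)" for \<xi>
    proof (cases "\<xi> \<in> lev_shell l")
      case True
      have "wgt s' \<xi> = wgt (s' - s) \<xi> * wgt s \<xi>"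
        by (simp add: powr_add[symmetric] diff_divide_distrib)
      also have "\<dots> \<le> W * wgt s \<xi>" using W(2)[OF True] by (intro mult_right_mono) auto
      finally have "wgt s' \<xi> * norm (g \<xi>) \<le> W * wgt s \<xi> * norm (g \<xi>)" by (intro mult_right_mono) auto
      then have "(wgt s' \<xi> * norm (g \<xi>))\<^sup>2 \<le> (W * wgt s \<xi> * norm (g \<xi>))\<^sup>2" by (intro power_mono) auto
      then show ?thesis using True by (simp add: power_mult_distrib)
    qed simp
    then show "AE \<xi> in lborel. norm ((wgt s' \<xi> * norm (indicator (lev_shell l) \<xi> *\<^sub>R g \<xi>))\<^sup>2) \<le> norm (W\<^sup>2 * (wgt s \<xi> * norm (g \<xi>))\<^sup>2)"
      by blast
  qed measurable
  have "AE \<xi> in lborel. \<forall>i. g (- \<xi>) $ i = cnj (g \<xi> $ i)" using g by (simp add: sobolev_vfun_iff)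
  then show "AE \<xi> in lborel. \<forall>i. (indicator (lev_shell l) (- \<xi>) *\<^sub>R g (- \<xi>)) $ i = cnj ((indicator (lev_shell l) \<xi> *\<^sub>R g \<xi>) $ i)"
    by eventually_elim (auto simp: indicator_def shell_uminus)
qed

text \<open>On the shell the weight is at most \<open>W\<close>, so the Sobolev error of a partial
  sum is dominated by the L2 errors of its components, to which \<open>packet_expansion\<close>
  applies; off the shell both functions vanish.\<close>

lemma packet_sum_has_sum:
  fixes v :: "'d::finite tempered ^ 'n::finite"
  assumes v: "v \<in> sobolev_vec s"
    and w: "has_fourier_vec w (\<lambda>\<xi>. indicator (lev_shell l) \<xi> *\<^sub>R ft_vec v \<xi>)"
  shows "sobolev_has_sum s (\<lambda>k. \<chi> i. packet_coeff l k (v $ i) *\<^sub>R packet l k) UNIV w"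
proof -
  let ?M = "shell_measure (lev_scale l) (lev_freq l)"
  let ?g = "\<lambda>k \<xi>. \<chi> i. of_real (packet_coeff l k (v $ i)) * packet_hat l k \<xi>"
  let ?r = "\<lambda>F i \<xi>. ft (v $ i) \<xi> - (\<Sum>k\<in>F. of_real (packet_coeff l k (v $ i)) * packet_hat l k \<xi>)"
  have vi: "v $ i \<in> sobolev s" for i using v by (simp add: sobolev_vec_def)
  have gs: "sobolev_fun s (ft (v $ i))" for i by (rule sobolev_ft[OF vi])
  interpret finite_measure ?M by (rule finite_measure_lev_shell)
  have rm: "h \<in> borel_measurable ?M" if "h \<in> borel_measurable borel" for h :: "real^'d \<Rightarrow> complex"
    using that by (intro measurable_restrict_space1) simp
  have [measurable]: "ft (v $ i) \<in> borel_measurable borel" for i using gs by (simp add: sobolev_fun_def)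
  have ri: "integrable ?M (\<lambda>\<xi>. (cmod (?r F i \<xi>))\<^sup>2)" for F i
  proof (rule square_integrable_diff_bounded)
    show "integrable ?M (\<lambda>\<xi>. (cmod (ft (v $ i) \<xi>))\<^sup>2)"
      by (rule square_integrable_lev_shell[where s = s]) (use gs in \<open>auto simp: sobolev_fun_def\<close>)
    show "norm (\<Sum>k\<in>F. of_real (packet_coeff l k (v $ i)) * packet_hat l k \<xi>) \<le> (\<Sum>k\<in>F. \<bar>packet_coeff l k (v $ i)\<bar> * lev_norm l)" for \<xi>
      by (intro sum_norm_le) (simp add: norm_mult mult_left_mono norm_packet_hat_le)
  qed (intro rm; measurable)+
  obtain W where W: "0 < W" "\<And>\<xi>. \<xi> \<in> lev_shell l \<Longrightarrow> wgt s \<xi> \<le> W"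
    using shell_wgt_bound[of "lev_scale l" "lev_freq l" s] lev_scale_pos by blast
  show ?thesis
  proof (rule sobolev_has_sumI[where g = ?g, OF _ _ w])
    show "has_fourier_vec (\<chi> i. packet_coeff l k (v $ i) *\<^sub>R packet l k) (?g k)" for k
      by (simp add: has_fourier_vec_def has_fourier_scaleR has_fourier_packet)
    show "sobolev_vfun s (?g k)" for k
      unfolding sobolev_vfun_def
    proof
      fix i
      have "sobolev_vfun s (\<lambda>\<xi>. \<chi> j::'n. packet_hat l k \<xi>)"
        by (simp add: sobolev_vfun_def sobolev_fun_packet_hat)
      from sobolev_vfun_lincomb[OF this this, of "packet_coeff l k (v $ i)" 0]
      show "sobolev_fun s (\<lambda>\<xi>. ?g k \<xi> $ i)"
        by (simp add: sobolev_vfun_def scaleR_conv_of_real[where 'a = complex])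
    qed
    show "sobolev_vfun s (\<lambda>\<xi>. indicator (lev_shell l) \<xi> *\<^sub>R ft_vec v \<xi>)"
      by (rule sobolev_vfun_restrict_lev_shell[OF sobolev_vec_ft(2)[OF v]])
    have le: "sobolev_mass s (\<lambda>\<xi>. indicator (lev_shell l) \<xi> *\<^sub>R ft_vec v \<xi> - (\<Sum>k\<in>F. ?g k \<xi>)) \<le>
       W\<^sup>2 * (\<Sum>i\<in>UNIV. LINT \<xi>|?M. (cmod (?r F i \<xi>))\<^sup>2)" for F
    proof -
      have i: "integrable lborel (\<lambda>\<xi>. \<Sum>i\<in>UNIV. indicator (lev_shell l) \<xi> *\<^sub>R (cmod (?r F i \<xi>))\<^sup>2)"
        using ri unfolding integrable_shell_measure by (intro Bochner_Integration.integrable_sum)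
      have "sobolev_mass s (\<lambda>\<xi>. indicator (lev_shell l) \<xi> *\<^sub>R ft_vec v \<xi> - (\<Sum>k\<in>F. ?g k \<xi>)) \<le>
        (LINT \<xi>|lborel. W\<^sup>2 * (\<Sum>i\<in>UNIV. indicator (lev_shell l) \<xi> *\<^sub>R (cmod (?r F i \<xi>))\<^sup>2))"
        unfolding sobolev_mass_def
      proof (rule integral_mono')
        show "integrable lborel (\<lambda>\<xi>. W\<^sup>2 * (\<Sum>i\<in>UNIV. indicator (lev_shell l) \<xi> *\<^sub>R (cmod (?r F i \<xi>))\<^sup>2))"
          by (intro integrable_mult_right i)
        fix \<xi>
        show "(wgt s \<xi> * norm (indicator (lev_shell l) \<xi> *\<^sub>R ft_vec v \<xi> - (\<Sum>k\<in>F. ?g k \<xi>)))\<^sup>2 \<le>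
           W\<^sup>2 * (\<Sum>i\<in>UNIV. indicator (lev_shell l) \<xi> *\<^sub>R (cmod (?r F i \<xi>))\<^sup>2)"
        proof (cases "\<xi> \<in> lev_shell l")
          case True
          have "(wgt s \<xi> * norm (ft_vec v \<xi> - (\<Sum>k\<in>F. ?g k \<xi>)))\<^sup>2 = (wgt s \<xi>)\<^sup>2 * (\<Sum>i\<in>UNIV. (cmod (?r F i \<xi>))\<^sup>2)"
            by (simp add: power_mult_distrib norm_vec_power2 ft_vec_def)
          also have "\<dots> \<le> W\<^sup>2 * (\<Sum>i\<in>UNIV. (cmod (?r F i \<xi>))\<^sup>2)"
            using W(2)[OF True] by (intro mult_right_mono power_mono sum_nonneg) auto
          finally show ?thesis using True by simp
        next
          case False
          then have "(\<Sum>k\<in>F. ?g k \<xi>) = 0" by (simp add: packet_hat_eq_0 vec_eq_iff)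
          then show ?thesis using False by simp
        qed
      qed (auto intro!: mult_nonneg_nonneg sum_nonneg)
      also have "\<dots> = W\<^sup>2 * (\<Sum>i\<in>UNIV. LINT \<xi>|?M. (cmod (?r F i \<xi>))\<^sup>2)"
      proof -
        have "(LINT \<xi>|lborel. (\<Sum>i\<in>UNIV. indicator (lev_shell l) \<xi> *\<^sub>R (cmod (?r F i \<xi>))\<^sup>2)) =
            (\<Sum>i\<in>UNIV. LINT \<xi>|lborel. indicator (lev_shell l) \<xi> *\<^sub>R (cmod (?r F i \<xi>))\<^sup>2)"
          by (rule Bochner_Integration.integral_sum) (rule ri[unfolded integrable_shell_measure])
        then show ?thesis by (simp only: integral_mult_right_zero integral_shell_measure)
      qed
      finally show ?thesis .
    qed
    have "((\<lambda>F. W\<^sup>2 * (\<Sum>i\<in>UNIV. LINT \<xi>|?M. (cmod (?r F i \<xi>))\<^sup>2)) \<longlongrightarrow> W\<^sup>2 * (\<Sum>i\<in>(UNIV::'n set). 0)) (finite_subsets_at_top UNIV)"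
      by (intro tendsto_intros packet_expansion[OF vi])
    then have "((\<lambda>F. W\<^sup>2 * (\<Sum>i\<in>UNIV. LINT \<xi>|?M. (cmod (?r F i \<xi>))\<^sup>2)) \<longlongrightarrow> 0) (finite_subsets_at_top UNIV)"
      by simp
    then show "((\<lambda>F. sobolev_mass s (\<lambda>\<xi>. indicator (lev_shell l) \<xi> *\<^sub>R ft_vec v \<xi> - (\<Sum>k\<in>F. ?g k \<xi>))) \<longlongrightarrow> 0) (finite_subsets_at_top UNIV)"
      by (rule Lim_null_comparison[rotated]) (simp add: always_eventually abs_of_nonneg[OF sobolev_mass_nonneg] le)
  qed
qed

text \<open>The form in which the projector enters the iteration: a cut-off on the Fourier side.
  Uniqueness of sums evaluates the definite description.\<close>

lemma packet_proj_fourier: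
  fixes v :: "'d::finite tempered ^ 'n::finite"
  assumes v: "v \<in> sobolev_vec s"
  shows "has_fourier_vec (packet_proj s l v) (\<lambda>\<xi>. indicator (lev_shell l) \<xi> *\<^sub>R ft_vec v \<xi>)"
proof -
  obtain w where w: "has_fourier_vec w (\<lambda>\<xi>. indicator (lev_shell l) \<xi> *\<^sub>R ft_vec v \<xi>)"
    using sobolev_vfun_has_fourier[OF sobolev_vfun_restrict_lev_shell[OF sobolev_vec_ft(2)[OF v]]] by blast
  have "packet_proj s l v = w"
    unfolding packet_proj_def
  proof (rule the_equality)
    fix w' assume "sobolev_has_sum s (\<lambda>k. \<chi> i. packet_coeff l k (v $ i) *\<^sub>R packet l k) UNIV w'"
    then show "w' = w" by (rule sobolev_has_sum_unique[OF _ packet_sum_has_sum[OF v w]])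
  qed (rule packet_sum_has_sum[OF v w])
  then show ?thesis using w by simp
qed

section \<open>Matrices\<close>

lemma norm_matrix_le_sum:
  fixes A :: "'a::real_normed_vector^'n::finite^'m::finite"
  shows "norm A \<le> (\<Sum>i\<in>UNIV. \<Sum>j\<in>UNIV. norm (A $ i $ j))"
proof -
  have "norm A \<le> (\<Sum>i\<in>UNIV. norm (A $ i))"
    unfolding norm_vec_def[of A] by (rule L2_set_le_sum) simp
  also have "\<dots> \<le> (\<Sum>i\<in>UNIV. \<Sum>j\<in>UNIV. norm (A $ i $ j))"
    by (intro sum_mono) (simp add: norm_vec_def[of "A $ _"] L2_set_le_sum)
  finally show ?thesis .
qed

lemma norm_entry_le: "norm (A $ i $ j) \<le> norm (A :: 'a::real_normed_vector^'n::finite^'m::finite)"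
  by (rule order_trans[OF Finite_Cartesian_Product.norm_nth_le Finite_Cartesian_Product.norm_nth_le])

lemma norm_matrix_vector_le:
  fixes A :: "complex^'n::finite^'m::finite"
  assumes "\<And>i j. norm (A $ i $ j) \<le> c"
  shows "norm (A *v x) \<le> real CARD('m) * real CARD('n) * c * norm x"
proof -
  have "norm (A *v x) \<le> (\<Sum>i\<in>UNIV. norm ((A *v x) $ i))"
    unfolding norm_vec_def[of "A *v x"] by (rule L2_set_le_sum) simp
  also have "\<dots> \<le> (\<Sum>i\<in>(UNIV::'m set). \<Sum>j\<in>(UNIV::'n set). c * norm x)"
  proof (intro sum_mono)
    fix i
    have "norm ((A *v x) $ i) \<le> (\<Sum>j\<in>UNIV. norm (A $ i $ j * x $ j))"
      unfolding matrix_vector_mult_def by (simp add: norm_sum)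
    also have "\<dots> \<le> (\<Sum>j\<in>(UNIV::'n set). c * norm x)"
      unfolding norm_mult
      by (intro sum_mono mult_mono assms Finite_Cartesian_Product.norm_nth_le order_trans[OF norm_ge_zero assms]) auto
    finally show "norm ((A *v x) $ i) \<le> (\<Sum>j\<in>(UNIV::'n set). c * norm x)" .
  qed
  also have "\<dots> = real CARD('m) * real CARD('n) * c * norm x" by simp
  finally show ?thesis .
qed

abbreviation cmat :: "real^'n^'m \<Rightarrow> complex^'n^'m" where
  "cmat \<equiv> map_matrix complex_of_real"

lemma cmat_nth [simp]: "cmat A $ i $ j = of_real (A $ i $ j)"
  by (simp add: map_matrix_def)

lemma cmat_mult: "cmat (A ** B) = cmat A ** cmat B"
  by (simp add: vec_eq_iff matrix_matrix_mult_def)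

lemma cmat_one: "cmat (mat 1) = mat 1"
  by (simp add: vec_eq_iff mat_def)

lemma pseudo_inverse_eq:
  assumes "B ** X = mat 1" "X ** B = mat 1"
  shows "pseudo_inverse B = X"
  unfolding pseudo_inverse_def
proof (rule the_equality)
  show "B ** X ** B = B \<and> X ** B ** X = X \<and> transpose (B ** X) = B ** X \<and> transpose (X ** B) = X ** B"
    by (simp add: assms transpose_mat)
  fix Y assume Y: "B ** Y ** B = B \<and> Y ** B ** Y = Y \<and> transpose (B ** Y) = B ** Y \<and> transpose (Y ** B) = Y ** B"
  have "Y = (X ** B) ** Y ** (B ** X)" by (simp add: assms)
  also have "\<dots> = X ** (B ** Y ** B) ** X" by (simp only: matrix_mul_assoc)
  also have "\<dots> = X" using Y by (simp add: assms)
  finally show "Y = X" .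
qed

lemma continuous_on_det: "continuous_on S (det :: real^'n^'n::finite \<Rightarrow> real)"
  unfolding det_def[abs_def] by (intro continuous_intros)

text \<open>The determinant is a polynomial in \<open>s\<close>, and nonzero: otherwise the matrices
  I + N / s, which tend to I, would all be singular. Its finitely many roots leave room in every
  interval. This puts a nonsingular matrix into the cube around \<open>N\<close>, so that the
  maximum of |det| is positive.\<close>

lemma nonsingular_shift:
  fixes N :: "real^'n^'n::finite"
  assumes "0 < \<rho>"
  shows "\<exists>s. 0 < s \<and> s < \<rho> \<and> det (N + s *\<^sub>R mat 1) \<noteq> 0"
proof -
  define P :: "real poly" where
    "P = (\<Sum>p | p permutes (UNIV :: 'n set). [:of_int (sign p):] * (\<Prod>i\<in>UNIV. [:N $ i $ p i, mat 1 $ i $ p i:]))"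
  have P: "poly P s = det (N + s *\<^sub>R mat 1)" for s
    unfolding P_def det_def poly_sum poly_mult poly_prod by simp
  have "P \<noteq> 0"
  proof
    assume "P = 0"
    then have z: "det (N + s *\<^sub>R mat 1) = 0" for s using P[of s] by simp
    have "det (mat 1 + (1 / (real n + 1)) *\<^sub>R N) = 0" for n
    proof -
      have "mat 1 + (1 / (real n + 1)) *\<^sub>R N = (1 / (real n + 1)) *\<^sub>R (N + (real n + 1) *\<^sub>R mat 1)"
        by (simp add: scaleR_add_right)
      moreover have "det (c *\<^sub>R A) = c ^ CARD('n) * det A" for c and A :: "real^'n^'n"
      proof -
        have "c *\<^sub>R A = (\<chi> i. c *s A $ i)" by (simp add: vec_eq_iff)
        then show ?thesis using det_rows_mul[of "\<lambda>_. c" "\<lambda>i. A $ i"] by simp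
      qed
      ultimately show ?thesis using z by simp
    qed
    moreover have "(\<lambda>n. det (mat 1 + (1 / (real n + 1)) *\<^sub>R N)) \<longlonglongrightarrow> det (mat 1 + 0 *\<^sub>R N)"
    proof (rule continuous_on_tendsto_compose[OF continuous_on_det[of UNIV]])
      have "(\<lambda>n. 1 / (real n + 1)) \<longlonglongrightarrow> 0"
        using LIMSEQ_inverse_real_of_nat by (simp add: inverse_eq_divide add.commute)
      then show "(\<lambda>n. mat 1 + (1 / (real n + 1)) *\<^sub>R N) \<longlonglongrightarrow> mat 1 + 0 *\<^sub>R N" by (intro tendsto_intros)
    qed auto
    ultimately have "(\<lambda>n::nat. 0::real) \<longlonglongrightarrow> 1" by simp
    then show False by (simp add: LIMSEQ_const_iff)
  qed
  then have "finite {s. poly P s = 0}" by (rule poly_roots_finite)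
  moreover have "infinite {0<..<\<rho>}" using assms by (simp add: infinite_Ioo)
  ultimately have "\<not> {0<..<\<rho>} \<subseteq> {s. poly P s = 0}" using finite_subset by blast
  then show ?thesis using P by auto
qed

text \<open>A maximiser \<open>B\<close> of \<open>\<bar>det\<bar>\<close> on a cube: as \<open>det\<close> is affine in every entry with slope
  \<open>det B \<cdot> (B\<^sup>-\<^sup>1)\<^sub>k\<^sub>i\<close>, maximality bounds the entries of the inverse.\<close>

lemma regular_matrix_near:
  fixes N :: "real^'n^'n::finite"
  assumes \<rho>: "0 < \<rho>"
  shows "\<exists>B X. B ** X = mat 1 \<and> X ** B = mat 1 \<and> (\<forall>i j. \<bar>B $ i $ j - N $ i $ j\<bar> \<le> \<rho>) \<and> (\<forall>i j. \<bar>X $ i $ j\<bar> \<le> 1 / \<rho>)"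
proof -
  define S where "S = {B :: real^'n^'n. \<forall>i j. \<bar>B $ i $ j - N $ i $ j\<bar> \<le> \<rho>}"
  have "closed S"
    unfolding S_def by (intro closed_Collect_all closed_Collect_le continuous_intros)
  moreover have "bounded S"
  proof (rule boundedI)
    fix B assume "B \<in> S"
    then have le: "\<bar>B $ i $ j - N $ i $ j\<bar> \<le> \<rho>" for i j by (simp add: S_def)
    have "\<bar>B $ i $ j\<bar> \<le> \<bar>N $ i $ j\<bar> + \<rho>" for i j
      using le[of i j] by linarith
    then show "norm B \<le> (\<Sum>i\<in>UNIV. \<Sum>j\<in>UNIV. \<bar>N $ i $ j\<bar> + \<rho>)"
      by (intro order_trans[OF norm_matrix_le_sum] sum_mono) simp
  qed
  ultimately have "compact S" by (simp add: compact_eq_bounded_closed)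
  moreover have "S \<noteq> {}" using \<rho> by (auto simp: S_def intro!: exI[of _ N])
  moreover have "continuous_on S (\<lambda>B. \<bar>det B\<bar>)" by (intro continuous_intros continuous_on_det)
  ultimately obtain B where B: "B \<in> S" and max: "\<And>B'. B' \<in> S \<Longrightarrow> \<bar>det B'\<bar> \<le> \<bar>det B\<bar>"
    using continuous_attains_sup by metis
  obtain s where s: "0 < s" "s < \<rho>" "det (N + s *\<^sub>R mat 1) \<noteq> 0"
    using nonsingular_shift[OF \<rho>] by blast
  have "N + s *\<^sub>R mat 1 \<in> S" using s \<rho> by (auto simp: S_def mat_def)
  from max[OF this] s(3) have d: "det B \<noteq> 0" by auto
  then obtain X where X: "B ** X = mat 1" "X ** B = mat 1"
    by (auto simp: invertible_det_nz[symmetric] invertible_def)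
  have "\<bar>X $ k $ i\<bar> \<le> 1 / \<rho>" for k i
  proof -
    have key: "\<bar>1 + c * X $ k $ i\<bar> \<le> 1" if c: "\<bar>B $ i $ k + c - N $ i $ k\<bar> \<le> \<rho>" for c
    proof -
      \<comment> \<open>\<open>B'\<close> is \<open>B\<close> with \<open>c\<close> added to the
        entry in row \<open>i\<close> and column \<open>k\<close>. Its column \<open>k\<close> is B
        x for x = e_k + c X e_i, and Cramer's rule makes \<open>x $ k\<close> the ratio of the
        determinants.\<close>
      define x where "x = axis k 1 + c *\<^sub>R (X *v axis i 1)"
      define B' where "B' = (\<chi> r j. if j = k then (B *v x) $ r else B $ r $ j)"
      have Bx: "(B *v x) $ r = B $ r $ k + (if r = i then c else 0)" for r
      proof -
        have "B *v x = B *v axis k 1 + c *\<^sub>R ((B ** X) *v axis i 1)"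
          unfolding x_def by (simp add: matrix_vector_right_distrib matrix_vector_mult_scaleR matrix_vector_mul_assoc)
        moreover have "(B *v axis k 1) $ r = B $ r $ k"
          by (simp add: matrix_vector_mult_basis column_def)
        moreover have "axis i (1::real) $ r = (if r = i then 1 else 0)"
          by (simp add: axis_def)
        ultimately show ?thesis unfolding X by simp
      qed
      have "det B' = x $ k * det B" unfolding B'_def by (rule cramer_lemma)
      moreover have "x $ k = 1 + c * X $ k $ i"
        by (simp add: x_def matrix_vector_mult_basis column_def)
      moreover have "B' \<in> S" using B c by (auto simp: S_def B'_def Bx)
      ultimately have "\<bar>1 + c * X $ k $ i\<bar> * \<bar>det B\<bar> \<le> 1 * \<bar>det B\<bar>"
        using max[of B'] by (simp add: abs_mult)
      then show ?thesis using d by simp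
    qed
    \<comment> \<open>The entry is moved to the two ends of its range. Subtracting the bounds
      isolates \<open>2 * \<rho> * X $ k $ i\<close>, wherever in the cube \<open>B\<close>
      lies.\<close>
    have "\<bar>1 + (N $ i $ k + \<rho> - B $ i $ k) * X $ k $ i\<bar> \<le> 1" "\<bar>1 + (N $ i $ k - \<rho> - B $ i $ k) * X $ k $ i\<bar> \<le> 1"
      using \<rho> by (intro key; simp)+
    then have "\<bar>(1 + (N $ i $ k + \<rho> - B $ i $ k) * X $ k $ i) - (1 + (N $ i $ k - \<rho> - B $ i $ k) * X $ k $ i)\<bar> \<le> 2"
      by linarith
    also have "(1 + (N $ i $ k + \<rho> - B $ i $ k) * X $ k $ i) - (1 + (N $ i $ k - \<rho> - B $ i $ k) * X $ k $ i) = 2 * \<rho> * X $ k $ i"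
      by (simp add: algebra_simps)
    finally have "\<bar>X $ k $ i\<bar> * \<rho> \<le> 1" using \<rho> by (simp add: abs_mult mult.commute)
    then show ?thesis using \<rho> by (simp add: pos_le_divide_eq)
  qed
  then show ?thesis using X B unfolding S_def by blast
qed

section \<open>Partitions of the frequency domain\<close>

lemma freq_bounds: "2 ^ length w \<le> freq w \<and> freq w < 2 ^ Suc (length w)"
  by (induction w) auto

lemma freq_inj: "length w = length w' \<Longrightarrow> freq w = freq w' \<Longrightarrow> w = w'"
proof (induction w w' rule: list_induct2)
  case (Cons b w b' w')
  have "freq (b # w) div 2 = freq w" "freq (b' # w') div 2 = freq w'" by auto
  with Cons have w: "w = w'" by metis
  then have "(if b = odd (freq w) then 0 else 1 :: nat) = (if b' = odd (freq w) then 0 else 1)"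
    using Cons.prems by simp
  then have "b = b'" by (auto split: if_splits)
  with w show ?case by simp
qed simp

text \<open>Words of length n enumerate the integers from 2^n to 2^(n+1) - 1, one binary digit per
  filter; the head is the last digit corrected by the parity of the index of the tail.\<close>

lemma freq_surj: "2 ^ n \<le> q \<Longrightarrow> q < 2 ^ Suc n \<Longrightarrow> \<exists>w. length w = n \<and> freq w = q"
proof (induction n arbitrary: q)
  case 0
  then have "q = 1" by simp
  then show ?case by (intro exI[of _ "[]"]) simp
next
  case (Suc n)
  have "2 ^ n \<le> q div 2" "q div 2 < 2 ^ Suc n" using Suc.prems by auto
  then obtain w where w: "length w = n" "freq w = q div 2" using Suc.IH by blast
  have "freq ((if even q then odd (freq w) else even (freq w)) # w) = q"
    using w(2) by (auto elim!: evenE oddE)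
  then show ?case using w(1) by (intro exI[of _ "(if even q then odd (freq w) else even (freq w)) # w"]) simp
qed

text \<open>Every dyadic shell \<open>2\<^sup>a\<^sup>i \<pi> \<le> \<bar>\<xi>\<^sub>i\<bar> \<le> 2\<^sup>a\<^sup>i\<^sup>+\<^sup>1 \<pi>\<close> is cut into \<open>2\<^sup>K\<^sup>(\<^sup>a\<^sup>)\<close> bands per coordinate.\<close>

definition refines :: "(int^'d::finite \<Rightarrow> nat) \<Rightarrow> int^'d \<Rightarrow> 'd level \<Rightarrow> bool" where
  "refines K a l \<longleftrightarrow> (\<forall>i. length (snd (l $ i)) = K a \<and> fst (l $ i) + int (K a) = a $ i)"

definition refined_levels :: "(int^'d::finite \<Rightarrow> nat) \<Rightarrow> 'd level set" where
  "refined_levels K = {l. \<exists>a. refines K a l}"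

lemma level_scale_inverse: "2 powi (- j) * t \<le> c \<longleftrightarrow> t \<le> 2 powi j * (c::real)"
  "c \<le> 2 powi (- j) * t \<longleftrightarrow> 2 powi j * c \<le> t" "2 powi (- j) * t < c \<longleftrightarrow> t < 2 powi j * c"
  "c < 2 powi (- j) * t \<longleftrightarrow> 2 powi j * c < t"
proof -
  have "(0::real) < 2 powi j" by simp
  then show "2 powi (- j) * t \<le> c \<longleftrightarrow> t \<le> 2 powi j * c" "c \<le> 2 powi (- j) * t \<longleftrightarrow> 2 powi j * c \<le> t"
    "2 powi (- j) * t < c \<longleftrightarrow> t < 2 powi j * c" "c < 2 powi (- j) * t \<longleftrightarrow> 2 powi j * c < t"
    by (simp_all add: power_int_minus field_simps)
qed

lemma lev_shell_iff:
  "\<xi> \<in> lev_shell l \<longleftrightarrow> (\<forall>i. 2 powi fst (l $ i) * (real (lev_freq l i) * pi) \<le> \<bar>\<xi> $ i\<bar> \<and>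
     \<bar>\<xi> $ i\<bar> \<le> 2 powi fst (l $ i) * ((real (lev_freq l i) + 1) * pi))"
  by (simp add: shell_def lev_scale_def abs_mult level_scale_inverse)

lemma lev_open_shell_iff:
  "\<xi> \<in> lev_open_shell l \<longleftrightarrow> (\<forall>i. 2 powi fst (l $ i) * (real (lev_freq l i) * pi) < \<bar>\<xi> $ i\<bar> \<and>
     \<bar>\<xi> $ i\<bar> < 2 powi fst (l $ i) * ((real (lev_freq l i) + 1) * pi))"
  by (simp add: open_shell_def lev_scale_def abs_mult level_scale_inverse)

lemma refines_band:
  assumes "refines K a l"
  shows "2 powi (a $ i) * pi \<le> 2 powi fst (l $ i) * (real (lev_freq l i) * pi)"
    "2 powi fst (l $ i) * ((real (lev_freq l i) + 1) * pi) \<le> 2 powi (a $ i + 1) * pi"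
    "2 powi fst (l $ i) = (2 powi (a $ i) / 2 ^ K a :: real)"
proof -
  let ?j = "fst (l $ i)" and ?q = "lev_freq l i"
  have a: "a $ i = ?j + int (K a)" "length (snd (l $ i)) = K a" using assms by (auto simp: refines_def)
  have n: "2 ^ K a \<le> ?q" "?q + 1 \<le> 2 * 2 ^ K a"
    using freq_bounds[of "snd (l $ i)"] a(2) unfolding lev_freq_def by (simp_all add: Suc_le_eq)
  have "real (2 ^ K a) \<le> real ?q" "real (?q + 1) \<le> real (2 * 2 ^ K a)"
    using n by (simp_all only: of_nat_le_iff)
  then have q: "2 ^ K a \<le> real ?q" "real ?q + 1 \<le> 2 * 2 ^ K a" by simp_all
  have e: "(2::real) powi (a $ i) = 2 powi ?j * 2 ^ K a" "(2::real) powi (a $ i + 1) = 2 powi ?j * (2 * 2 ^ K a)"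
    unfolding a(1) by (simp_all add: power_int_add)
  show "2 powi (a $ i) * pi \<le> 2 powi fst (l $ i) * (real (lev_freq l i) * pi)"
    unfolding e mult.assoc by (intro mult_left_mono mult_right_mono q) auto
  show "2 powi fst (l $ i) * ((real (lev_freq l i) + 1) * pi) \<le> 2 powi (a $ i + 1) * pi"
    unfolding e(2) using q(2) by (subst mult.assoc, intro mult_left_mono mult_right_mono) auto
  show "2 powi fst (l $ i) = (2 powi (a $ i) / 2 ^ K a :: real)"
    unfolding e by simp
qed

lemma dyadic_unique:
  fixes t :: real
  assumes "2 powi a < t" "t < 2 powi (a + 1)" "2 powi b < t" "t < 2 powi (b + 1)"
  shows "a = b"
proof -
  have "(2::real) powi a < 2 powi (b + 1)" "(2::real) powi b < 2 powi (a + 1)" using assms by linarith+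
  then have "a < b + 1" "b < a + 1"
    using power_int_increasing[of "b + 1" a "2::real"] power_int_increasing[of "a + 1" b "2::real"] by force+
  then show ?thesis by simp
qed

text \<open>The moduli of the coordinates determine the dyadic cell \<open>a\<close>, hence the
  depth \<open>K a\<close> and the dilations. The frequency index is then the integer part of a
  rescaled coordinate, and \<open>freq_inj\<close> recovers its word.\<close>

lemma refined_levels_disjoint:
  assumes l: "l \<in> refined_levels K" "l' \<in> refined_levels K" and \<xi>: "\<xi> \<in> lev_open_shell l" "\<xi> \<in> lev_open_shell l'"
  shows "l = l'"
proof -
  obtain a a' where a: "refines K a l" "refines K a' l'" using l by (auto simp: refined_levels_def)
  have "2 powi (b $ i) < \<bar>\<xi> $ i\<bar> / pi \<and> \<bar>\<xi> $ i\<bar> / pi < 2 powi (b $ i + 1)"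
    if m: "refines K b m" "\<xi> \<in> lev_open_shell m" for b m i
  proof -
    have "2 powi fst (m $ i) * (real (lev_freq m i) * pi) < \<bar>\<xi> $ i\<bar>"
      "\<bar>\<xi> $ i\<bar> < 2 powi fst (m $ i) * ((real (lev_freq m i) + 1) * pi)"
      using m(2) unfolding lev_open_shell_iff by blast+
    with refines_band(1,2)[OF m(1), of i]
    have "2 powi (b $ i) * pi < \<bar>\<xi> $ i\<bar>" "\<bar>\<xi> $ i\<bar> < 2 powi (b $ i + 1) * pi"
      by linarith+
    then show ?thesis by (simp add: pos_less_divide_eq pos_divide_less_eq)
  qed
  from this[OF a(1) \<xi>(1)] this[OF a(2) \<xi>(2)] have "a $ i = a' $ i" for i
    using dyadic_unique by blast
  then have aa: "a = a'" by (simp add: vec_eq_iff)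
  have j: "fst (l $ i) = fst (l' $ i)" "length (snd (l $ i)) = length (snd (l' $ i))" for i
  proof -
    have "fst (l $ i) + int (K a) = a $ i" "fst (l' $ i) + int (K a) = a $ i"
      using a unfolding aa refines_def by auto
    then show "fst (l $ i) = fst (l' $ i)" by linarith
    show "length (snd (l $ i)) = length (snd (l' $ i))" using a unfolding aa refines_def by auto
  qed
  have "lev_freq l i = lev_freq l' i" for i
  proof -
    let ?p = "2 powi fst (l' $ i) * pi :: real"
    have p: "0 < ?p" by simp
    have "?p * real (lev_freq l i) < ?p * (real (lev_freq l' i) + 1)" "?p * real (lev_freq l' i) < ?p * (real (lev_freq l i) + 1)"
      using \<xi> unfolding lev_open_shell_iff j by (smt (verit) mult.assoc mult.commute)+
    then have "real (lev_freq l i) < real (lev_freq l' i) + 1" "real (lev_freq l' i) < real (lev_freq l i) + 1"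
      using p by (simp_all only: mult_less_cancel_left_pos)
    then show ?thesis by linarith
  qed
  then have "snd (l $ i) = snd (l' $ i)" for i
    using freq_inj[OF j(2)] unfolding lev_freq_def by blast
  with j(1) show ?thesis by (simp add: vec_eq_iff prod_eq_iff)
qed

text \<open>The cell is read off from binary logarithms, and \<open>y i\<close> measures the
  coordinate in band widths, so its integer part is the frequency index. A zero coordinate lies in
  no dyadic band.\<close>

lemma refined_levels_cover:
  assumes "\<And>i. \<xi> $ i \<noteq> 0"
  shows "\<exists>l\<in>refined_levels K. \<xi> \<in> lev_shell l"
proof -
  define a :: "int^'a" where "a = (\<chi> i. \<lfloor>log 2 (\<bar>\<xi> $ i\<bar> / pi)\<rfloor>)"
  define n where "n = K a"
  define y where "y i = \<bar>\<xi> $ i\<bar> / pi / 2 powi (a $ i - int n)" for i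
  have y: "2 ^ n \<le> y i \<and> y i < 2 ^ Suc n" for i
  proof -
    have t: "0 < \<bar>\<xi> $ i\<bar> / pi" using assms by simp
    have "2 powr (of_int (a $ i)) \<le> \<bar>\<xi> $ i\<bar> / pi" "\<bar>\<xi> $ i\<bar> / pi < 2 powr (of_int (a $ i) + 1)"
      using t floor_correct[of "log 2 (\<bar>\<xi> $ i\<bar> / pi)"] unfolding a_def
      by (simp_all add: le_log_iff[symmetric] log_less_iff[symmetric])
    then have "2 powi (a $ i) \<le> \<bar>\<xi> $ i\<bar> / pi" "\<bar>\<xi> $ i\<bar> / pi < 2 powi (a $ i + 1)"
      by (simp_all add: powr_real_of_int'[of 2 "a $ i"] powr_real_of_int'[of 2 "a $ i + 1", simplified])
    moreover have "(2::real) powi (a $ i) = 2 powi (a $ i - int n) * 2 ^ n"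
      "(2::real) powi (a $ i + 1) = 2 powi (a $ i - int n) * 2 ^ Suc n"
      by (simp_all add: power_int_diff power_int_add)
    ultimately have "2 ^ n * 2 powi (a $ i - int n) \<le> \<bar>\<xi> $ i\<bar> / pi \<and> \<bar>\<xi> $ i\<bar> / pi < 2 ^ Suc n * 2 powi (a $ i - int n)"
      by (simp only: mult.commute)
    moreover have p: "(0::real) < 2 powi (a $ i - int n)" by simp
    ultimately show ?thesis
      unfolding y_def pos_le_divide_eq[OF p] pos_divide_less_eq[OF p] by blast
  qed
  have "\<exists>w. length w = n \<and> freq w = nat \<lfloor>y i\<rfloor>" for i
  proof (rule freq_surj)
    show "2 ^ n \<le> nat \<lfloor>y i\<rfloor>" using y[of i] by (intro le_nat_floor) simp
    have "y i < real (2 ^ Suc n)" using y[of i] by simp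
    moreover have "0 \<le> y i" using y[of i] by (rule order_trans[OF zero_le_power conjunct1, rotated]) simp
    ultimately show "nat \<lfloor>y i\<rfloor> < 2 ^ Suc n" by (simp add: nat_less_iff floor_less_iff)
  qed
  then obtain w where w: "\<And>i. length (w i) = n" "\<And>i. freq (w i) = nat \<lfloor>y i\<rfloor>" by metis
  define l :: "'a level" where "l = (\<chi> i. (a $ i - int n, w i))"
  have "refines K a l" using w(1) by (simp add: refines_def l_def n_def)
  then have "l \<in> refined_levels K" by (auto simp: refined_levels_def)
  moreover have "\<xi> \<in> lev_shell l"
    unfolding lev_shell_iff
  proof
    fix i
    have y0: "0 \<le> y i" using y[of i] by (smt (verit) zero_le_power)
    have q: "real (lev_freq l i) \<le> y i" "y i \<le> real (lev_freq l i) + 1"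
      using y0 unfolding lev_freq_def l_def by (simp_all add: w(2))
    have eq: "\<bar>\<xi> $ i\<bar> = 2 powi fst (l $ i) * (y i * pi)" by (simp add: y_def l_def)
    show "2 powi fst (l $ i) * (real (lev_freq l i) * pi) \<le> \<bar>\<xi> $ i\<bar> \<and>
     \<bar>\<xi> $ i\<bar> \<le> 2 powi fst (l $ i) * ((real (lev_freq l i) + 1) * pi)"
      unfolding eq using q by (intro conjI mult_left_mono mult_right_mono) auto
  qed
  ultimately show ?thesis by blast
qed

subsection \<open>Small oscillation on fine partitions\<close>

text \<open>Signs are removed one coordinate at a time, each by at most one reflection.\<close>

lemma even_abs:
  fixes M :: "real^'d::finite \<Rightarrow> 'b"
  assumes even: "\<And>i \<xi>. M (\<chi> k. if k = i then - (\<xi> $ k) else \<xi> $ k) = M \<xi>"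
  shows "M (\<chi> k. \<bar>\<xi> $ k\<bar>) = M \<xi>"
proof -
  have "M (\<chi> k. if k \<in> S then \<bar>\<xi> $ k\<bar> else \<xi> $ k) = M \<xi>" if "finite S" for S
    using that
  proof (induction S rule: finite_induct)
    case (insert i S)
    let ?y = "\<chi> k. if k \<in> S then \<bar>\<xi> $ k\<bar> else \<xi> $ k"
    show ?case
    proof (cases "0 \<le> \<xi> $ i")
      case True
      then have "(\<chi> k. if k \<in> insert i S then \<bar>\<xi> $ k\<bar> else \<xi> $ k) = ?y" by (auto simp: vec_eq_iff)
      then show ?thesis using insert.IH by simp
    next
      case False
      then have "(\<chi> k. if k \<in> insert i S then \<bar>\<xi> $ k\<bar> else \<xi> $ k) = (\<chi> k. if k = i then - (?y $ k) else ?y $ k)"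
        using insert.hyps by (auto simp: vec_eq_iff)
      then show ?thesis using even[of i ?y] insert.IH by simp
    qed
  qed (simp add: vec_nth_inverse)
  from this[of UNIV] show ?thesis by simp
qed

text \<open>The sample point of a level: the corner nearest to the origin of its box in the positive
  orthant.\<close>

definition lev_corner :: "'d::finite level \<Rightarrow> real^'d" where
  "lev_corner l = (\<chi> i. 2 powi fst (l $ i) * (real (lev_freq l i) * pi))"

lemma lev_corner_in_shell: "lev_corner l \<in> lev_shell l"
  by (simp add: lev_shell_iff lev_corner_def abs_mult)

text \<open>Within one dyadic cell compactness gives uniform continuity of symbol and weight, and
  evenness moves \<xi> into the positive box that contains the corner. The positive lower bound
  \<open>m\<close> of the weight turns absolute errors into relative ones.\<close>

lemma small_oscillation_shell:
  fixes M :: "real^'d::finite \<Rightarrow> complex^'n^'n::finite" and a :: "int^'d"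
  assumes cont: "continuous_on UNIV M" and \<tau>: "0 < \<tau>"
    and even: "\<And>i \<xi>. M (\<chi> k. if k = i then - (\<xi> $ k) else \<xi> $ k) = M \<xi>"
  shows "\<exists>k. \<forall>l. refines (\<lambda>_. k) a l \<longrightarrow> (\<forall>\<xi>\<in>lev_shell l. norm (M \<xi> - M (lev_corner l)) \<le> \<tau> * wgt t \<xi> \<and>
     wgt t \<xi> \<le> 2 * wgt t (lev_corner l) \<and> wgt t (lev_corner l) \<le> 2 * wgt t \<xi>)"
proof -
  \<comment> \<open>Empty words make the whole cell a shell, so the facts about shells apply to
    it.\<close>
  define l0 :: "'d level" where "l0 = (\<chi> i. (a $ i, []))"
  let ?D = "lev_shell l0"
  have D: "\<xi> \<in> ?D \<longleftrightarrow> (\<forall>i. 2 powi (a $ i) * pi \<le> \<bar>\<xi> $ i\<bar> \<and> \<bar>\<xi> $ i\<bar> \<le> 2 powi (a $ i + 1) * pi)" for \<xi>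
    unfolding lev_shell_iff by (simp add: l0_def lev_freq_def power_int_add mult.assoc)
  have compact: "compact ?D"
    by (simp add: compact_eq_bounded_closed closed_shell bounded_shell lev_scale_pos)
  obtain W where W: "0 < W" "\<And>\<xi>. \<xi> \<in> ?D \<Longrightarrow> wgt (- t) \<xi> \<le> W"
    using shell_wgt_bound[of "lev_scale l0" "lev_freq l0" "- t"] lev_scale_pos by blast
  define m where "m = 1 / W"
  have m: "0 < m" "\<xi> \<in> ?D \<Longrightarrow> m \<le> wgt t \<xi>" for \<xi>
  proof -
    show "0 < m" using W by (simp add: m_def)
    assume "\<xi> \<in> ?D"
    from W(2)[OF this] W(1) wgt_pos[of \<xi> t] show "m \<le> wgt t \<xi>"
      unfolding wgt_minus m_def by (simp add: pos_divide_le_eq mult.commute)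
  qed
  have ne: "1 + (norm \<xi>)\<^sup>2 \<noteq> 0" for \<xi> :: "real^'d" by (smt (verit) zero_le_power2)
  have "continuous_on ?D (wgt t)" by (intro continuous_intros) (auto simp: ne)
  then have uw: "uniformly_continuous_on ?D (wgt t)" using compact by (rule compact_uniformly_continuous)
  have uM: "uniformly_continuous_on ?D M"
    using continuous_on_subset[OF cont] compact by (intro compact_uniformly_continuous) auto
  obtain d1 where d1: "0 < d1" "\<And>x y. x \<in> ?D \<Longrightarrow> y \<in> ?D \<Longrightarrow> dist y x < d1 \<Longrightarrow> dist (wgt t y) (wgt t x) < m / 2"
    by (rule uniformly_continuous_onE[OF uw half_gt_zero[OF m(1)]]) (rule that; assumption)
  obtain d2 where d2: "0 < d2" "\<And>x y. x \<in> ?D \<Longrightarrow> y \<in> ?D \<Longrightarrow> dist y x < d2 \<Longrightarrow> dist (M y) (M x) < \<tau> * m"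
    by (rule uniformly_continuous_onE[OF uM mult_pos_pos[OF \<tau> m(1)]]) (rule that; assumption)
  define d where "d = min d1 d2"
  \<comment> \<open>\<open>C\<close> is the sum of the side lengths of an undivided box;
    \<open>k\<close> halvings divide it by 2^k.\<close>
  define C where "C = (\<Sum>i\<in>UNIV. 2 powi (a $ i) * pi)"
  have d: "0 < d" using d1 d2 by (simp add: d_def)
  obtain k where k: "C / d < 2 ^ k" using real_arch_pow[of 2 "C / d"] by auto
  show ?thesis
  proof (intro exI[of _ k] allI impI ballI)
    fix l :: "'d level" and \<xi> assume l: "refines (\<lambda>_. k) a l" and \<xi>: "\<xi> \<in> lev_shell l"
    let ?c = "lev_corner l" and ?y = "\<chi> k. \<bar>\<xi> $ k\<bar>"
    have sub: "lev_shell l \<subseteq> ?D"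
    proof
      fix x assume x: "x \<in> lev_shell l"
      show "x \<in> ?D"
        unfolding D
      proof
        fix i
        show "2 powi (a $ i) * pi \<le> \<bar>x $ i\<bar> \<and> \<bar>x $ i\<bar> \<le> 2 powi (a $ i + 1) * pi"
          using refines_band(1,2)[OF l, of i] x[unfolded lev_shell_iff, rule_format, of i] by linarith
      qed
    qed
    have cD: "?c \<in> ?D" using sub lev_corner_in_shell by blast
    have "?y \<in> lev_shell l" using \<xi> by (simp add: lev_shell_iff)
    then have yD: "?y \<in> ?D" using sub by blast
    have "norm (?y - ?c) \<le> (\<Sum>i\<in>UNIV. \<bar>(?y - ?c) $ i\<bar>)" by (rule norm_le_l1_cart)
    also have "\<dots> \<le> (\<Sum>i\<in>UNIV. 2 powi (a $ i) / 2 ^ k * pi)"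
    proof (rule sum_mono)
      fix i
      let ?j = "2 powi fst (l $ i) :: real" and ?q = "real (lev_freq l i)"
      have "?j * (?q * pi) \<le> \<bar>\<xi> $ i\<bar>" "\<bar>\<xi> $ i\<bar> \<le> ?j * ((?q + 1) * pi)"
        using \<xi> unfolding lev_shell_iff by blast+
      moreover have "?j * ((?q + 1) * pi) = ?j * (?q * pi) + ?j * pi" by (simp add: algebra_simps)
      ultimately have "\<bar>(?y - ?c) $ i\<bar> \<le> ?j * pi" by (simp add: lev_corner_def)
      then show "\<bar>(?y - ?c) $ i\<bar> \<le> 2 powi (a $ i) / 2 ^ k * pi"
        using refines_band(3)[OF l, of i] by simp
    qed
    also have "\<dots> = C / 2 ^ k" by (simp add: C_def sum_divide_distrib)
    also have "\<dots> < d" using k d by (simp add: pos_divide_less_eq mult.commute)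
    finally have dist: "dist ?y ?c < d" by (simp add: dist_norm)
    have norm: "norm ?y = norm \<xi>" by (simp add: norm_vec_def)
    have "dist (wgt t ?y) (wgt t ?c) < m / 2" using d1(2)[OF cD yD] dist by (simp add: d_def)
    \<comment> \<open>Both weights are at least \<open>m\<close>, so a difference below m / 2 keeps
      them within a factor 2 of each other.\<close>
    then have w: "\<bar>wgt t \<xi> - wgt t ?c\<bar> < m / 2" by (simp add: dist_real_def norm)
    have mw: "m \<le> wgt t \<xi>" "m \<le> wgt t ?c" using m(2)[OF yD] m(2)[OF cD] by (simp_all add: norm)
    have "dist (M ?y) (M ?c) < \<tau> * m" using d2(2)[OF cD yD] dist by (simp add: d_def)
    then have "norm (M \<xi> - M ?c) < \<tau> * m" by (simp add: even_abs[of M, OF even] dist_norm)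
    also have "\<dots> \<le> \<tau> * wgt t \<xi>" using mw(1) \<tau> by (intro mult_left_mono) auto
    finally show "norm (M \<xi> - M ?c) \<le> \<tau> * wgt t \<xi> \<and> wgt t \<xi> \<le> 2 * wgt t ?c \<and> wgt t ?c \<le> 2 * wgt t \<xi>"
      using w mw by linarith
  qed
qed

text \<open>The cells are unbounded in number and size, and continuity gives no common depth for
  them; so the depth is chosen cell by cell and \<open>K\<close> is a function.\<close>

lemma small_oscillation:
  fixes M :: "real^'d::finite \<Rightarrow> complex^'n^'n::finite"
  assumes cont: "continuous_on UNIV M" and \<tau>: "0 < \<tau>"
    and even: "\<And>i \<xi>. M (\<chi> k. if k = i then - (\<xi> $ k) else \<xi> $ k) = M \<xi>"
  obtains K where "\<And>l \<xi>. l \<in> refined_levels K \<Longrightarrow> \<xi> \<in> lev_shell l \<Longrightarrow> norm (M \<xi> - M (lev_corner l)) \<le> \<tau> * wgt t \<xi> \<and>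
     wgt t \<xi> \<le> 2 * wgt t (lev_corner l) \<and> wgt t (lev_corner l) \<le> 2 * wgt t \<xi>"
proof -
  obtain K where K: "\<And>a l. refines (\<lambda>_. K a) a l \<Longrightarrow> \<forall>\<xi>\<in>lev_shell l. norm (M \<xi> - M (lev_corner l)) \<le> \<tau> * wgt t \<xi> \<and>
     wgt t \<xi> \<le> 2 * wgt t (lev_corner l) \<and> wgt t (lev_corner l) \<le> 2 * wgt t \<xi>"
    using small_oscillation_shell[OF cont \<tau> even, of _ t] by metis
  have "refines K a l \<Longrightarrow> refines (\<lambda>_. K a) a l" for a and l :: "'d level" by (simp add: refines_def)
  with K show ?thesis by (intro that[of K]) (auto simp: refined_levels_def)
qed

subsection \<open>Negligible sets\<close>

lemma negligible_if_AE_notin: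
  assumes "AE x in lborel. x \<notin> S"
  shows "negligible S"
proof -
  obtain N where N: "N \<in> null_sets lborel" "{x. \<not> x \<notin> S} \<subseteq> N"
    using assms by (auto simp: eventually_ae_filter)
  then have "negligible N" by (simp add: negligible_iff_null_sets null_sets_completionI)
  then show ?thesis using N(2) by (rule_tac negligible_subset) auto
qed

lemma AE_notin_if_negligible:
  assumes "negligible S"
  shows "AE x in lborel. x \<notin> S"
proof -
  have "AE x in lebesgue. x \<notin> S"
    using assms by (intro AE_not_in) (simp add: negligible_iff_null_sets)
  then show ?thesis by (simp add: AE_completion_iff)
qed

text \<open>A finite cover by boxes is measurable, with measure at most its total volume, so it
  serves as an outer approximation for Lebesgue measure.\<close>

lemma riemann_null_negligible:
  assumes "riemann_null S"
  shows "negligible S"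
  unfolding negligible_outer_le
proof (intro allI impI)
  fix e :: real assume "0 < e"
  then obtain D where D: "finite D" "S \<subseteq> (\<Union>(a, b)\<in>D. cbox a b)" "(\<Sum>(a, b)\<in>D. measure lborel (cbox a b)) < e"
    using assms unfolding riemann_null_def by blast
  let ?T = "\<Union>(a, b)\<in>D. cbox a b"
  have "?T \<in> lmeasurable"
    using D(1) by (intro fmeasurable.finite_UN) auto
  moreover have "measure lebesgue ?T \<le> (\<Sum>p\<in>D. measure lebesgue (case p of (a, b) \<Rightarrow> cbox a b))"
    by (rule measure_UNION_le[OF D(1)]) auto
  moreover have "(\<Sum>p\<in>D. measure lebesgue (case p of (a, b) \<Rightarrow> cbox a b)) = (\<Sum>(a, b)\<in>D. measure lborel (cbox a b))"
    by (intro sum.cong) (auto simp: measure_completion)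
  ultimately show "\<exists>T. S \<subseteq> T \<and> T \<in> lmeasurable \<and> measure lebesgue T \<le> e"
    using D(2,3) by (intro exI[of _ ?T]) auto
qed

text \<open>Balls of integer radius exhaust the space, and countably many null sets have a null
  union.\<close>

lemma AE_invertible:
  fixes M :: "real^'d::finite \<Rightarrow> complex^'n^'n::finite"
  assumes "\<And>K. compact K \<Longrightarrow> riemann_null {\<xi> \<in> K. \<not> invertible (M \<xi>)}"
  shows "AE \<xi> in lborel. invertible (M \<xi>)"
proof -
  have "AE \<xi> in lborel. \<forall>n::nat. \<xi> \<notin> {\<xi> \<in> cball 0 (real n). \<not> invertible (M \<xi>)}"
    unfolding AE_all_countable
    by (intro allI AE_notin_if_negligible riemann_null_negligible assms) simp
  then show ?thesis
  proof (rule AE_mp, intro AE_I2 impI)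
    fix \<xi> :: "real^'d" assume *: "\<forall>n::nat. \<xi> \<notin> {\<xi> \<in> cball 0 (real n). \<not> invertible (M \<xi>)}"
    obtain n :: nat where "norm \<xi> \<le> real n" using real_arch_simple by blast
    then show "invertible (M \<xi>)" using *[rule_format, of n] by simp
  qed
qed

lemma AE_all_lev_shell: "AE \<xi> in lborel. \<forall>l. \<xi> \<in> lev_shell l \<longleftrightarrow> \<xi> \<in> lev_open_shell l"
  unfolding AE_all_countable by (intro allI AE_lev_shell)

lemma AE_refined_cover: "AE \<xi> in lborel. \<exists>l\<in>refined_levels K. \<xi> \<in> lev_shell l"
proof -
  have "AE \<xi>::real^'d in lborel. \<forall>i\<in>UNIV. \<xi> $ i \<noteq> 0"
    by (intro AE_finite_allI AE_coord_neq) auto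
  then show ?thesis by eventually_elim (rule refined_levels_cover, simp)
qed

lemma packet_partition_refined: "packet_partition (refined_levels K)"
  unfolding packet_partition_def
proof (intro conjI ballI impI)
  fix l l' assume l: "l \<in> refined_levels K" "l' \<in> refined_levels K" "l \<noteq> l'"
  have "AE \<xi> in lborel. \<xi> \<notin> fourier_support l \<inter> fourier_support l'"
    using AE_all_lev_shell
  proof eventually_elim
    case (elim \<xi>)
    then show ?case
      using refined_levels_disjoint[OF l(1,2)] l(3) fourier_support_subset by blast
  qed
  then show "negligible (fourier_support l \<inter> fourier_support l')" by (rule negligible_if_AE_notin)
next
  have "AE \<xi> in lborel. \<xi> \<notin> - (\<Union>l\<in>refined_levels K. fourier_support l)"
    using AE_all_lev_shell AE_refined_cover[of K]
  proof eventually_elim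
    case (elim \<xi>)
    then show ?case using fourier_support_superset by blast
  qed
  then show "negligible (- (\<Union>l\<in>refined_levels K. fourier_support l))" by (rule negligible_if_AE_notin)
qed

text \<open>Taking the least index in an enumeration of the levels makes the choice measurable. It
  is even because shells are invariant under reflection, and evenness keeps the preconditioned
  function Hermitian. On the null set of points in no shell the value is arbitrary.\<close>

lemma level_selector:
  fixes K :: "int^'d::finite \<Rightarrow> nat"
  obtains lev where "lev \<in> measurable borel (count_space UNIV)" "\<And>\<xi>. lev (- \<xi>) = lev \<xi>"
    "AE \<xi> in lborel. lev \<xi> \<in> refined_levels K \<and> (\<forall>l\<in>refined_levels K. \<xi> \<in> lev_shell l \<longleftrightarrow> l = lev \<xi>)"
proof -
  let ?J = "refined_levels K"
  define lev :: "real^'d \<Rightarrow> 'd level" where "lev \<xi> = from_nat (LEAST n. from_nat n \<in> ?J \<and> \<xi> \<in> lev_shell (from_nat n))" for \<xi>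
  show ?thesis
  proof (rule that[of lev])
    have "(\<lambda>\<xi>::real^'d. LEAST n. from_nat n \<in> ?J \<and> \<xi> \<in> lev_shell (from_nat n)) \<in> measurable borel (count_space UNIV)"
    proof (rule measurable_Least)
      fix n :: nat
      have "Measurable.pred borel (\<lambda>\<xi>::real^'d. \<xi> \<in> lev_shell (from_nat n))"
        by (simp add: pred_def)
      then show "Measurable.pred borel (\<lambda>\<xi>::real^'d. from_nat n \<in> ?J \<and> \<xi> \<in> lev_shell (from_nat n))"
        by (cases "from_nat n \<in> ?J") simp_all
    qed
    then show "lev \<in> measurable borel (count_space UNIV)"
      unfolding lev_def[abs_def] by (rule measurable_compose) simp
    show "lev (- \<xi>) = lev \<xi>" for \<xi> by (simp add: lev_def shell_uminus)
    show "AE \<xi> in lborel. lev \<xi> \<in> ?J \<and> (\<forall>l\<in>?J. \<xi> \<in> lev_shell l \<longleftrightarrow> l = lev \<xi>)"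
      using AE_all_lev_shell AE_refined_cover[of K]
    proof eventually_elim
      case (elim \<xi>)
      from elim(2) obtain l where l: "l \<in> ?J" "\<xi> \<in> lev_shell l" by blast
      have "from_nat (to_nat l) \<in> ?J \<and> \<xi> \<in> lev_shell (from_nat (to_nat l))" using l by simp
      then have lev: "lev \<xi> \<in> ?J \<and> \<xi> \<in> lev_shell (lev \<xi>)"
        unfolding lev_def by (rule LeastI)
      moreover have "l' = lev \<xi>" if "l' \<in> ?J" "\<xi> \<in> lev_shell l'" for l'
        using refined_levels_disjoint[OF that(1), of "lev \<xi>" \<xi>] lev that elim(1) by blast
      ultimately show ?case by blast
    qed
  qed
qed

section \<open>The preconditioned Richardson iteration\<close>

lemma has_fourier_cong_AE:
  assumes T: "has_fourier T g" and ae: "AE \<xi> in lborel. g \<xi> = h \<xi>" and h: "h \<in> borel_measurable borel"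
  shows "has_fourier T h"
  unfolding has_fourier_def
proof (intro conjI allI impI h)
  fix f :: "real^'a \<Rightarrow> complex" assume f: "schwartz f"
  note [measurable] = h schwartz_measurable[OF f] has_fourier_measurable[OF T]
  have ae': "AE \<xi> in lborel. g \<xi> * f \<xi> = h \<xi> * f \<xi>" using ae by eventually_elim simp
  show "integrable lborel (\<lambda>\<xi>. h \<xi> * f \<xi>)"
    by (rule integrable_cong_AE_imp[OF has_fourier_integrable[OF T f]]) (use ae' in auto)
  show "apply_dist T (fourier f) = (LINT \<xi>|lborel. h \<xi> * f \<xi>)"
    unfolding has_fourier_apply[OF T f] by (rule integral_cong_AE) (use ae' in auto)
qed

lemma has_fourier_vec_cong_AE:
  assumes u: "has_fourier_vec u g" and ae: "AE \<xi> in lborel. g \<xi> = h \<xi>" and [measurable]: "h \<in> borel_measurable borel"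
  shows "has_fourier_vec u h"
  unfolding has_fourier_vec_def
proof
  fix i
  have "AE \<xi> in lborel. g \<xi> $ i = h \<xi> $ i" using ae by eventually_elim simp
  then show "has_fourier (u $ i) (\<lambda>\<xi>. h \<xi> $ i)"
    by (rule has_fourier_cong_AE[rotated]) (use u in \<open>auto simp: has_fourier_vec_def\<close>)
qed

lemma has_fourier_matrix_act:
  fixes X :: "real^'n^'n::finite"
  assumes "has_fourier_vec u g"
  shows "has_fourier_vec (matrix_act X u) (\<lambda>\<xi>. cmat X *v g \<xi>)"
  using assms unfolding has_fourier_vec_def matrix_act_def matrix_vector_mult_def
  by (auto intro!: has_fourier_sum has_fourier_scaleR)

text \<open>Orthogonality of the projections turns unconditional convergence of \<open>\<Sum>\<^sub>l P\<^sub>l w\<close> into the vanishing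
  of the mass of \<open>w\<close> outside finitely many levels.\<close>

lemma level_sum_tendsto:
  fixes W :: "real^'d::finite \<Rightarrow> complex^'n::finite"
  assumes W: "sobolev_vfun s W" and lev: "lev \<in> measurable borel (count_space UNIV)"
    and part: "AE \<xi> in lborel. lev \<xi> \<in> J \<and> (\<forall>l\<in>J. \<xi> \<in> lev_shell l \<longleftrightarrow> l = lev \<xi>)"
  shows "((\<lambda>F. sobolev_mass s (\<lambda>\<xi>. W \<xi> - (\<Sum>l\<in>F. indicator (lev_shell l) \<xi> *\<^sub>R W \<xi>))) \<longlongrightarrow> 0) (finite_subsets_at_top J)"
proof -
  note [measurable] = sobolev_vfun_measurable[OF W]
  let ?h = "\<lambda>\<xi>. (wgt s \<xi> * norm (W \<xi>))\<^sup>2"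
  have h: "integrable lborel ?h" using W by (simp add: sobolev_vfun_iff)
  \<comment> \<open>Numbering the levels orders them in a sequence; the mass carried by levels
    beyond \<open>n\<close> is a tail that dominated convergence sends to zero.\<close>
  define c where "c \<xi> = to_nat (lev \<xi>)" for \<xi>
  have [measurable]: "c \<in> measurable borel (count_space UNIV)"
    unfolding c_def[abs_def] using lev by (rule measurable_compose) simp
  let ?t = "\<lambda>n \<xi>. (if n < c \<xi> then 1 else 0) * ?h \<xi>"
  have ti: "integrable lborel (?t n)" for n
    by (rule Bochner_Integration.integrable_bound[OF h]) auto
  have "(\<lambda>n. LINT \<xi>|lborel. ?t n \<xi>) \<longlonglongrightarrow> (LINT \<xi>|(lborel :: (real^'d) measure). (0::real))"
  proof (rule integral_dominated_convergence[OF _ _ h])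
    show "AE \<xi> in lborel. (\<lambda>n. ?t n \<xi>) \<longlonglongrightarrow> 0"
    proof (intro AE_I2 tendsto_eventually)
      fix \<xi>
      show "\<forall>\<^sub>F n in sequentially. ?t n \<xi> = 0"
        unfolding eventually_sequentially by (intro exI[of _ "c \<xi>"]) auto
    qed
  qed auto
  then have lim: "(\<lambda>n. LINT \<xi>|lborel. ?t n \<xi>) \<longlonglongrightarrow> 0" by simp
  show ?thesis
  proof (rule tendstoI)
    fix e :: real assume "0 < e"
    from order_tendstoD(2)[OF lim this] obtain n where n: "(LINT \<xi>|lborel. ?t n \<xi>) < e"
      by (auto simp: eventually_sequentially)
    define F0 where "F0 = {l \<in> J. to_nat l \<le> n}"
    have "finite (to_nat ` F0)" by (rule finite_subset[of _ "{..n}"]) (auto simp: F0_def)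
    then have F0: "finite F0" by (rule finite_imageD) (rule inj_on_subset[OF inj_to_nat], simp)
    have small: "dist (sobolev_mass s (\<lambda>\<xi>. W \<xi> - (\<Sum>l\<in>F. indicator (lev_shell l) \<xi> *\<^sub>R W \<xi>))) 0 < e"
      if F: "finite F" "F0 \<subseteq> F" "F \<subseteq> J" for F
    proof -
      have "sobolev_mass s (\<lambda>\<xi>. W \<xi> - (\<Sum>l\<in>F. indicator (lev_shell l) \<xi> *\<^sub>R W \<xi>)) \<le> (LINT \<xi>|lborel. ?t n \<xi>)"
        unfolding sobolev_mass_def
      proof (rule integral_mono_AE')
        show "AE \<xi> in lborel. (wgt s \<xi> * norm (W \<xi> - (\<Sum>l\<in>F. indicator (lev_shell l) \<xi> *\<^sub>R W \<xi>)))\<^sup>2 \<le> ?t n \<xi>"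
          using part
        proof eventually_elim
          case (elim \<xi>)
          have "(\<Sum>l\<in>F. indicator (lev_shell l) \<xi> *\<^sub>R W \<xi>) = (\<Sum>l\<in>F. if l = lev \<xi> then W \<xi> else 0)"
            using elim F(3) by (intro sum.cong) (auto simp: indicator_def)
          also have "\<dots> = (if lev \<xi> \<in> F then W \<xi> else 0)" using F(1) by simp
          finally have "W \<xi> - (\<Sum>l\<in>F. indicator (lev_shell l) \<xi> *\<^sub>R W \<xi>) = (if lev \<xi> \<in> F then 0 else W \<xi>)" by simp
          moreover have "n < c \<xi>" if "lev \<xi> \<notin> F"
            using that F(2) elim by (auto simp: F0_def c_def not_le[symmetric])
          ultimately show ?case by simp
        qed
      qed (auto intro: ti)
      with n show ?thesis by (simp add: abs_of_nonneg[OF sobolev_mass_nonneg])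
    qed
    show "\<forall>\<^sub>F F in finite_subsets_at_top J. dist (sobolev_mass s (\<lambda>\<xi>. W \<xi> - (\<Sum>l\<in>F. indicator (lev_shell l) \<xi> *\<^sub>R W \<xi>))) 0 < e"
      unfolding eventually_finite_subsets_at_top
    proof (intro exI[of _ F0] conjI allI impI F0)
      show "F0 \<subseteq> J" by (auto simp: F0_def)
    qed (rule small; simp)
  qed
qed

text \<open>On the Fourier side the series multiplies by \<open>X\<close> at the level of the
  frequency. The bound \<open>C / wgt t \<xi>\<close> is what carries order \<open>- t / 2\<close>
  to order \<open>t / 2\<close>; real matrices and an even selector keep the product
  Hermitian.\<close>

lemma preconditioner_has_sum:
  fixes r :: "'d::finite tempered ^ 'n::finite" and X :: "'d level \<Rightarrow> real^'n^'n"
  assumes r: "r \<in> sobolev_vec (- t / 2)" and lev: "lev \<in> measurable borel (count_space UNIV)" "\<And>\<xi>. lev (- \<xi>) = lev \<xi>"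
    and part: "AE \<xi> in lborel. lev \<xi> \<in> J \<and> (\<forall>l\<in>J. \<xi> \<in> lev_shell l \<longleftrightarrow> l = lev \<xi>)"
    and X: "\<And>l \<xi> i j. l \<in> J \<Longrightarrow> \<xi> \<in> lev_shell l \<Longrightarrow> \<bar>X l $ i $ j\<bar> \<le> C / wgt t \<xi>"
    and B: "\<And>l. l \<in> J \<Longrightarrow> pseudo_inverse (B l) = X l"
  obtains w where "sobolev_has_sum (t / 2) (\<lambda>l. matrix_act (pseudo_inverse (B l)) (packet_proj (- t / 2) l r)) J w"
    "has_fourier_vec w (\<lambda>\<xi>. cmat (X (lev \<xi>)) *v ft_vec r \<xi>)" "sobolev_vfun (t / 2) (\<lambda>\<xi>. cmat (X (lev \<xi>)) *v ft_vec r \<xi>)"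
proof -
  let ?W = "\<lambda>\<xi>. cmat (X (lev \<xi>)) *v ft_vec r \<xi>"
  have R: "sobolev_vfun (- t / 2) (ft_vec r)" by (rule sobolev_vec_ft[OF r])
  note [measurable] = sobolev_vfun_measurable[OF R]
  have Wm[measurable]: "?W \<in> borel_measurable borel"
  proof (rule measurable_vec_components)
    fix i
    have [measurable]: "(\<lambda>\<xi>. complex_of_real (X (lev \<xi>) $ i $ j)) \<in> borel_measurable borel" for j
      using lev(1) by (rule measurable_compose) simp
    show "(\<lambda>\<xi>. ?W \<xi> $ i) \<in> borel_measurable borel"
      unfolding matrix_vector_mult_def by simp
  qed
  define c where "c = real CARD('n) * real CARD('n) * C"
  have W: "sobolev_vfun (t / 2) ?W"
    unfolding sobolev_vfun_iff
  proof (intro conjI Wm)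
    have Ri: "integrable lborel (\<lambda>\<xi>. (wgt (- t / 2) \<xi> * norm (ft_vec r \<xi>))\<^sup>2)"
      using R by (simp add: sobolev_vfun_iff)
    show "integrable lborel (\<lambda>\<xi>. (wgt (t / 2) \<xi> * norm (?W \<xi>))\<^sup>2)"
    proof (rule Bochner_Integration.integrable_bound[OF integrable_mult_right[OF Ri, of "c\<^sup>2"]])
      show "AE \<xi> in lborel. norm ((wgt (t / 2) \<xi> * norm (?W \<xi>))\<^sup>2) \<le> norm (c\<^sup>2 * (wgt (- t / 2) \<xi> * norm (ft_vec r \<xi>))\<^sup>2)"
        using part
      proof eventually_elim
        case (elim \<xi>)
        then have l: "lev \<xi> \<in> J" "\<xi> \<in> lev_shell (lev \<xi>)" by auto
        have "norm (?W \<xi>) \<le> real CARD('n) * real CARD('n) * (C / wgt t \<xi>) * norm (ft_vec r \<xi>)"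
          by (rule norm_matrix_vector_le) (use X[OF l] in simp)
        then have "norm (?W \<xi>) \<le> c / wgt t \<xi> * norm (ft_vec r \<xi>)" by (simp add: c_def)
        then have "wgt (t / 2) \<xi> * norm (?W \<xi>) \<le> wgt (t / 2) \<xi> * (c / wgt t \<xi> * norm (ft_vec r \<xi>))"
          by (intro mult_left_mono) auto
        also have "\<dots> = c * (wgt (t / 2) \<xi> / wgt t \<xi> * norm (ft_vec r \<xi>))" by simp
        also have "wgt (t / 2) \<xi> / wgt t \<xi> = wgt (- t / 2) \<xi>"
          by (simp add: powr_diff[symmetric])
        finally have "(wgt (t / 2) \<xi> * norm (?W \<xi>))\<^sup>2 \<le> (c * (wgt (- t / 2) \<xi> * norm (ft_vec r \<xi>)))\<^sup>2"
          by (intro power_mono) auto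
        then show ?case by (simp add: power_mult_distrib)
      qed
    qed measurable
    have "AE \<xi> in lborel. \<forall>i. ft_vec r (- \<xi>) $ i = cnj (ft_vec r \<xi> $ i)" using R by (simp add: sobolev_vfun_iff)
    then show "AE \<xi> in lborel. \<forall>i. ?W (- \<xi>) $ i = cnj (?W \<xi> $ i)"
      by eventually_elim (simp add: matrix_vector_mult_def lev(2))
  qed
  obtain w where w: "has_fourier_vec w ?W" using sobolev_vfun_has_fourier[OF W] by blast
  have "sobolev_has_sum (t / 2) (\<lambda>l. matrix_act (pseudo_inverse (B l)) (packet_proj (- t / 2) l r)) J w"
  proof (rule sobolev_has_sumI[where g = "\<lambda>l \<xi>. indicator (lev_shell l) \<xi> *\<^sub>R ?W \<xi>", OF _ _ w W])
    fix l assume l: "l \<in> J"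
    show "sobolev_vfun (t / 2) (\<lambda>\<xi>. indicator (lev_shell l) \<xi> *\<^sub>R ?W \<xi>)"
      using W by (rule sobolev_vfun_restrict_lev_shell)
    show "has_fourier_vec (matrix_act (pseudo_inverse (B l)) (packet_proj (- t / 2) l r)) (\<lambda>\<xi>. indicator (lev_shell l) \<xi> *\<^sub>R ?W \<xi>)"
      unfolding B[OF l]
    proof (rule has_fourier_vec_cong_AE[OF has_fourier_matrix_act[OF packet_proj_fourier[OF r]]])
      show "AE \<xi> in lborel. cmat (X l) *v (indicator (lev_shell l) \<xi> *\<^sub>R ft_vec r \<xi>) = indicator (lev_shell l) \<xi> *\<^sub>R ?W \<xi>"
        using part
      proof eventually_elim
        case (elim \<xi>)
        then show ?case using l by (cases "\<xi> \<in> lev_shell l") auto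
      qed
    qed measurable
  next
    show "((\<lambda>F. sobolev_mass (t / 2) (\<lambda>\<xi>. ?W \<xi> - (\<Sum>l\<in>F. indicator (lev_shell l) \<xi> *\<^sub>R ?W \<xi>))) \<longlongrightarrow> 0) (finite_subsets_at_top J)"
      by (rule level_sum_tendsto[OF W lev(1) part])
  qed
  then show ?thesis using w W by (rule that)
qed

text \<open>Reflecting all coordinates gives M(-\<xi>) = M(\<xi>), and Hermitian symmetry then
  equates every entry with its conjugate. Hence real constant matrices can approximate the
  symbol.\<close>

lemma real_symbol:
  fixes M :: "real^'d::finite \<Rightarrow> complex^'n^'n::finite"
  assumes "\<And>\<xi> i j. M (- \<xi>) $ i $ j = cnj (M \<xi> $ i $ j)"
    and even: "\<And>i \<xi>. M (\<chi> k. if k = i then - (\<xi> $ k) else \<xi> $ k) = M \<xi>"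
  shows "M \<xi> = cmat (\<chi> i j. Re (M \<xi> $ i $ j))"
proof -
  have "M (- \<xi>) = M \<xi>"
    using even_abs[of M "- \<xi>", OF even] even_abs[of M \<xi>, OF even] by simp
  then have "M \<xi> $ i $ j = cnj (M \<xi> $ i $ j)" for i j using assms(1)[of \<xi> i j] by simp
  then have "of_real (Re (M \<xi> $ i $ j)) = M \<xi> $ i $ j" for i j by (metis Reals_cnj_iff of_real_Re)
  then show ?thesis by (simp add: vec_eq_iff)
qed

text \<open>One choice of levels and matrices for every accuracy \<open>\<tau>\<close>: the matrices are \<open>\<tau>\<close>-close to the symbol and
  their inverses are of size \<open>1 / \<tau>\<close>, both relative to the weight, so \<open>I - M B\<^sup>-\<^sup>1 = (B - M) B\<^sup>-\<^sup>1\<close> stays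
  bounded as \<open>\<tau> \<rightarrow> 0\<close> even where \<open>M\<close> degenerates.\<close>

lemma symbol_approximation:
  fixes M :: "real^'d::finite \<Rightarrow> complex^'n^'n::finite"
  assumes cont: "continuous_on UNIV M" and \<tau>: "0 < \<tau>"
    and herm: "\<And>\<xi> i j. M (- \<xi>) $ i $ j = cnj (M \<xi> $ i $ j)"
    and even: "\<And>i \<xi>. M (\<chi> k. if k = i then - (\<xi> $ k) else \<xi> $ k) = M \<xi>"
  obtains K B X where "\<And>l. B l ** X l = mat 1" "\<And>l. X l ** B l = mat 1"
    "\<And>l \<xi>. l \<in> refined_levels K \<Longrightarrow> \<xi> \<in> lev_shell l \<Longrightarrow>
       norm (M \<xi> - cmat (B l)) \<le> (1 + 2 * real CARD('n) * real CARD('n)) * \<tau> * wgt t \<xi>"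
    "\<And>l \<xi> i j. l \<in> refined_levels K \<Longrightarrow> \<xi> \<in> lev_shell l \<Longrightarrow> \<bar>X l $ i $ j\<bar> \<le> 2 / \<tau> / wgt t \<xi>"
proof -
  obtain K where K: "\<And>l \<xi>. l \<in> refined_levels K \<Longrightarrow> \<xi> \<in> lev_shell l \<Longrightarrow> norm (M \<xi> - M (lev_corner l)) \<le> \<tau> * wgt t \<xi> \<and>
     wgt t \<xi> \<le> 2 * wgt t (lev_corner l) \<and> wgt t (lev_corner l) \<le> 2 * wgt t \<xi>"
    by (rule small_oscillation[OF cont \<tau> even, of t]) (assumption | (rule that; assumption))+
  define N where "N l = (\<chi> i j. Re (M (lev_corner l) $ i $ j))" for l
  have N: "M (lev_corner l) = cmat (N l)" for l unfolding N_def by (rule real_symbol[of M, OF herm even])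
  \<comment> \<open>The radius of the cube carries the weight at the corner, so closeness and the
    inverse bound both become relative to the weight.\<close>
  have "\<exists>B X. B ** X = mat 1 \<and> X ** B = mat 1 \<and> (\<forall>i j. \<bar>B $ i $ j - N l $ i $ j\<bar> \<le> \<tau> * wgt t (lev_corner l)) \<and>
     (\<forall>i j. \<bar>X $ i $ j\<bar> \<le> 1 / (\<tau> * wgt t (lev_corner l)))" for l
    by (rule regular_matrix_near) (use \<tau> wgt_pos[of "lev_corner l" t] in simp)
  then obtain B X where BX: "\<And>l. B l ** X l = mat 1" "\<And>l. X l ** B l = mat 1"
    "\<And>l i j. \<bar>B l $ i $ j - N l $ i $ j\<bar> \<le> \<tau> * wgt t (lev_corner l)" "\<And>l i j. \<bar>X l $ i $ j\<bar> \<le> 1 / (\<tau> * wgt t (lev_corner l))"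
    by metis
  show ?thesis
  proof (rule that[of B X K])
    fix l and \<xi> :: "real^'d" assume l: "l \<in> refined_levels K" "\<xi> \<in> lev_shell l"
    note k = K[OF l]
    \<comment> \<open>Each entry is off by at most \<tau> times the corner weight, which is at most
      twice the weight at \<xi>. Summed over the entries this is the 2 n^2 of the constant; the
      oscillation of \<open>M\<close> adds the 1.\<close>
    have "norm (cmat (N l) - cmat (B l)) \<le> (\<Sum>i\<in>(UNIV::'n set). \<Sum>j\<in>(UNIV::'n set). 2 * \<tau> * wgt t \<xi>)"
    proof (intro order_trans[OF norm_matrix_le_sum] sum_mono)
      fix i j
      have "norm ((cmat (N l) - cmat (B l)) $ i $ j) = \<bar>B l $ i $ j - N l $ i $ j\<bar>"
        by (simp add: norm_minus_commute flip: of_real_diff)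
      also have "\<dots> \<le> \<tau> * wgt t (lev_corner l)" by (rule BX)
      also have "\<dots> \<le> \<tau> * (2 * wgt t \<xi>)" using k \<tau> by (intro mult_left_mono) auto
      finally show "norm ((cmat (N l) - cmat (B l)) $ i $ j) \<le> 2 * \<tau> * wgt t \<xi>" by simp
    qed
    also have "\<dots> = 2 * real CARD('n) * real CARD('n) * \<tau> * wgt t \<xi>" by simp
    finally have "norm (M (lev_corner l) - cmat (B l)) \<le> 2 * real CARD('n) * real CARD('n) * \<tau> * wgt t \<xi>"
      unfolding N .
    moreover have "norm (M \<xi> - cmat (B l)) \<le> norm (M \<xi> - M (lev_corner l)) + norm (M (lev_corner l) - cmat (B l))"
      using norm_triangle_ineq[of "M \<xi> - M (lev_corner l)" "M (lev_corner l) - cmat (B l)"] by simp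
    ultimately show "norm (M \<xi> - cmat (B l)) \<le> (1 + 2 * real CARD('n) * real CARD('n)) * \<tau> * wgt t \<xi>"
      using k by (simp add: distrib_right)
    fix i j
    have "\<tau> * wgt t \<xi> / 2 \<le> \<tau> * wgt t (lev_corner l)" using k \<tau> by simp
    moreover have "0 < \<tau> * wgt t \<xi> / 2" using \<tau> wgt_pos[of \<xi> t] by simp
    ultimately have "1 / (\<tau> * wgt t (lev_corner l)) \<le> 1 / (\<tau> * wgt t \<xi> / 2)"
      using \<tau> wgt_pos[of "lev_corner l" t] wgt_pos[of \<xi> t] by (intro divide_left_mono) simp_all
    then show "\<bar>X l $ i $ j\<bar> \<le> 2 / \<tau> / wgt t \<xi>" using BX(4)[of l i j] by simp
  qed (rule BX)+
qed

text \<open>The \<tau> w in the bound for B - M cancels the 1 / (\<tau> w) in that for the inverse,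
  so the result is blind to how close \<open>M\<close> is to a singular matrix. The two entrywise
  estimates contribute n^2 each.\<close>

lemma residual_bounded:
  fixes B X :: "real^'n^'n::finite" and M :: "complex^'n^'n"
  assumes "B ** X = mat 1" and w: "0 < w" "0 < \<tau>" and "norm (M - cmat B) \<le> c * \<tau> * w" "\<And>i j. \<bar>X $ i $ j\<bar> \<le> 2 / \<tau> / w"
  shows "norm (y - M *v (cmat X *v y)) \<le> (2 * c * real CARD('n) ^ 4) * norm y"
proof -
  have BX: "cmat B *v (cmat X *v y) = y"
    by (simp add: matrix_vector_mul_assoc cmat_mult[symmetric] assms(1) cmat_one)
  have c: "0 \<le> c * \<tau> * w" using assms(4) norm_ge_zero order_trans by blast
  have "y - M *v (cmat X *v y) = (cmat B - M) *v (cmat X *v y)"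
    by (simp add: matrix_vector_mult_diff_rdistrib BX)
  also have "norm \<dots> \<le> real CARD('n) * real CARD('n) * (c * \<tau> * w) * norm (cmat X *v y)"
  proof (rule norm_matrix_vector_le)
    fix i j
    show "norm ((cmat B - M) $ i $ j) \<le> c * \<tau> * w"
      using norm_entry_le[of "cmat B - M" i j] assms(4) by (simp add: norm_minus_commute)
  qed
  also have "\<dots> \<le> real CARD('n) * real CARD('n) * (c * \<tau> * w) * (real CARD('n) * real CARD('n) * (2 / \<tau> / w) * norm y)"
    by (intro mult_left_mono norm_matrix_vector_le mult_nonneg_nonneg c) (use assms(5) in auto)
  also have "\<dots> = (2 * c * real CARD('n) ^ 4) * norm y"
    using w by (simp add: power4_eq_xxxx)
  finally show ?thesis .
qed

text \<open>An invertible \<open>M\<close> is bounded below, and nearby \<open>B n\<close> inherit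
  this: once \<open>k * (N * \<tau> n)\<close> is at most 1/2, the perturbation is absorbed into the
  left-hand side and the inverses stay bounded. An inverse bound of size 1 / \<tau> would only give
  a bounded residual.\<close>

lemma residual_tendsto_zero:
  fixes B X :: "nat \<Rightarrow> real^'n^'n::finite" and M :: "complex^'n^'n"
  assumes inv: "invertible M" and BX: "\<And>n. B n ** X n = mat 1" and \<tau>: "\<tau> \<longlonglongrightarrow> 0"
    and close: "\<And>n. norm (M - cmat (B n)) \<le> \<tau> n"
  shows "(\<lambda>n. y - M *v (cmat (X n) *v y)) \<longlonglongrightarrow> 0"
proof -
  obtain Y where Y: "Y ** M = mat 1" using inv by (auto simp: invertible_def)
  define N where "N = real CARD('n) * real CARD('n)"
  define k where "k = N * norm Y + 1"
  have N: "0 < N" by (simp add: N_def)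
  have k: "0 < k" using N by (simp add: k_def add_nonneg_pos)
  have lower: "norm x \<le> k * norm (M *v x)" for x
  proof -
    have "x = Y *v (M *v x)" by (simp add: matrix_vector_mul_assoc Y)
    also have "norm \<dots> \<le> N * norm Y * norm (M *v x)"
      unfolding N_def by (rule norm_matrix_vector_le) (rule norm_entry_le)
    also have "\<dots> \<le> k * norm (M *v x)" by (intro mult_right_mono) (auto simp: k_def)
    finally show ?thesis .
  qed
  have diff: "norm ((cmat (B n) - M) *v x) \<le> N * \<tau> n * norm x" for n x
    unfolding N_def
  proof (rule norm_matrix_vector_le)
    fix i j
    show "norm ((cmat (B n) - M) $ i $ j) \<le> \<tau> n"
      using norm_entry_le[of "cmat (B n) - M" i j] close[of n] by (simp add: norm_minus_commute)
  qed
  have bound: "norm (y - M *v (cmat (X n) *v y)) \<le> N * \<tau> n * (2 * k * norm y)" if small: "k * (N * \<tau> n) \<le> 1 / 2" for n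
  proof -
    let ?z = "cmat (X n) *v y"
    have Bz: "cmat (B n) *v ?z = y"
      by (simp add: matrix_vector_mul_assoc cmat_mult[symmetric] BX cmat_one)
    have e: "y - M *v ?z = (cmat (B n) - M) *v ?z"
      by (simp add: matrix_vector_mult_diff_rdistrib Bz)
    have "norm (M *v ?z) \<le> norm y + norm ((cmat (B n) - M) *v ?z)"
      unfolding e[symmetric] by (metis norm_minus_commute norm_triangle_sub)
    then have "k * norm (M *v ?z) \<le> k * (norm y + N * \<tau> n * norm ?z)"
      using diff[of n ?z] k by (intro mult_left_mono) auto
    then have "norm ?z \<le> k * norm y + k * (N * \<tau> n) * norm ?z"
      using lower[of ?z] by (simp add: algebra_simps)
    also have "\<dots> \<le> k * norm y + 1 / 2 * norm ?z"
      by (intro add_left_mono mult_right_mono small) auto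
    finally have z: "norm ?z \<le> 2 * k * norm y" by simp
    have "0 \<le> \<tau> n" using close[of n] norm_ge_zero order_trans by blast
    then have "N * \<tau> n * norm ?z \<le> N * \<tau> n * (2 * k * norm y)" using N by (intro mult_left_mono z) auto
    then show ?thesis unfolding e using diff[of n ?z] by linarith
  qed
  have lim: "(\<lambda>n. k * (N * \<tau> n)) \<longlonglongrightarrow> k * (N * 0)" "(\<lambda>n. N * \<tau> n * (2 * k * norm y)) \<longlonglongrightarrow> N * 0 * (2 * k * norm y)"
    by (intro tendsto_intros \<tau>)+
  have "\<forall>\<^sub>F n in sequentially. k * (N * \<tau> n) < 1 / 2"
    using order_tendstoD(2)[OF lim(1), of "1 / 2"] by simp
  then have "\<forall>\<^sub>F n in sequentially. norm (y - M *v (cmat (X n) *v y)) \<le> N * \<tau> n * (2 * k * norm y)"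
    by eventually_elim (intro bound, simp)
  moreover have "(\<lambda>n. N * \<tau> n * (2 * k * norm y)) \<longlonglongrightarrow> 0" using lim(2) by simp
  ultimately show ?thesis by (rule Lim_null_comparison)
qed

theorem theorem8p1:
  fixes t \<epsilon> \<delta> :: real
    and M :: "real^'d::finite \<Rightarrow> complex^'n^'n::finite"
    and A :: "'d tempered ^ 'n \<Rightarrow> 'd tempered ^ 'n"
    and v :: "'d tempered ^ 'n"
  assumes "const_coeff_operator t M A"
    and "\<And>\<xi> i j. M (- \<xi>) $ i $ j = cnj (M \<xi> $ i $ j)"
    and "continuous_on UNIV M"
    and "\<And>K. compact K \<Longrightarrow> riemann_null {\<xi> \<in> K. \<not> invertible (M \<xi>)}"
    and "\<And>i \<xi>. M (\<chi> k. if k = i then - (\<xi> $ k) else \<xi> $ k) = M \<xi>"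
    and "v \<in> sobolev_vec (- t / 2)"
    and "\<epsilon> > 0" and "\<delta> > 0"
  shows "\<exists>J B u r p. packet_partition J \<and> approximates_symbol \<delta> t M J B \<and>
           richardson t A J B v u r \<and>
           u p \<in> sobolev_vec (t / 2) \<and> sobolev_vec_norm (- t / 2) (v - A (u p)) < \<epsilon>"
proof -
  note A = assms(1)[unfolded const_coeff_operator_def]
  define c where "c = 1 + 2 * real CARD('n) * real CARD('n)"
  \<comment> \<open>Dividing by \<open>c\<close>, the constant of
    \<open>symbol_approximation\<close>, keeps every family of matrices within the prescribed
    accuracy \<delta> while \<open>\<tau> n\<close> tends to 0.\<close>
  define \<tau> where "\<tau> n = \<delta> / c / (real n + 1)" for n
  have c: "0 < c" by (simp add: c_def add_pos_nonneg)
  have \<tau>: "0 < \<tau> n" "c * \<tau> n \<le> \<delta>" for n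
    using c assms(8) by (simp_all add: \<tau>_def divide_le_eq mult_left_le)
  have \<tau>lim: "\<tau> \<longlonglongrightarrow> 0"
  proof -
    have "(\<lambda>n. \<delta> / c * (1 / (real n + 1))) \<longlonglongrightarrow> \<delta> / c * 0"
      using LIMSEQ_inverse_real_of_nat by (intro tendsto_intros) (simp add: inverse_eq_divide add.commute)
    then show ?thesis by (simp add: \<tau>_def[abs_def])
  qed
  \<comment> \<open>Everything belonging to one accuracy is bundled, so that a single choice yields
    sequences in \<open>n\<close>.\<close>
  define Q where "Q n K B X lev \<longleftrightarrow> (\<forall>l. B l ** X l = mat 1 \<and> X l ** B l = mat 1) \<and>
     (\<forall>l \<xi>. l \<in> refined_levels K \<longrightarrow> \<xi> \<in> lev_shell l \<longrightarrow> norm (M \<xi> - cmat (B l)) \<le> c * \<tau> n * wgt t \<xi>) \<and>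
     (\<forall>l \<xi> i j. l \<in> refined_levels K \<longrightarrow> \<xi> \<in> lev_shell l \<longrightarrow> \<bar>X l $ i $ j\<bar> \<le> 2 / \<tau> n / wgt t \<xi>) \<and>
     lev \<in> measurable borel (count_space UNIV) \<and> (\<forall>\<xi>. lev (- \<xi>) = lev \<xi>) \<and>
     (AE \<xi> in lborel. lev \<xi> \<in> refined_levels K \<and> (\<forall>l\<in>refined_levels K. \<xi> \<in> lev_shell l \<longleftrightarrow> l = lev \<xi>))"
    for n :: nat and K :: "int^'d \<Rightarrow> nat" and B X :: "'d level \<Rightarrow> real^'n^'n" and lev :: "real^'d \<Rightarrow> 'd level"
  have "\<forall>n. \<exists>K B X lev. Q n K B X lev"
  proof
    fix n
    obtain K B X where 1: "\<And>l. B l ** X l = mat 1" "\<And>l. X l ** B l = mat 1"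
      "\<And>l \<xi>. l \<in> refined_levels K \<Longrightarrow> \<xi> \<in> lev_shell l \<Longrightarrow>
         norm (M \<xi> - cmat (B l)) \<le> (1 + 2 * real CARD('n) * real CARD('n)) * \<tau> n * wgt t \<xi>"
      "\<And>l \<xi> i j. l \<in> refined_levels K \<Longrightarrow> \<xi> \<in> lev_shell l \<Longrightarrow> \<bar>X l $ i $ j\<bar> \<le> 2 / \<tau> n / wgt t \<xi>"
      by (rule symbol_approximation[OF assms(3) \<tau>(1)[of n] assms(2,5), of t]) (assumption | (rule that; assumption))+
    obtain lev where 2: "lev \<in> measurable borel (count_space UNIV)" "\<And>\<xi>. lev (- \<xi>) = lev \<xi>"
      "AE \<xi> in lborel. lev \<xi> \<in> refined_levels K \<and> (\<forall>l\<in>refined_levels K. \<xi> \<in> lev_shell l \<longleftrightarrow> l = lev \<xi>)"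
      by (rule level_selector[of K]) (rule that; assumption)
    have "Q n K B X lev"
      unfolding Q_def by (intro conjI allI impI 1[folded c_def] 2; assumption)
    then show "\<exists>K B X lev. Q n K B X lev" by (intro exI)
  qed
  then obtain K B X lev where Q: "\<And>n. Q n (K n) (B n) (X n) (lev n)"
    unfolding choice_iff by blast
  have BX: "\<And>n l. B n l ** X n l = mat 1" "\<And>n l. X n l ** B n l = mat 1"
    and close: "\<And>n l \<xi>. l \<in> refined_levels (K n) \<Longrightarrow> \<xi> \<in> lev_shell l \<Longrightarrow> norm (M \<xi> - cmat (B n l)) \<le> c * \<tau> n * wgt t \<xi>"
    and Xb: "\<And>n l \<xi> i j. l \<in> refined_levels (K n) \<Longrightarrow> \<xi> \<in> lev_shell l \<Longrightarrow> \<bar>X n l $ i $ j\<bar> \<le> 2 / \<tau> n / wgt t \<xi>"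
    and lev: "\<And>n. lev n \<in> measurable borel (count_space UNIV)" "\<And>n \<xi>. lev n (- \<xi>) = lev n \<xi>"
    and part: "\<And>n. AE \<xi> in lborel. lev n \<xi> \<in> refined_levels (K n) \<and>
       (\<forall>l\<in>refined_levels (K n). \<xi> \<in> lev_shell l \<longleftrightarrow> l = lev n \<xi>)"
    using Q unfolding Q_def by blast+
  let ?J = "\<lambda>n. refined_levels (K n)"
  let ?sum = "\<lambda>n r. sobolev_has_sum (t / 2) (\<lambda>l. matrix_act (pseudo_inverse (B n l)) (packet_proj (- t / 2) l r)) (?J n)"
  have ex: "\<exists>w. ?sum n r w \<and> has_fourier_vec w (\<lambda>\<xi>. cmat (X n (lev n \<xi>)) *v ft_vec r \<xi>)"
    if r: "r \<in> sobolev_vec (- t / 2)" for n r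
    by (rule preconditioner_has_sum[OF r lev(1)[of n] lev(2)[of n] part[of n], where X = "X n" and C = "2 / \<tau> n" and B = "B n"])
      (use Xb pseudo_inverse_eq[OF BX] in auto)
  \<comment> \<open>The preconditioner as a function of the residual, since
    \<open>richardson\<close> applies it to every iterate.\<close>
  define Pre where "Pre n r = (SOME w. ?sum n r w \<and> has_fourier_vec w (\<lambda>\<xi>. cmat (X n (lev n \<xi>)) *v ft_vec r \<xi>))" for n r
  have Pre: "\<And>n r. r \<in> sobolev_vec (- t / 2) \<Longrightarrow> ?sum n r (Pre n r)"
    and PreF: "\<And>n r. r \<in> sobolev_vec (- t / 2) \<Longrightarrow> has_fourier_vec (Pre n r) (\<lambda>\<xi>. cmat (X n (lev n \<xi>)) *v ft_vec r \<xi>)"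
    using someI_ex[OF ex] unfolding Pre_def by simp_all
  have PreS: "Pre n r \<in> sobolev_vec (t / 2)" if "r \<in> sobolev_vec (- t / 2)" for n r
    using Pre[OF that, of n] by (simp add: sobolev_has_sum_def)
  have AS: "A u \<in> sobolev_vec (- t / 2)" if "u \<in> sobolev_vec (t / 2)" for u using A that by blast
  define V where "V = ft_vec v"
  have V: "has_fourier_vec v V" "sobolev_vfun (- t / 2) V" unfolding V_def using sobolev_vec_ft[OF assms(6)] by auto
  note [measurable] = sobolev_vfun_measurable[OF V(2)]
  let ?R = "\<lambda>n \<xi>. V \<xi> - ft_vec (A (Pre n v)) \<xi>"
  have R: "has_fourier_vec (v - A (Pre n v)) (?R n)" "sobolev_vfun (- t / 2) (?R n)" for n
    by (intro has_fourier_vec_diff sobolev_vfun_diff V sobolev_vec_ft[OF AS[OF PreS[OF assms(6)]]])+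
  have R_eq: "AE \<xi> in lborel. ?R n \<xi> = V \<xi> - M \<xi> *v (cmat (X n (lev n \<xi>)) *v V \<xi>)" for n
  proof -
    have "AE \<xi> in lborel. ft_vec (A (Pre n v)) \<xi> = M \<xi> *v ft_vec (Pre n v) \<xi>"
      using A PreS[OF assms(6)] unfolding ft_vec_def by blast
    moreover have "AE \<xi> in lborel. ft_vec (Pre n v) \<xi> = cmat (X n (lev n \<xi>)) *v V \<xi>"
      unfolding V_def by (rule has_fourier_vec_AE[OF sobolev_vec_ft(1)[OF PreS[OF assms(6)]] PreF[OF assms(6)]])
    ultimately show ?thesis by eventually_elim simp
  qed
  have "(\<lambda>n. LINT \<xi>|lborel. (wgt (- t / 2) \<xi> * norm (?R n \<xi>))\<^sup>2) \<longlonglongrightarrow> (LINT \<xi>|(lborel :: (real^'d) measure). 0)"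
  proof (rule integral_dominated_convergence)
    \<comment> \<open>The bound of \<open>residual_bounded\<close>, from which the accuracy has
      cancelled: one majorant serves all \<open>n\<close>.\<close>
    define C where "C = 2 * c * real CARD('n) ^ 4"
    show "integrable lborel (\<lambda>\<xi>. C\<^sup>2 * (wgt (- t / 2) \<xi> * norm (V \<xi>))\<^sup>2)"
      using V(2) by (intro integrable_mult_right) (simp add: sobolev_vfun_iff)
    show "(\<lambda>\<xi>. (wgt (- t / 2) \<xi> * norm (?R n \<xi>))\<^sup>2) \<in> borel_measurable lborel" for n
      using sobolev_vfun_measurable[OF R(2)[of n]] by measurable
    show "AE \<xi> in lborel. norm ((wgt (- t / 2) \<xi> * norm (?R n \<xi>))\<^sup>2) \<le> C\<^sup>2 * (wgt (- t / 2) \<xi> * norm (V \<xi>))\<^sup>2" for n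
      using R_eq[of n] part[of n]
    proof eventually_elim
      case (elim \<xi>)
      then have l: "lev n \<xi> \<in> ?J n" "\<xi> \<in> lev_shell (lev n \<xi>)" by auto
      have "norm (?R n \<xi>) \<le> C * norm (V \<xi>)"
        unfolding elim(1) C_def by (rule residual_bounded[OF BX(1) wgt_pos \<tau>(1) close[OF l] Xb[OF l]])
      then have "wgt (- t / 2) \<xi> * norm (?R n \<xi>) \<le> wgt (- t / 2) \<xi> * (C * norm (V \<xi>))"
        by (intro mult_left_mono) auto
      then have "(wgt (- t / 2) \<xi> * norm (?R n \<xi>))\<^sup>2 \<le> (wgt (- t / 2) \<xi> * (C * norm (V \<xi>)))\<^sup>2"
        by (intro power_mono) auto
      then show ?case by (simp add: power_mult_distrib mult_ac)
    qed
    \<comment> \<open>The exceptional sets depend on \<open>n\<close>; their countable union is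
      null, so the limit can be taken at a fixed frequency.\<close>
    have allR: "AE \<xi> in lborel. \<forall>n. ?R n \<xi> = V \<xi> - M \<xi> *v (cmat (X n (lev n \<xi>)) *v V \<xi>)"
      unfolding AE_all_countable using R_eq by blast
    have inv: "AE \<xi> in lborel. invertible (M \<xi>)"
      by (rule AE_invertible) (rule assms(4))
    have allP: "AE \<xi> in lborel. \<forall>n. lev n \<xi> \<in> ?J n \<and> (\<forall>l\<in>?J n. \<xi> \<in> lev_shell l \<longleftrightarrow> l = lev n \<xi>)"
      unfolding AE_all_countable using part by blast
    show "AE \<xi> in lborel. (\<lambda>n. (wgt (- t / 2) \<xi> * norm (?R n \<xi>))\<^sup>2) \<longlonglongrightarrow> 0"
      using allR allP inv
    proof eventually_elim
      case (elim \<xi>)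
      have l: "lev n \<xi> \<in> ?J n" "\<xi> \<in> lev_shell (lev n \<xi>)" for n using elim(2) by blast+
      have "(\<lambda>n. c * \<tau> n * wgt t \<xi>) \<longlonglongrightarrow> c * 0 * wgt t \<xi>" by (intro tendsto_intros \<tau>lim)
      then have "(\<lambda>n. c * \<tau> n * wgt t \<xi>) \<longlonglongrightarrow> 0" by simp
      from residual_tendsto_zero[OF elim(3) BX(1) this close[OF l], of "V \<xi>"]
      have "(\<lambda>n. ?R n \<xi>) \<longlonglongrightarrow> 0" using elim(1) by simp
      then have "(\<lambda>n. (wgt (- t / 2) \<xi> * norm (?R n \<xi>))\<^sup>2) \<longlonglongrightarrow> (wgt (- t / 2) \<xi> * norm (0 :: complex^'n))\<^sup>2"
        by (intro tendsto_intros)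
      then show ?case by simp
    qed
  qed simp
  then have "(\<lambda>n. sobolev_mass (- t / 2) (?R n)) \<longlonglongrightarrow> 0" by (simp add: sobolev_mass_def)
  then have "\<forall>\<^sub>F n in sequentially. sobolev_mass (- t / 2) (?R n) < \<epsilon>\<^sup>2"
    using assms(7) by (intro order_tendstoD(2)) auto
  then obtain n where n: "sobolev_mass (- t / 2) (?R n) < \<epsilon>\<^sup>2" by (auto simp: eventually_sequentially)
  have small: "sobolev_vec_norm (- t / 2) (v - A (Pre n v)) < \<epsilon>"
    unfolding sobolev_vec_norm_eq[OF R] using n assms(7) by (intro real_less_lsqrt sobolev_mass_nonneg) auto
  \<comment> \<open>With \<open>n\<close> fixed the residuals are the powers of one map on the space
    of order \<open>- t / 2\<close>. The sequences are built for every \<open>p\<close>, and the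
    estimate is read off at \<open>p = 1\<close>.\<close>
  define r where "r p = ((\<lambda>r. r - A (Pre n r)) ^^ p) v" for p
  define u where "u p = (\<Sum>q<p. Pre n (r q))" for p
  have rS: "r p \<in> sobolev_vec (- t / 2)" for p
  proof (induction p)
    case 0
    show ?case using assms(6) by (simp add: r_def)
  next
    case (Suc p)
    have "r p - A (Pre n (r p)) \<in> sobolev_vec (- t / 2)"
      by (rule sobolev_vec_memI[OF has_fourier_vec_diff sobolev_vfun_diff])
        (rule sobolev_vec_ft[OF Suc.IH] sobolev_vec_ft[OF AS[OF PreS[OF Suc.IH]]])+
    then show ?case by (simp add: r_def)
  qed
  have "packet_partition (?J n)" by (rule packet_partition_refined)
  moreover have "approximates_symbol \<delta> t M (?J n) (B n)"
    unfolding approximates_symbol_def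
  proof (intro ballI)
    fix l \<xi> assume l: "l \<in> ?J n" "\<xi> \<in> fourier_support l"
    have "norm (M \<xi> - cmat (B n l)) \<le> c * \<tau> n * wgt t \<xi>"
      using close[OF l(1)] fourier_support_subset l(2) by blast
    also have "\<dots> \<le> \<delta> * wgt t \<xi>" using \<tau>(2) by (intro mult_right_mono) auto
    finally show "norm (M \<xi> - cmat (B n l)) \<le> \<delta> * wgt t \<xi>" .
  qed
  moreover have "richardson t A (?J n) (B n) v u r"
    unfolding richardson_def
  proof (intro conjI allI)
    show "u 0 = 0" "r 0 = v" by (simp_all add: u_def r_def)
    fix p
    have u: "u (Suc p) = u p + Pre n (r p)" by (simp add: u_def)
    then show "\<exists>w. ?sum n (r p) w \<and> u (Suc p) = u p + w" using Pre[OF rS] by blast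
    show "r (Suc p) = r p - A (u (Suc p) - u p)" unfolding u by (simp add: r_def)
  qed
  moreover have u1: "u 1 = Pre n v" by (simp add: u_def r_def)
  then have "u 1 \<in> sobolev_vec (t / 2)" "sobolev_vec_norm (- t / 2) (v - A (u 1)) < \<epsilon>"
    using PreS[OF assms(6)] small by simp_all
  ultimately show ?thesis by blast
qed

end
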